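(* Let $(G,\mu)$ be a weighted graph satisfying the condition $(p_0)$, the polynomial volume growth condition $(\mathrm{V}(d_f))$, the Poincaré inequality $(\mathrm{PI}(d_w))$ and the capacity upper bound $(\mathrm{Cap}(d_w)_{\le})$, where $d_f<1+d_w$. Then $(G,\mu)$ satisfies the two-sided sub-Gaussian heat kernel bounds: there exist $C,c>0$ such that \[ h_n(x,y) \le \frac{C}{V_G(x,n^{1/d_w})} \exp\left[-\left(\frac{d_G(x,y)^{d_w}}{Cn}\right)^{\frac{1}{d_w-1}}\right] \quad \forall n\ge 1,\ \forall x,y\in V, \] and \[ h_n(x,y)+h_{n+1}(x,y) \ge \frac{c}{V_G(x,n^{1/d_w})} \exp\left[-\left(\frac{d_G(x,y)^{d_w}}{cn}\right)^{\frac{1}{d_w-1}}\right] \quad \forall x,y\in V,\ \forall n\ge 1\vee d_G(x,y). \]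
   Context: $G=(V,E)$ is an infinite, locally finite, connected graph with graph metric $d_G$; $x\sim y$ means $\{x,y\}\in E$. A weight is a symmetric function $\mu:V\times V\to[0,\infty)$ with $\mu(x,y)>0$ iff $x\sim y$; set $\mu_x=\sum_y \mu(x,y)$, $\mu(A)=\sum_{x\in A}\mu_x$, $B_G(x,r)=\{y: d_G(x,y)\le r\}$, $V_G(x,r)=\mu(B_G(x,r))$. Let $p(x,y)=\mu(x,y)/\mu_x$, let $(X_n)$ be the Markov chain with transition probabilities $p(x,y)$, $p_n(x,y)=\mathbb P^x(X_n=y)$, and $h_n(x,y)=p_n(x,y)/\mu_y$. $(p_0)$: there is $p_0>0$ with $p(x,y)\ge p_0$ whenever $x\sim y$. $(\mathrm{V}(d_f))$: there is $C_V>1$ with $C_V^{-1}r^{d_f}\le V_G(x,r)\le C_V r^{d_f}$ for all $x\in V$, $r\ge1$. Energy: $\mathcal E_G(f,f)=\frac12\sum_{x,y}(f(x)-f(y))^2\mu(x,y)$; capacity $\mathrm{Cap}_G(A,B)=\inf\{\mathcal E_G(f,f): f\in\mathbb R^V, f|_A\equiv1, f|_B\equiv 0\}$. $(\mathrm{Cap}(d_w)_{\le})$: there is $C>1$ with $\mathrm{Cap}_G(B_G(x,r),B_G(x,2r)^c)\le C V_G(x,r)/r^{d_w}$ for all $x\in V$, $r>0$. $(\mathrm{PI}(d_w))$: there is $C_P>1$ such that for every $x_0\in V$, $r\ge0$, $f\in\mathbb R^V$, with $B=B_G(x_0,r)$ and $f_B=\mu(B)^{-1}\sum_{x\in B}f(x)\mu_x$,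 $\sum_{x\in B}(f(x)-f_B)^2\mu_x\le C_P r^{d_w}\sum_{x,y\in B_G(x_0,2r),\,x\sim y}(f(x)-f(y))^2\mu(x,y)$. *)

theory Defs
  imports "HOL-Analysis.Analysis"
begin

definition weighted_graph :: "('a \<Rightarrow> 'a \<Rightarrow> bool) \<Rightarrow> ('a \<Rightarrow> 'a \<Rightarrow> real) \<Rightarrow> bool" where
  "weighted_graph adj mu \<longleftrightarrow>
     infinite (UNIV :: 'a set) \<and>
     (\<forall>x y. adj x y \<longleftrightarrow> adj y x) \<and> (\<forall>x. \<not> adj x x) \<and>
     (\<forall>x. finite {y. adj x y}) \<and>
     (\<forall>x y. adj\<^sup>*\<^sup>* x y) \<and>
     (\<forall>x y. mu x y = mu y x) \<and> (\<forall>x y. mu x y \<ge> 0) \<and>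
     (\<forall>x y. mu x y > 0 \<longleftrightarrow> adj x y)"

definition dG :: "('a \<Rightarrow> 'a \<Rightarrow> bool) \<Rightarrow> 'a \<Rightarrow> 'a \<Rightarrow> nat" where
  "dG adj x y = (LEAST n. (adj ^^ n) x y)"

definition ball_G :: "('a \<Rightarrow> 'a \<Rightarrow> bool) \<Rightarrow> 'a \<Rightarrow> real \<Rightarrow> 'a set" where
  "ball_G adj x r = {y. real (dG adj x y) \<le> r}"

definition muv :: "('a \<Rightarrow> 'a \<Rightarrow> bool) \<Rightarrow> ('a \<Rightarrow> 'a \<Rightarrow> real) \<Rightarrow> 'a \<Rightarrow> real" where
  "muv adj mu x = (\<Sum>y\<in>{y. adj x y}. mu x y)"

definition muset :: "('a \<Rightarrow> 'a \<Rightarrow> bool) \<Rightarrow> ('a \<Rightarrow> 'a \<Rightarrow> real) \<Rightarrow> 'a set \<Rightarrow> real" where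
  "muset adj mu A = (\<Sum>x\<in>A. muv adj mu x)"

definition VG :: "('a \<Rightarrow> 'a \<Rightarrow> bool) \<Rightarrow> ('a \<Rightarrow> 'a \<Rightarrow> real) \<Rightarrow> 'a \<Rightarrow> real \<Rightarrow> real" where
  "VG adj mu x r = muset adj mu (ball_G adj x r)"

definition ptr :: "('a \<Rightarrow> 'a \<Rightarrow> bool) \<Rightarrow> ('a \<Rightarrow> 'a \<Rightarrow> real) \<Rightarrow> 'a \<Rightarrow> 'a \<Rightarrow> real" where
  "ptr adj mu x y = mu x y / muv adj mu x"

fun pn :: "('a \<Rightarrow> 'a \<Rightarrow> bool) \<Rightarrow> ('a \<Rightarrow> 'a \<Rightarrow> real) \<Rightarrow> nat \<Rightarrow> 'a \<Rightarrow> 'a \<Rightarrow> real" where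
  "pn adj mu 0 x y = (if x = y then 1 else 0)"
| "pn adj mu (Suc n) x y = (\<Sum>z\<in>{z. adj x z}. ptr adj mu x z * pn adj mu n z y)"

definition hn :: "('a \<Rightarrow> 'a \<Rightarrow> bool) \<Rightarrow> ('a \<Rightarrow> 'a \<Rightarrow> real) \<Rightarrow> nat \<Rightarrow> 'a \<Rightarrow> 'a \<Rightarrow> real" where
  "hn adj mu n x y = pn adj mu n x y / muv adj mu y"

definition energy :: "('a \<Rightarrow> 'a \<Rightarrow> real) \<Rightarrow> ('a \<Rightarrow> real) \<Rightarrow> ennreal" where
  "energy mu f = (\<Sum>\<^sub>\<infinity>(x,y)\<in>UNIV. ennreal ((f x - f y)^2 * mu x y)) / 2"

definition capG :: "('a \<Rightarrow> 'a \<Rightarrow> real) \<Rightarrow> 'a set \<Rightarrow> 'a set \<Rightarrow> ennreal" where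
  "capG mu A B = (INF f \<in> {f. (\<forall>x\<in>A. f x = 1) \<and> (\<forall>x\<in>B. f x = 0)}. energy mu f)"

definition cond_p0 :: "('a \<Rightarrow> 'a \<Rightarrow> bool) \<Rightarrow> ('a \<Rightarrow> 'a \<Rightarrow> real) \<Rightarrow> bool" where
  "cond_p0 adj mu \<longleftrightarrow> (\<exists>p0>0. \<forall>x y. adj x y \<longrightarrow> ptr adj mu x y \<ge> p0)"

definition cond_V :: "('a \<Rightarrow> 'a \<Rightarrow> bool) \<Rightarrow> ('a \<Rightarrow> 'a \<Rightarrow> real) \<Rightarrow> real \<Rightarrow> bool" where
  "cond_V adj mu df \<longleftrightarrow> (\<exists>CV>1. \<forall>x. \<forall>r\<ge>1.
      r powr df / CV \<le> VG adj mu x r \<and> VG adj mu x r \<le> CV * r powr df)"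

definition cond_Cap_le :: "('a \<Rightarrow> 'a \<Rightarrow> bool) \<Rightarrow> ('a \<Rightarrow> 'a \<Rightarrow> real) \<Rightarrow> real \<Rightarrow> bool" where
  "cond_Cap_le adj mu dw \<longleftrightarrow> (\<exists>C>1. \<forall>x. \<forall>r>0.
      capG mu (ball_G adj x r) (- ball_G adj x (2 * r)) \<le> ennreal (C * VG adj mu x r / r powr dw))"

definition cond_PI :: "('a \<Rightarrow> 'a \<Rightarrow> bool) \<Rightarrow> ('a \<Rightarrow> 'a \<Rightarrow> real) \<Rightarrow> real \<Rightarrow> bool" where
  "cond_PI adj mu dw \<longleftrightarrow> (\<exists>CP>1. \<forall>x0. \<forall>r\<ge>0. \<forall>f :: 'a \<Rightarrow> real.
      (let B = ball_G adj x0 r;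
           fB = (\<Sum>x\<in>B. f x * muv adj mu x) / muset adj mu B
       in (\<Sum>x\<in>B. (f x - fB)^2 * muv adj mu x)
          \<le> CP * r powr dw * (\<Sum>(x,y)\<in>{(x,y). x \<in> ball_G adj x0 (2*r) \<and> y \<in> ball_G adj x0 (2*r) \<and> adj x y}.
                (f x - f y)^2 * mu x y)))"

end

theory Submission
  imports Defs
begin

text \<open>
  Write \<open>a = d\<^sub>f\<close> and \<open>b = d\<^sub>w\<close>.  The Poincare inequality, summed over all centres, gives a Nash
  inequality, hence \<open>h\<^sub>n \<le> C n\<^sup>-\<^sup>a\<^sup>/\<^sup>b\<close>; spectral monotonicity gives \<open>\<bar>h\<^sub>n - h\<^sub>n\<^sub>+\<^sub>2\<bar> \<le> C n\<^sup>-\<^sup>1\<^sup>-\<^sup>a\<^sup>/\<^sup>b\<close>.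

  The heart of the matter is a weak Harnack inequality for a superharmonic \<open>u \<ge> 0\<close> with \<open>u \<ge> 1\<close> on a
  fixed fraction of a ball of radius \<open>R\<close> about \<open>x\<close>.  By the minimum principle there is at each
  distance \<open>n \<le> R\<close> a point where \<open>u \<le> u x\<close>.  Because \<open>a < 1 + b\<close>, the Poincare inequality bounds the
  capacity between such a one-dimensional family of points and a set of positive density from below by
  \<open>c R\<^sup>a\<^sup>-\<^sup>b\<close>, while the capacity condition bounds the energy of \<open>ln u\<close> from above by \<open>C R\<^sup>a\<^sup>-\<^sup>b\<close>.  Hence
  \<open>ln u x\<close> is bounded below.

  Applied to the mean exit time from a ball this gives \<open>E \<tau> \<ge> c R\<^sup>b\<close> at the centre, whence by chaining
  the sub-Gaussian tail and the off-diagonal upper bound.  Applied to \<open>h\<^sub>n + h\<^sub>n\<^sub>+\<^sub>1\<close>, corrected by a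
  multiple of the exit time, it gives oscillation decay, hence the near-diagonal lower bound; chaining
  along geodesics finishes the proof.
\<close>

section \<open>The graph metric and the random walk\<close>

text \<open>Two obstacles shape the proof. The capacity condition controls the total energy of a
  cutoff \<open>\<phi>\<close>, not energies weighted by another function, as iteration schemes for
  harmonic functions would require. Testing superharmonicity of \<open>v\<close> against
  \<open>\<phi>^2 / v\<close> meets this limit: the weight disappears into \<open>ln v\<close> and
  only the total energy of \<open>\<phi>\<close> remains. What an iteration would have supplied, a
  passage from energies to point values, is replaced by the fact that below dimension
  \<open>1 + b\<close> a set meeting every sphere up to radius \<open>R\<close> carries capacity of
  the same order as the whole ball. The other obstacle is parity. On a bipartite graph
  \<open>h n x\<close> vanishes on half of the vertices, so smoothness and positivity in space are
  stated for \<open>h n + h (n + 1)\<close>, and comparison in time is between \<open>n\<close> and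
  \<open>n + 2\<close>. Probability and spectral theory enter in finite form. Expected truncated
  exit times and exit probabilities are given by recursion on the one-step operator
  \<open>P\<close>, and monotonicity in time comes from writing even differences of the diagonal
  heat kernel as squared norms.\<close>

locale wgraph =
  fixes adj :: "'a \<Rightarrow> 'a \<Rightarrow> bool" and mu :: "'a \<Rightarrow> 'a \<Rightarrow> real"
  assumes wg: "weighted_graph adj mu"
begin

abbreviation d :: "'a \<Rightarrow> 'a \<Rightarrow> nat" where "d \<equiv> dG adj"
abbreviation B :: "'a \<Rightarrow> real \<Rightarrow> 'a set" where "B \<equiv> ball_G adj"
abbreviation m :: "'a \<Rightarrow> real" where "m \<equiv> muv adj mu"
abbreviation V :: "'a \<Rightarrow> real \<Rightarrow> real" where "V \<equiv> VG adj mu"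
abbreviation p :: "nat \<Rightarrow> 'a \<Rightarrow> 'a \<Rightarrow> real" where "p \<equiv> pn adj mu"
abbreviation h :: "nat \<Rightarrow> 'a \<Rightarrow> 'a \<Rightarrow> real" where "h \<equiv> hn adj mu"

lemma infinite_vertices: "infinite (UNIV :: 'a set)"
  and adj_sym: "adj x y \<longleftrightarrow> adj y x"
  and adj_irrefl: "\<not> adj x x"
  and finite_adj: "finite {y. adj x y}"
  and connected: "adj\<^sup>*\<^sup>* x y"
  and mu_sym: "mu x y = mu y x"
  and mu_nonneg: "mu x y \<ge> 0"
  and mu_pos_iff: "mu x y > 0 \<longleftrightarrow> adj x y"
  using wg unfolding weighted_graph_def by blast+

lemma mu_zero: "\<not> adj x y \<Longrightarrow> mu x y = 0"
  using mu_nonneg[of x y] mu_pos_iff[of x y] by linarith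

lemma path_d: "(adj ^^ d x y) x y"
proof -
  have "\<exists>n. (adj ^^ n) x y"
    using connected[of x y] by (simp add: rtranclp_power)
  then show ?thesis unfolding dG_def by (rule LeastI_ex)
qed

lemma d_le: "(adj ^^ n) x y \<Longrightarrow> d x y \<le> n"
  unfolding dG_def by (rule Least_le)

lemma d_self [simp]: "d x x = 0"
  using d_le[of 0 x x] by simp

lemma d_eq_0 [simp]: "d x y = 0 \<longleftrightarrow> x = y"
  using path_d[of x y] by auto

lemma d_triangle: "d x z \<le> d x y + d y z"
proof (rule d_le)
  show "(adj ^^ (d x y + d y z)) x z"
    unfolding relpowp_add using path_d by blast
qed

lemma relpowp_adj_sym: "(adj ^^ n) x y \<Longrightarrow> (adj ^^ n) y x"
proof (induction n arbitrary: x y)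
  case (Suc n)
  then obtain z where "(adj ^^ n) x z" "adj z y" by (auto elim: relpowp_Suc_E)
  then have "adj y z" "(adj ^^ n) z x" using Suc.IH adj_sym by auto
  then show ?case by (rule relpowp_Suc_I2)
qed auto

lemma d_sym: "d x y = d y x"
  using d_le path_d relpowp_adj_sym by (meson le_antisym)

lemma d_adj: "adj x y \<Longrightarrow> d x y = 1"
proof -
  assume a: "adj x y"
  have "d x y \<le> 1" using a by (intro d_le) (auto simp: relpowp_1)
  moreover have "d x y \<noteq> 0" using a adj_irrefl by auto
  ultimately show ?thesis by linarith
qed

lemma d_adj_le: "adj y z \<Longrightarrow> d x z \<le> d x y + 1"
  using d_triangle[of x z y] d_adj[of y z] by linarith

lemma d_1_adj: "d x y = 1 \<Longrightarrow> adj x y"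
  using path_d[of x y] relpowp_1[of adj] by simp

lemma geodesic_point:
  assumes "n \<le> d x y"
  obtains z where "d x z = n" "d z y = d x y - n"
proof -
  have "(adj ^^ (n + (d x y - n))) x y" using path_d[of x y] assms by simp
  then obtain z where z: "(adj ^^ n) x z" "(adj ^^ (d x y - n)) z y"
    unfolding relpowp_add by blast
  have "d x z \<le> n" "d z y \<le> d x y - n" using z by (auto intro: d_le)
  with d_triangle[of x y z] assms have "d x z = n" "d z y = d x y - n" by linarith+
  then show ?thesis using that by blast
qed

lemma finite_d_ball: "finite {y. d x y \<le> n}"
proof (induction n)
  case 0
  then show ?case by simp
next
  case (Suc n)
  have "{y. d x y \<le> Suc n} \<subseteq> {y. d x y \<le> n} \<union> (\<Union>z\<in>{y. d x y \<le> n}. {y. adj z y})"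
  proof
    fix y assume y: "y \<in> {y. d x y \<le> Suc n}"
    show "y \<in> {y. d x y \<le> n} \<union> (\<Union>z\<in>{y. d x y \<le> n}. {y. adj z y})"
    proof (cases "d x y \<le> n")
      case False
      then obtain z where "d x z = n" "d z y = d x y - n"
        using geodesic_point[of n x y] by auto
      then show ?thesis using False y d_1_adj[of z y] by auto
    qed auto
  qed
  then show ?case by (rule finite_subset) (use Suc finite_adj in auto)
qed

lemma mem_B: "y \<in> B x r \<longleftrightarrow> real (d x y) \<le> r"
  by (simp add: ball_G_def)

lemma finite_B [simp]: "finite (B x r)"
proof (rule finite_subset[OF _ finite_d_ball[of x "nat \<lceil>r\<rceil>"]])
  show "B x r \<subseteq> {y. d x y \<le> nat \<lceil>r\<rceil>}"
    by (auto simp: mem_B) linarith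
qed

lemma center_B [simp]: "0 \<le> r \<Longrightarrow> x \<in> B x r"
  by (simp add: mem_B)

lemma B_subset: "real (d x y) + r \<le> s \<Longrightarrow> B y r \<subseteq> B x s"
proof
  fix z assume "real (d x y) + r \<le> s" "z \<in> B y r"
  then show "z \<in> B x s" using d_triangle[of x z y] by (simp add: mem_B)
qed

lemma B_mono: "r \<le> s \<Longrightarrow> B x r \<subseteq> B x s"
  by (rule B_subset) simp

lemma B_small: "0 \<le> r \<Longrightarrow> r < 1 \<Longrightarrow> B x r = {x}"
proof (auto simp: mem_B)
  fix y assume "r < 1" "real (d x y) \<le> r"
  then have "d x y = 0" by linarith
  then show "y = x" by simp
qed

lemma nbr_B: "y \<in> B x r \<Longrightarrow> adj y z \<Longrightarrow> z \<in> B x (r + 1)"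
  using d_adj_le[of y z x] by (simp add: mem_B)

text \<open>Balls are finite and the vertex set is infinite, so some vertex lies beyond any given
  distance, and a geodesic to it crosses every smaller sphere.\<close>

lemma ex_sphere: obtains y where "d x y = n"
proof -
  have "\<exists>y. \<not> d x y \<le> n"
    using finite_d_ball[of x n] infinite_vertices by (metis UNIV_eq_I mem_Collect_eq)
  then obtain y where "n \<le> d x y" using nat_le_linear by blast
  then show ?thesis using geodesic_point that by metis
qed

lemma ex_adj: obtains y where "adj x y"
  using ex_sphere[of x 1] d_1_adj by metis

lemma m_pos: "m x > 0"
proof -
  obtain y where "adj x y" by (rule ex_adj)
  then show ?thesis unfolding muv_def
    using mu_pos_iff mu_nonneg finite_adj by (intro sum_pos2[of _ y]) auto
qed

lemma m_nz [simp]: "m x \<noteq> 0" using m_pos[of x] by simp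
lemma m_nonneg [simp]: "m x \<ge> 0" using m_pos[of x] by simp

lemma m_sum: "finite Z \<Longrightarrow> {y. adj x y} \<subseteq> Z \<Longrightarrow> m x = (\<Sum>y\<in>Z. mu x y)"
  unfolding muv_def by (rule sum.mono_neutral_left) (auto simp: mu_zero)

lemma m_ge_sum: "finite Z \<Longrightarrow> (\<Sum>y\<in>Z. mu x y) \<le> m x"
proof -
  assume "finite Z"
  then have "m x = (\<Sum>y\<in>Z \<union> {y. adj x y}. mu x y)"
    using finite_adj by (intro m_sum) auto
  also have "\<dots> \<ge> (\<Sum>y\<in>Z. mu x y)"
    using \<open>finite Z\<close> finite_adj mu_nonneg by (intro sum_mono2) auto
  finally show ?thesis .
qed

lemma V_eq_sum: "V x r = (\<Sum>y\<in>B x r. m y)"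
  by (simp add: VG_def muset_def)

lemma V_mono: "B x r \<subseteq> B y s \<Longrightarrow> V x r \<le> V y s"
  unfolding V_eq_sum by (rule sum_mono2) auto

lemma V_pos: "0 \<le> r \<Longrightarrow> V x r > 0"
  unfolding V_eq_sum using m_pos by (intro sum_pos2[of _ x]) auto

section \<open>The transition operator and the heat kernel\<close>

definition P :: "('a \<Rightarrow> real) \<Rightarrow> 'a \<Rightarrow> real" where
  "P f x = (\<Sum>y\<in>{y. adj x y}. ptr adj mu x y * f y)"

lemma ptr_nonneg: "ptr adj mu x y \<ge> 0"
  by (simp add: ptr_def mu_nonneg)

lemma m_P: "finite Z \<Longrightarrow> {y. adj x y} \<subseteq> Z \<Longrightarrow> m x * P f x = (\<Sum>y\<in>Z. mu x y * f y)"
proof -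
  assume Z: "finite Z" "{y. adj x y} \<subseteq> Z"
  have "m x * P f x = (\<Sum>y\<in>{y. adj x y}. mu x y * f y)"
    unfolding P_def sum_distrib_left by (rule sum.cong) (auto simp: ptr_def)
  also have "\<dots> = (\<Sum>y\<in>Z. mu x y * f y)"
    using Z by (intro sum.mono_neutral_left) (auto simp: mu_zero)
  finally show ?thesis .
qed

lemma P_cong: "(\<And>y. adj x y \<Longrightarrow> f y = g y) \<Longrightarrow> P f x = P g x"
  unfolding P_def by (rule sum.cong) auto

lemma P_mono: "(\<And>y. adj x y \<Longrightarrow> f y \<le> g y) \<Longrightarrow> P f x \<le> P g x"
  unfolding P_def by (rule sum_mono) (auto intro: mult_left_mono ptr_nonneg)

lemma P_add: "P (\<lambda>y. f y + g y) x = P f x + P g x"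
  unfolding P_def by (simp add: distrib_left sum.distrib)

lemma P_diff: "P (\<lambda>y. f y - g y) x = P f x - P g x"
  unfolding P_def by (simp add: right_diff_distrib sum_subtractf)

lemma P_cmult: "P (\<lambda>y. c * f y) x = c * P f x"
  unfolding P_def by (simp add: sum_distrib_left mult.left_commute)

lemma P_const [simp]: "P (\<lambda>y. c) x = c"
proof -
  have "m x * P (\<lambda>y. c) x = m x * c"
    using m_P[OF finite_adj subset_refl, of x "\<lambda>y. c"] m_sum[OF finite_adj subset_refl, of x]
    by (simp add: sum_distrib_right)
  then show ?thesis by simp
qed

lemma P_sum: "P (\<lambda>y. \<Sum>i\<in>I. f i y) x = (\<Sum>i\<in>I. P (f i) x)"
  unfolding P_def sum_distrib_left by (rule sum.swap)

lemma P_nonneg: "(\<And>y. adj x y \<Longrightarrow> 0 \<le> f y) \<Longrightarrow> 0 \<le> P f x"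
  using P_mono[of x "\<lambda>_. 0" f] by simp

lemma P_ge_term: "(\<And>y. adj x y \<Longrightarrow> 0 \<le> f y) \<Longrightarrow> adj x y \<Longrightarrow> ptr adj mu x y * f y \<le> P f x"
  unfolding P_def
  by (rule member_le_sum) (auto simp: finite_adj ptr_nonneg)

lemma p_Suc: "p (Suc n) x y = P (\<lambda>z. p n z y) x"
  by (simp add: P_def)

lemma p_nonneg: "p n x y \<ge> 0"
  by (induction n arbitrary: x) (auto intro!: sum_nonneg mult_nonneg_nonneg ptr_nonneg)

lemma p_eq_0: "n < d x y \<Longrightarrow> p n x y = 0"
proof (induction n arbitrary: x)
  case 0
  then show ?case by auto
next
  case (Suc n)
  have "P (\<lambda>z. p n z y) x = P (\<lambda>z. 0) x"
  proof (rule P_cong)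
    fix z assume "adj x z"
    then have "d x y \<le> 1 + d z y" using d_triangle[of x y z] d_adj[of x z] by simp
    then show "p n z y = 0" using Suc by (intro Suc.IH) linarith
  qed
  then show ?case by (simp only: p_Suc P_const)
qed

lemma p_support: "p n x y \<noteq> 0 \<Longrightarrow> y \<in> B x (real n)"
  using p_eq_0[of n x y] by (force simp: mem_B)

lemma p_add:
  assumes "finite Z" "B x (real a) \<subseteq> Z"
  shows "p (a + b) x y = (\<Sum>z\<in>Z. p a x z * p b z y)"
proof -
  \<comment> \<open>In the induction \<open>x\<close> moves to its neighbours while the range of
    summation must not change; hence a ball of fixed centre \<open>x'\<close>, large enough for the
    \<open>a\<close> steps that remain.\<close>
  have *: "p (a + b) x y = (\<Sum>z\<in>B x' (real k). p a x z * p b z y)" if "d x' x + a \<le> k" for x' k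
    using that
  proof (induction a arbitrary: x)
    case 0
    then have "x \<in> B x' (real k)" by (simp add: mem_B)
    then show ?case by (simp add: if_distrib[of "\<lambda>u. u * _"] sum.delta cong: if_cong)
  next
    case (Suc a)
    have "p (Suc a + b) x y = P (\<lambda>w. p (a + b) w y) x" by (simp add: p_Suc del: pn.simps)
    also have "\<dots> = P (\<lambda>w. \<Sum>z\<in>B x' (real k). p a w z * p b z y) x"
    proof (rule P_cong)
      fix w assume "adj x w"
      then have "d x' w + a \<le> k" using d_adj_le[of x w x'] Suc.prems by simp
      then show "p (a + b) w y = (\<Sum>z\<in>B x' (real k). p a w z * p b z y)" by (rule Suc.IH)
    qed
    also have "\<dots> = (\<Sum>z\<in>B x' (real k). P (\<lambda>w. p a w z * p b z y) x)" by (rule P_sum)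
    also have "\<dots> = (\<Sum>z\<in>B x' (real k). p (Suc a) x z * p b z y)"
      unfolding p_Suc using P_cmult[of "p b _ y"] by (simp add: mult.commute)
    finally show ?case .
  qed
  have "p (a + b) x y = (\<Sum>z\<in>B x (real a). p a x z * p b z y)" by (rule *) simp
  also have "\<dots> = (\<Sum>z\<in>Z. p a x z * p b z y)"
    using assms p_support by (intro sum.mono_neutral_left) auto
  finally show ?thesis .
qed

lemma p_1: "p 1 x y = ptr adj mu x y"
proof -
  have "p 1 x y = (\<Sum>z\<in>{z. adj x z}. if z = y then ptr adj mu x z else 0)"
    by (simp add: if_distrib cong: if_cong)
  also have "\<dots> = ptr adj mu x y"
    using finite_adj by (auto simp: sum.delta ptr_def mu_zero)
  finally show ?thesis .
qed

lemma p_sum: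
  assumes "finite Z" "B x (real n) \<subseteq> Z"
  shows "(\<Sum>y\<in>Z. p n x y) = 1"
proof -
  have *: "(\<Sum>z\<in>B x' (real k). p n x z) = 1" if "d x' x + n \<le> k" for x' k
    using that
  proof (induction n arbitrary: x)
    case 0
    then have "x \<in> B x' (real k)" by (simp add: mem_B)
    then show ?case by simp
  next
    case (Suc n)
    have "(\<Sum>z\<in>B x' (real k). p (Suc n) x z) = P (\<lambda>w. \<Sum>z\<in>B x' (real k). p n w z) x"
      unfolding p_Suc P_sum ..
    also have "\<dots> = P (\<lambda>w. 1) x"
    proof (rule P_cong)
      fix w assume "adj x w"
      then have "d x' w + n \<le> k" using d_adj_le[of x w x'] Suc.prems by simp
      then show "(\<Sum>z\<in>B x' (real k). p n w z) = 1" by (rule Suc.IH)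
    qed
    finally show ?case by simp
  qed
  have "1 = (\<Sum>z\<in>B x (real n). p n x z)" by (rule *[symmetric]) simp
  also have "\<dots> = (\<Sum>z\<in>Z. p n x z)"
    using assms p_support by (intro sum.mono_neutral_left) auto
  finally show ?thesis by simp
qed

text \<open>Detailed balance for one step, \<open>m x * p 1 x z = m z * p 1 z x\<close>, propagates
  by splitting off one step at the start on one side and at the end on the other.\<close>

lemma p_reversible: "m x * p n x y = m y * p n y x"
proof (induction n arbitrary: x y)
  case 0
  then show ?case by simp
next
  case (Suc n)
  define Z where "Z = B x 1 \<union> B y (real n)"
  have Z: "finite Z" "B x 1 \<subseteq> Z" "B y (real n) \<subseteq> Z" by (auto simp: Z_def)
  have "m x * p (1 + n) x y = (\<Sum>z\<in>Z. m x * p 1 x z * p n z y)"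
    using p_add[of Z x 1 n y] Z by (simp add: sum_distrib_left mult.assoc del: pn.simps)
  also have "\<dots> = (\<Sum>z\<in>Z. m y * (p n y z * p 1 z x))"
  proof (rule sum.cong)
    fix z
    have "m x * p 1 x z = m z * p 1 z x" unfolding p_1 by (simp add: ptr_def mu_sym)
    then show "m x * p 1 x z * p n z y = m y * (p n y z * p 1 z x)"
      using Suc[of z y] by (simp add: mult.commute mult.left_commute del: pn.simps)
  qed simp
  also have "\<dots> = m y * p (n + 1) y x"
    using p_add[of Z y n 1 x] Z by (simp add: sum_distrib_left del: pn.simps)
  finally show ?case by (simp del: pn.simps)
qed

lemma p_h: "p n x y = h n x y * m y"
  by (simp add: hn_def)

lemma h_nonneg: "h n x y \<ge> 0"
  by (simp add: hn_def p_nonneg)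

lemma h_sym: "h n x y = h n y x"
  using p_reversible[of x n y] by (simp add: hn_def field_simps)

lemma h_Suc: "h (Suc n) x y = P (\<lambda>z. h n z y) x"
  unfolding hn_def p_Suc P_def by (simp add: sum_divide_distrib)

lemma h_add:
  assumes "finite Z" "B x (real a) \<subseteq> Z"
  shows "h (a + b) x y = (\<Sum>z\<in>Z. h a x z * h b y z * m z)"
proof -
  have "h (a + b) x y = (\<Sum>z\<in>Z. p a x z * p b z y / m y)"
    unfolding hn_def[of adj mu "a+b"] p_add[OF assms] sum_divide_distrib ..
  also have "\<dots> = (\<Sum>z\<in>Z. h a x z * h b y z * m z)"
    by (rule sum.cong) (auto simp: p_h[of a x] p_h[of b _ y] h_sym[of b _ y])
  finally show ?thesis .
qed

lemma h_sum: "finite Z \<Longrightarrow> B x (real n) \<subseteq> Z \<Longrightarrow> (\<Sum>z\<in>Z. h n x z * m z) = 1"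
  using p_sum[of Z x n] by (simp add: p_h)

lemma h_eq_0: "n < d x y \<Longrightarrow> h n x y = 0"
  by (simp add: hn_def p_eq_0)

text \<open>Every edge is counted twice, so this is twice the energy.\<close>

definition En :: "'a set \<Rightarrow> ('a \<Rightarrow> real) \<Rightarrow> real" where
  "En S f = (\<Sum>x\<in>S. \<Sum>y\<in>S. (f x - f y)\<^sup>2 * mu x y)"

lemma En_nonneg: "En S f \<ge> 0"
  unfolding En_def by (intro sum_nonneg mult_nonneg_nonneg) (auto simp: mu_nonneg)

lemma En_mono: "finite T \<Longrightarrow> S \<subseteq> T \<Longrightarrow> En S f \<le> En T f"
proof -
  assume T: "finite T" "S \<subseteq> T"
  have "En S f \<le> (\<Sum>x\<in>S. \<Sum>y\<in>T. (f x - f y)\<^sup>2 * mu x y)"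
    unfolding En_def using T mu_nonneg by (intro sum_mono sum_mono2) auto
  also have "\<dots> \<le> En T f"
    unfolding En_def using T mu_nonneg by (intro sum_mono2 sum_nonneg mult_nonneg_nonneg) auto
  finally show ?thesis .
qed

lemma En_le:
  assumes "\<And>x y. x \<in> S \<Longrightarrow> y \<in> S \<Longrightarrow> adj x y \<Longrightarrow> \<bar>f x - f y\<bar> \<le> \<bar>g x - g y\<bar>"
  shows "En S f \<le> En S g"
  unfolding En_def
proof (intro sum_mono)
  fix x y assume "x \<in> S" "y \<in> S"
  then show "(f x - f y)\<^sup>2 * mu x y \<le> (g x - g y)\<^sup>2 * mu x y"
    using assms[of x y] mu_nonneg[of x y] mu_zero[of x y]
    by (cases "adj x y") (auto intro: mult_right_mono simp: abs_le_square_iff)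
qed

text \<open>Summation by parts. As \<open>f\<close> vanishes off \<open>S\<close>, the left side
  extends to a double sum over \<open>Z\<close>; exchanging the two variables and using symmetry of
  \<open>mu\<close>, the mean of both forms is the right side. \<open>Z\<close> contains the
  neighbours of \<open>S\<close> so that \<open>P g\<close> can be computed inside it;
  \<open>g\<close> may have any support.\<close>

lemma Green_formula:
  assumes Z: "finite Z" and S: "S \<subseteq> Z" and nb: "\<And>x. x \<in> S \<Longrightarrow> {y. adj x y} \<subseteq> Z"
    and 0: "\<And>x. x \<notin> S \<Longrightarrow> f x = 0"
  shows "(\<Sum>x\<in>S. f x * (g x - P g x) * m x)
       = (\<Sum>x\<in>Z. \<Sum>y\<in>Z. (f x - f y) * (g x - g y) * mu x y) / 2"
proof -
  have "(\<Sum>x\<in>S. f x * (g x - P g x) * m x) = (\<Sum>x\<in>S. \<Sum>y\<in>Z. f x * (g x - g y) * mu x y)"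
  proof (rule sum.cong)
    fix x assume x: "x \<in> S"
    have "f x * (g x - P g x) * m x = f x * (g x * m x - m x * P g x)" by (simp add: algebra_simps)
    also have "\<dots> = f x * (g x * (\<Sum>y\<in>Z. mu x y) - (\<Sum>y\<in>Z. mu x y * g y))"
      using m_sum[OF Z nb[OF x]] m_P[OF Z nb[OF x]] by simp
    also have "\<dots> = (\<Sum>y\<in>Z. f x * (g x - g y) * mu x y)"
      unfolding sum_distrib_left sum_subtractf[symmetric]
      by (simp add: sum_distrib_left algebra_simps sum_subtractf)
    finally show "f x * (g x - P g x) * m x = (\<Sum>y\<in>Z. f x * (g x - g y) * mu x y)" .
  qed simp
  also have "\<dots> = (\<Sum>x\<in>Z. \<Sum>y\<in>Z. f x * (g x - g y) * mu x y)" (is "_ = ?A")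
    using Z S 0 by (intro sum.mono_neutral_left) auto
  finally have 1: "(\<Sum>x\<in>S. f x * (g x - P g x) * m x) = ?A" .
  have 2: "?A = (\<Sum>x\<in>Z. \<Sum>y\<in>Z. f y * (g y - g x) * mu x y)"
    using sum.swap[of "\<lambda>x y. f x * (g x - g y) * mu x y" Z Z] by (simp add: mu_sym)
  have "(\<Sum>x\<in>Z. \<Sum>y\<in>Z. (f x - f y) * (g x - g y) * mu x y)
      = ?A + (\<Sum>x\<in>Z. \<Sum>y\<in>Z. f y * (g y - g x) * mu x y)"
    unfolding sum.distrib[symmetric] by (simp add: algebra_simps)
  with 1 2 show ?thesis by simp
qed

end

section \<open>Volume growth and Poincare inequality\<close>

text \<open>Turns a comparison of growth rates up to a constant into an inequality between
  exponents; this is how \<open>a \<ge> 1\<close> and \<open>b \<ge> 2\<close> are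
  extracted.\<close>

lemma powr_bounded_imp_nonpos:
  assumes "\<And>n::nat. n \<ge> 1 \<Longrightarrow> real n powr s \<le> C"
  shows "s \<le> 0"
proof (rule ccontr)
  assume "\<not> s \<le> 0"
  then have s: "s > 0" by simp
  define t where "t = (max C 1 + 1) powr (1/s)"
  define n where "n = nat \<lceil>t\<rceil>"
  have t: "t \<ge> 1" unfolding t_def using s by (intro ge_one_powr_ge_zero) auto
  then have n: "n \<ge> 1" "real n \<ge> t" unfolding n_def by linarith+
  have "max C 1 + 1 = t powr s" using s by (simp add: t_def powr_powr)
  also have "\<dots> \<le> real n powr s" using n t s by (intro powr_mono2) auto
  also have "\<dots> \<le> C" using assms n by simp
  finally show False by simp
qed

lemma sum_le_infsum_ennreal:
  fixes f :: "'b \<Rightarrow> ennreal"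
  assumes "finite F" shows "sum f F \<le> (\<Sum>\<^sub>\<infinity>x\<in>UNIV. f x)"
proof -
  have "sum f F = (\<Sum>\<^sub>\<infinity>x\<in>F. f x)" using assms by simp
  also have "\<dots> \<le> (\<Sum>\<^sub>\<infinity>x\<in>UNIV. f x)"
    by (rule infsum_mono_neutral) (auto intro: nonneg_summable_on_complete)
  finally show ?thesis .
qed

locale hk_graph = wgraph adj mu for adj :: "'a \<Rightarrow> 'a \<Rightarrow> bool" and mu :: "'a \<Rightarrow> 'a \<Rightarrow> real" +
  fixes a b p0 CV CP CC :: real
  assumes p0_pos: "p0 > 0" and p0: "\<And>x y. adj x y \<Longrightarrow> p0 \<le> ptr adj mu x y"
    and CV1: "CV > 1"
    and V_lower1: "\<And>x r. r \<ge> 1 \<Longrightarrow> r powr a / CV \<le> V x r"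
    and V_upper: "\<And>x r. r \<ge> 1 \<Longrightarrow> V x r \<le> CV * r powr a"
    and CP1: "CP > 1"
    and PI_sum: "\<And>x0 r f. r \<ge> 0 \<Longrightarrow> (\<Sum>x\<in>B x0 r. (f x - (\<Sum>x\<in>B x0 r. f x * m x) / muset adj mu (B x0 r))\<^sup>2 * m x)
          \<le> CP * r powr b * (\<Sum>(x,y)\<in>{(x,y). x \<in> B x0 (2*r) \<and> y \<in> B x0 (2*r) \<and> adj x y}. (f x - f y)\<^sup>2 * mu x y)"
    and CC1: "CC > 1"
    and Cap: "\<And>x r. r > 0 \<Longrightarrow> capG mu (B x r) (- B x (2 * r)) \<le> ennreal (CC * V x r / r powr b)"
    and ab: "a < 1 + b"
begin

definition avg :: "'a set \<Rightarrow> ('a \<Rightarrow> real) \<Rightarrow> real" where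
  "avg S f = (\<Sum>x\<in>S. f x * m x) / (\<Sum>x\<in>S. m x)"

lemma PI:
  assumes "r \<ge> 0"
  shows "(\<Sum>x\<in>B x0 r. (f x - avg (B x0 r) f)\<^sup>2 * m x) \<le> CP * r powr b * En (B x0 (2*r)) f"
proof -
  let ?S = "B x0 (2*r)"
  have "(\<Sum>(x,y)\<in>{(x,y). x \<in> ?S \<and> y \<in> ?S \<and> adj x y}. (f x - f y)\<^sup>2 * mu x y)
      = (\<Sum>(x,y)\<in>?S \<times> ?S. (f x - f y)\<^sup>2 * mu x y)"
    by (rule sum.mono_neutral_left) (auto, metis mu_zero)
  also have "\<dots> = En ?S f" unfolding En_def by (rule sum.cartesian_product[symmetric])
  finally show ?thesis using PI_sum[OF assms, where ?x0.0=x0 and f=f] by (simp add: avg_def muset_def)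
qed

text \<open>A near-minimiser of the capacity, truncated to values in [0,1], which does not increase
  the energy. One factor 2 of the constant is the room left because the infimum need not be
  attained, the other comes from \<open>En\<close> counting each edge twice.\<close>

lemma cutoff:
  assumes "r > 0"
  obtains \<phi> where "\<And>y. 0 \<le> \<phi> y" "\<And>y. \<phi> y \<le> 1" "\<And>y. y \<in> B x r \<Longrightarrow> \<phi> y = 1"
    "\<And>y. y \<notin> B x (2 * r) \<Longrightarrow> \<phi> y = 0" "\<And>Z. finite Z \<Longrightarrow> En Z \<phi> \<le> 4 * CC * V x r / r powr b"
proof -
  let ?K = "CC * V x r / r powr b"
  have K: "?K > 0" using CC1 V_pos[of r x] assms by simp
  have "capG mu (B x r) (- B x (2 * r)) \<le> ennreal ?K" using Cap assms by blast
  also have "\<dots> < ennreal (2 * ?K)" using K by (intro ennreal_lessI) simp_all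
  finally obtain f where f: "\<forall>y\<in>B x r. f y = 1" "\<forall>y\<in>- B x (2*r). f y = 0"
    and e: "energy mu f < ennreal (2 * ?K)"
    unfolding capG_def INF_less_iff by blast
  define \<phi> where "\<phi> = (\<lambda>y. max 0 (min 1 (f y)))"
  have "En Z \<phi> \<le> 4 * ?K" if Z: "finite Z" for Z
  proof -
    have "ennreal (En Z f) = (\<Sum>(x,y)\<in>Z\<times>Z. ennreal ((f x - f y)^2 * mu x y))"
      unfolding En_def sum.cartesian_product
      by (subst sum_ennreal[symmetric]) (auto simp: mu_nonneg split_def)
    also have "\<dots> \<le> (\<Sum>\<^sub>\<infinity>(x,y)\<in>UNIV. ennreal ((f x - f y)^2 * mu x y))"
      using Z by (intro sum_le_infsum_ennreal) auto
    also have "\<dots> = 2 * energy mu f"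
      unfolding energy_def ennreal_times_divide mult.commute[of 2]
      by (rule mult_divide_eq_ennreal[symmetric]) auto
    also have "\<dots> \<le> 2 * ennreal (2 * ?K)" using e by (intro mult_left_mono) auto
    also have "\<dots> = ennreal 2 * ennreal (2 * ?K)" by simp
    also have "\<dots> = ennreal (2 * (2 * ?K))" using K by (intro ennreal_mult[symmetric]) auto
    also have "2 * (2 * ?K) = 4 * ?K" by simp
    finally have "En Z f \<le> 4 * ?K" using K by (simp add: ennreal_le_iff)
    moreover have "En Z \<phi> \<le> En Z f" by (rule En_le) (auto simp: \<phi>_def max_def min_def)
    ultimately show ?thesis by linarith
  qed
  then show ?thesis using f by (intro that[of \<phi>]) (auto simp: \<phi>_def mult.assoc)
qed

section \<open>Vertex weights, and a priori bounds on the exponents\<close>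

lemma p0_le_1: "p0 \<le> 1"
proof -
  obtain y where y: "adj undefined y" by (rule ex_adj)
  have "p0 \<le> ptr adj mu undefined y" using p0 y .
  also have "\<dots> \<le> P (\<lambda>_. 1) undefined"
    using P_ge_term[of undefined "\<lambda>_. 1" y] y by simp
  finally show ?thesis by simp
qed

lemma m_upper: "m x \<le> CV"
proof -
  have "m x = V x 0" by (simp add: V_eq_sum B_small)
  also have "\<dots> \<le> V x 1" by (rule V_mono, rule B_mono) simp
  also have "\<dots> \<le> CV" using V_upper[of 1 x] by simp
  finally show ?thesis .
qed

text \<open>Condition \<open>p0\<close> at a neighbour \<open>y\<close> of \<open>x\<close> gives
  \<open>m y \<le> mu x y / p0\<close>, so the unit ball has measure at most
  \<open>m x * (1 + 1 / p0)\<close>, while volume growth at radius 1 makes it at least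
  \<open>1 / CV\<close>. The resulting lower bound for \<open>m x\<close> also serves as the lower
  volume constant at every positive radius.\<close>

definition c_vol :: real where "c_vol = 1 / (CV * (1 + 1 / p0))"

lemma c_vol_pos: "c_vol > 0"
  using p0_pos CV1 by (simp add: c_vol_def add_pos_pos)

lemma m_lower: "c_vol \<le> m x"
proof -
  have B1: "B x 1 = insert x {y. adj x y}"
  proof -
    have "adj x y" if "real (d x y) \<le> 1" "y \<noteq> x" for y
      using that d_1_adj[of x y] d_eq_0[of x y] by (cases "d x y = 0") auto
    then show ?thesis using d_adj by (auto simp: mem_B)
  qed
  have nb: "m y \<le> mu x y / p0" if "adj x y" for y
    using p0[of y x] that adj_sym p0_pos m_pos[of y]
    by (simp add: ptr_def field_simps mu_sym)
  have "1 / CV \<le> V x 1" using V_lower1[of 1 x] by simp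
  also have "V x 1 = m x + (\<Sum>y\<in>{y. adj x y}. m y)"
    unfolding V_eq_sum B1 using finite_adj adj_irrefl by simp
  also have "\<dots> \<le> m x + (\<Sum>y\<in>{y. adj x y}. mu x y / p0)"
    using nb by (intro add_left_mono sum_mono) auto
  also have "\<dots> = m x * (1 + 1 / p0)"
    using m_sum[OF finite_adj subset_refl, of x] by (simp add: sum_divide_distrib[symmetric] distrib_left)
  finally show ?thesis using p0_pos CV1
    by (simp add: c_vol_def divide_le_eq mult.commute mult.left_commute add_pos_pos)
qed

lemma card_le_V: "c_vol * card (B x r) \<le> V x r"
  unfolding V_eq_sum using sum_mono[of "B x r" "\<lambda>_. c_vol" m] m_lower by (simp add: mult.commute)

text \<open>No sphere is empty, so a ball of radius \<open>n\<close> contains at least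
  \<open>n\<close> vertices, each of weight at least \<open>c_vol\<close>.\<close>

lemma a_ge_1: "a \<ge> 1"
proof -
  have "real n powr (1 - a) \<le> CV / c_vol" if n: "n \<ge> 1" for n :: nat
  proof -
    fix x :: 'a
    have "\<forall>k. \<exists>y. d x y = k" using ex_sphere by metis
    then obtain g where g: "\<And>k. d x (g k) = k" by metis
    have "n = card (g ` {..<n})"
      using g by (subst card_image) (auto intro: inj_on_inverseI)
    also have "\<dots> \<le> card (B x (real n))" using g by (intro card_mono) (auto simp: mem_B)
    finally have "c_vol * n \<le> c_vol * card (B x (real n))" using c_vol_pos by simp
    also have "\<dots> \<le> CV * real n powr a" using card_le_V[of x n] V_upper[of "real n" x] n by simp
    finally show ?thesis using n c_vol_pos by (simp add: powr_diff field_simps)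
  qed
  from powr_bounded_imp_nonpos[OF this] show ?thesis by simp
qed

lemma c_vol_le: "c_vol \<le> 1 / CV"
  unfolding c_vol_def using CV1 p0_pos by (intro divide_left_mono) (auto simp: add_pos_pos)

lemma V_lower: "r > 0 \<Longrightarrow> c_vol * r powr a \<le> V x r"
proof (cases "r \<ge> 1")
  case True
  have "c_vol * r powr a \<le> 1 / CV * r powr a" using c_vol_le by (intro mult_right_mono) auto
  then show ?thesis using V_lower1[OF True, of x] by simp
next
  case False
  assume "r > 0"
  then have "r powr a \<le> 1" using False a_ge_1 powr_mono2[of a r 1] by simp
  then have "c_vol * r powr a \<le> c_vol" using c_vol_pos mult_left_le[of "r powr a" c_vol] by simp
  also have "\<dots> \<le> m x" by (rule m_lower)
  also have "\<dots> = V x r" using False \<open>r > 0\<close> by (simp add: V_eq_sum B_small)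
  finally show ?thesis .
qed

lemma En_le_measure:
  assumes "finite S" "\<And>x y. x \<in> S \<Longrightarrow> y \<in> S \<Longrightarrow> adj x y \<Longrightarrow> \<bar>f x - f y\<bar> \<le> 1"
  shows "En S f \<le> (\<Sum>x\<in>S. m x)"
  unfolding En_def
proof (intro sum_mono)
  fix x assume x: "x \<in> S"
  have "(\<Sum>y\<in>S. (f x - f y)\<^sup>2 * mu x y) \<le> (\<Sum>y\<in>S. mu x y)"
  proof (intro sum_mono)
    fix y assume "y \<in> S"
    then show "(f x - f y)\<^sup>2 * mu x y \<le> mu x y"
      using assms(2)[OF x, of y] mu_nonneg[of x y] mu_zero[of x y]
      by (cases "adj x y") (auto intro: mult_left_le_one_le simp: abs_square_le_1)
  qed
  also have "\<dots> \<le> m x" using assms by (intro m_ge_sum)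
  finally show "(\<Sum>y\<in>S. (f x - f y)\<^sup>2 * mu x y) \<le> m x" .
qed

text \<open>The distance function tests the Poincare inequality at scale \<open>k\<close>: its
  variance is at least of order \<open>k^2 * k^a\<close>, while its energy is at most the volume, of
  order \<open>k^a\<close>.\<close>

lemma b_ge_2: "b \<ge> 2"
proof -
  define C where "C = CP * 8 powr b * CV * 16 powr a / c_vol"
  have "real k powr (2 - b) \<le> C" if k: "k \<ge> 1" for k :: nat
  proof -
    fix x :: 'a
    obtain y where y: "d x y = 4 * k" by (rule ex_sphere)
    define f where "f = (\<lambda>z. real (d x z))"
    define t where "t = avg (B x (8 * real k)) f"
    let ?B = "B x (8 * real k)"
    have *: "(real k)\<^sup>2 * (c_vol * real k powr a) \<le> (\<Sum>z\<in>?B. (f z - t)\<^sup>2 * m z)"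
      if w: "B w (real k) \<subseteq> ?B" "\<And>z. z \<in> B w (real k) \<Longrightarrow> real k \<le> \<bar>f z - t\<bar>" for w
    proof -
      have "(real k)\<^sup>2 * (c_vol * real k powr a) \<le> (real k)\<^sup>2 * V w (real k)"
        using k by (intro mult_left_mono V_lower) auto
      also have "\<dots> = (\<Sum>z\<in>B w (real k). (real k)\<^sup>2 * m z)"
        by (simp add: V_eq_sum sum_distrib_left)
      also have "\<dots> \<le> (\<Sum>z\<in>B w (real k). (f z - t)\<^sup>2 * m z)"
      proof (intro sum_mono mult_right_mono)
        fix z assume "z \<in> B w (real k)"
        then show "(real k)\<^sup>2 \<le> (f z - t)\<^sup>2" using w(2) by (simp add: abs_le_square_iff[symmetric])
      qed simp
      also have "\<dots> \<le> (\<Sum>z\<in>?B. (f z - t)\<^sup>2 * m z)" using w(1) by (intro sum_mono2) auto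
      finally show ?thesis .
    qed
    \<comment> \<open>The centres \<open>x\<close> and \<open>y\<close> are \<open>4 * k\<close>
      apart. On whichever side of \<open>2 * k\<close> the mean \<open>t\<close> lies, one of the
      two balls of radius \<open>k\<close> keeps \<open>f\<close> at distance at least
      \<open>k\<close> from it.\<close>
    have "(real k)\<^sup>2 * (c_vol * real k powr a) \<le> (\<Sum>z\<in>?B. (f z - t)\<^sup>2 * m z)"
    proof (cases "t \<ge> 2 * k")
      case True
      show ?thesis
      proof (rule *[of x])
        fix z assume "z \<in> B x (real k)"
        then show "real k \<le> \<bar>f z - t\<bar>" using True by (simp add: mem_B f_def)
      qed (auto intro!: B_subset)
    next
      case False
      show ?thesis
      proof (rule *[of y])
        fix z assume "z \<in> B y (real k)"
        then have "real (d x z) \<ge> 3 * k" using d_triangle[of x y z] y d_sym[of y z] by (simp add: mem_B)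
        then show "real k \<le> \<bar>f z - t\<bar>" using False by (simp add: f_def)
      qed (auto intro!: B_subset simp: y)
    qed
    also have "\<dots> \<le> CP * (8 * real k) powr b * En (B x (2 * (8 * real k))) f"
      unfolding t_def by (rule PI) simp
    also have "\<dots> \<le> CP * (8 * real k) powr b * V x (2 * (8 * real k))"
      unfolding V_eq_sum
    proof (intro mult_left_mono En_le_measure)
      fix u v assume "adj u v"
      then show "\<bar>f u - f v\<bar> \<le> 1"
        using d_adj_le[of u v x] d_adj_le[of v u x] adj_sym by (auto simp: f_def)
    qed (use CP1 in auto)
    also have "\<dots> \<le> CP * (8 * real k) powr b * (CV * (2 * (8 * real k)) powr a)"
      using k CP1 by (intro mult_left_mono V_upper) auto
    also have "\<dots> = real k powr b * real k powr a * (C * c_vol)"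
      using c_vol_pos by (simp add: C_def powr_mult)
    finally have "(real k)\<^sup>2 * (c_vol * real k powr a) \<le> (real k powr b * C) * (c_vol * real k powr a)"
      by (simp only: mult_ac)
    then have "(real k)\<^sup>2 \<le> real k powr b * C"
      by (rule mult_right_le_imp_le) (use k c_vol_pos in simp)
    moreover have "real k powr (2 - b) = (real k)\<^sup>2 / real k powr b"
      using k by (simp add: powr_diff)
    ultimately show ?thesis using k by (simp add: divide_le_eq mult.commute)
  qed
  from powr_bounded_imp_nonpos[OF this] show ?thesis by simp
qed

lemma V_doubling_ratio: "r \<ge> 1 \<Longrightarrow> V x (2 * r) \<le> CV * 2 powr a * r powr a"
  using V_upper[of "2*r" x] by (simp add: powr_mult)

end

section \<open>The weak Harnack inequality\<close>

lemma sq_add_ge: "(x + y)\<^sup>2 \<ge> x\<^sup>2 / 2 - (y::real)\<^sup>2"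
proof -
  have "0 \<le> (x + 2 * y)\<^sup>2" by simp
  then show ?thesis by (simp add: power2_eq_square algebra_simps)
qed

lemma sq_add_le: "(x + y)\<^sup>2 \<le> 2 * x\<^sup>2 + 2 * (y::real)\<^sup>2"
proof -
  have "0 \<le> (x - y)\<^sup>2" by simp
  then show ?thesis by (simp add: power2_eq_square algebra_simps)
qed

lemma ln_le_diff_inverse:
  assumes "s \<ge> (1::real)"
  shows "ln s \<le> s - 1 / s"
proof -
  have "ln s \<le> s - 1" using assms by (intro ln_le_minus_one) simp
  moreover have "1 / s \<le> 1" using assms by simp
  ultimately show ?thesis by linarith
qed

lemma ln_sq_le:
  assumes "s > (0::real)"
  shows "(ln s)\<^sup>2 \<le> (s - 1 / s)\<^sup>2"
proof (cases "s \<ge> 1")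
  case True
  then show ?thesis using ln_le_diff_inverse[OF True] by (intro power_mono) auto
next
  case False
  then have "1 / s \<ge> 1" using assms by simp
  then have "(ln (1 / s))\<^sup>2 \<le> (1 / s - 1 / (1 / s))\<^sup>2"
    using ln_le_diff_inverse[of "1 / s"] by (intro power_mono) auto
  then show ?thesis using assms by (simp add: ln_div power2_commute)
qed

text \<open>With \<open>s = \<surd>(w / v)\<close> the left-hand side equals \<open>(A - C)\<^sup>2 - (A s - C / s)\<^sup>2\<close>.\<close>

lemma log_caccioppoli_pointwise:
  assumes "v > 0" "w > (0::real)"
  shows "(A\<^sup>2 / v - C\<^sup>2 / w) * (v - w)
      \<le> 2 * (A - C)\<^sup>2 - min (A\<^sup>2) (C\<^sup>2) * (ln v - ln w)\<^sup>2 / 8"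
proof -
  define s where "s = sqrt (w / v)"
  have s: "s > 0" using assms by (simp add: s_def)
  have s2: "s\<^sup>2 = w / v" using assms by (simp add: s_def)
  have w: "w = s\<^sup>2 * v" using s2 assms by simp
  have ln: "ln v - ln w = - 2 * ln s"
    using assms s unfolding w by (simp add: ln_mult ln_realpow)
  have "(A\<^sup>2 / v - C\<^sup>2 / w) * (v - w) = (A\<^sup>2 - C\<^sup>2 / s\<^sup>2) * (1 - s\<^sup>2)"
    unfolding w using assms s by (simp add: field_simps)
  also have "\<dots> = (A - C)\<^sup>2 - (A * s - C / s)\<^sup>2"
    using s by (simp add: power2_eq_square field_simps)
  finally have 1: "(A\<^sup>2 / v - C\<^sup>2 / w) * (v - w) = (A - C)\<^sup>2 - (A * s - C / s)\<^sup>2" .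
  \<comment> \<open>The square is expanded about \<open>A\<close> when \<open>s \<ge> 1\<close> and
    about \<open>C\<close> otherwise, so that the error \<open>A - C\<close> is damped by
    \<open>1 / s\<close> or by \<open>s\<close> and never amplified.\<close>
  have 2: "(A * s - C / s)\<^sup>2 \<ge> min (A\<^sup>2) (C\<^sup>2) * (s - 1 / s)\<^sup>2 / 2 - (A - C)\<^sup>2"
  proof (cases "s \<ge> 1")
    case True
    have "A * s - C / s = A * (s - 1 / s) + (A - C) / s" using s by (simp add: field_simps)
    then have "(A * s - C / s)\<^sup>2 \<ge> (A * (s - 1 / s))\<^sup>2 / 2 - ((A - C) / s)\<^sup>2"
      using sq_add_ge[of "A * (s - 1 / s)" "(A - C) / s"] by simp
    moreover have "((A - C) / s)\<^sup>2 \<le> (A - C)\<^sup>2"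
    proof -
      have "1 \<le> s\<^sup>2" using True by simp
      then have "(A - C)\<^sup>2 * 1 \<le> (A - C)\<^sup>2 * s\<^sup>2" by (intro mult_left_mono) auto
      then show ?thesis using s by (simp add: power_divide divide_le_eq)
    qed
    moreover have "min (A\<^sup>2) (C\<^sup>2) * (s - 1 / s)\<^sup>2 \<le> (A * (s - 1 / s))\<^sup>2"
      unfolding power_mult_distrib by (intro mult_right_mono) auto
    ultimately show ?thesis by linarith
  next
    case False
    have "A * s - C / s = C * (s - 1 / s) + (A - C) * s" using s by (simp add: field_simps)
    then have "(A * s - C / s)\<^sup>2 \<ge> (C * (s - 1 / s))\<^sup>2 / 2 - ((A - C) * s)\<^sup>2"
      using sq_add_ge[of "C * (s - 1 / s)" "(A - C) * s"] by simp
    moreover have "((A - C) * s)\<^sup>2 \<le> (A - C)\<^sup>2"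
    proof -
      have "s\<^sup>2 \<le> 1" using False s by (simp add: power_le_one)
      then show ?thesis unfolding power_mult_distrib by (rule mult_left_le) simp
    qed
    moreover have "min (A\<^sup>2) (C\<^sup>2) * (s - 1 / s)\<^sup>2 \<le> (C * (s - 1 / s))\<^sup>2"
      unfolding power_mult_distrib by (intro mult_right_mono) auto
    ultimately show ?thesis by linarith
  qed
  have "min (A\<^sup>2) (C\<^sup>2) * (ln s)\<^sup>2 \<le> min (A\<^sup>2) (C\<^sup>2) * (s - 1 / s)\<^sup>2"
    using ln_sq_le[OF s] by (intro mult_left_mono) auto
  then have "min (A\<^sup>2) (C\<^sup>2) * (ln v - ln w)\<^sup>2 / 8 \<le> min (A\<^sup>2) (C\<^sup>2) * (s - 1 / s)\<^sup>2 / 2"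
    unfolding ln by (simp add: power_mult_distrib mult.commute)
  with 1 2 show ?thesis by linarith
qed

context wgraph
begin

text \<open>Superharmonicity is tested against \<open>\<phi>^2 / v\<close>, turned into a double sum
  by the Green formula, and estimated edge by edge. The minimum of the two squares appears because
  an edge is weighted by both of its endpoints.\<close>

lemma log_caccioppoli:
  assumes Z: "finite Z" and S: "S \<subseteq> Z" and nb: "\<And>x. x \<in> S \<Longrightarrow> {y. adj x y} \<subseteq> Z"
    and 0: "\<And>x. x \<notin> S \<Longrightarrow> \<phi> x = 0" and v: "\<And>x. x \<in> Z \<Longrightarrow> v x > 0"
    and sup: "\<And>x. x \<in> S \<Longrightarrow> P v x \<le> v x"
  shows "(\<Sum>x\<in>Z. \<Sum>y\<in>Z. min ((\<phi> x)\<^sup>2) ((\<phi> y)\<^sup>2) * (ln (v x) - ln (v y))\<^sup>2 * mu x y) \<le> 16 * En Z \<phi>"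
proof -
  let ?M = "\<lambda>x y. min ((\<phi> x)\<^sup>2) ((\<phi> y)\<^sup>2) * (ln (v x) - ln (v y))\<^sup>2 * mu x y"
  have "0 \<le> (\<Sum>x\<in>S. (\<phi> x)\<^sup>2 / v x * (v x - P v x) * m x)"
  proof (intro sum_nonneg mult_nonneg_nonneg)
    fix x assume "x \<in> S"
    then show "0 \<le> (\<phi> x)\<^sup>2 / v x" "0 \<le> v x - P v x" using v[of x] sup[of x] S by auto
  qed simp
  also have "\<dots> = (\<Sum>x\<in>Z. \<Sum>y\<in>Z. ((\<phi> x)\<^sup>2 / v x - (\<phi> y)\<^sup>2 / v y) * (v x - v y) * mu x y) / 2"
    by (rule Green_formula[OF Z S nb]) (auto simp: 0)
  also have "\<dots> \<le> (\<Sum>x\<in>Z. \<Sum>y\<in>Z. (2 * (\<phi> x - \<phi> y)\<^sup>2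
       - min ((\<phi> x)\<^sup>2) ((\<phi> y)\<^sup>2) * (ln (v x) - ln (v y))\<^sup>2 / 8) * mu x y) / 2"
    using v mu_nonneg
    by (intro divide_right_mono sum_mono mult_right_mono log_caccioppoli_pointwise) auto
  also have "\<dots> = (2 * En Z \<phi> - (\<Sum>x\<in>Z. \<Sum>y\<in>Z. ?M x y) / 8) / 2"
    unfolding En_def by (simp add: left_diff_distrib sum_subtractf sum_distrib_left sum_divide_distrib mult.assoc)
  finally show ?thesis by simp
qed

text \<open>Otherwise the minimum over the closed ball of radius \<open>n\<close> is attained in its
  interior only. Superharmonicity passes a minimal value on to all neighbours, so the minimal set is
  closed under adjacency; by connectedness it is the whole graph, yet it lies in a ball.\<close>

lemma minimum_principle:
  assumes sup: "\<And>z. d x0 z < n \<Longrightarrow> P u z \<le> u z"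
  obtains y where "d x0 y = n" "u y \<le> u x0"
proof (rule ccontr)
  assume "\<not> thesis"
  then have gt: "u x0 < u y" if "d x0 y = n" for y
    using that \<open>\<And>y. d x0 y = n \<Longrightarrow> u y \<le> u x0 \<Longrightarrow> thesis\<close> by force
  define K where "K = {y. d x0 y \<le> n}"
  have K: "finite K" "x0 \<in> K" by (auto simp: K_def finite_d_ball)
  define M where "M = Min (u ` K)"
  have M: "M \<le> u z" if "z \<in> K" for z using K that by (simp add: M_def)
  have "M \<in> u ` K" unfolding M_def using K by (intro Min_in) auto
  then obtain z0 where z0: "z0 \<in> K" "u z0 = M" by auto
  have "z \<in> K \<and> u z = M" if "adj\<^sup>*\<^sup>* z0 z" for z
    using that
  proof (induction rule: rtranclp_induct)
    case base
    then show ?case using z0 by simp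
  next
    case (step y z)
    have "d x0 y \<noteq> n" using gt[of y] M[OF K(2)] step.IH by force
    then have y: "d x0 y < n" using step.IH by (simp add: K_def)
    have nbK: "w \<in> K" if "adj y w" for w using d_adj_le[OF that, of x0] y by (simp add: K_def)
    have "ptr adj mu y z * (u z - M) \<le> P (\<lambda>w. u w - M) y"
      using step.hyps nbK M by (intro P_ge_term) auto
    also have "\<dots> = P u y - M" by (simp add: P_diff)
    also have "\<dots> \<le> 0" using sup[OF y] step.IH by simp
    finally have "u z - M \<le> 0"
      using step.hyps mu_pos_iff[of y z] m_pos[of y] by (simp add: ptr_def mult_le_0_iff zero_less_divide_iff not_le divide_le_0_iff)
    then show ?case using M[OF nbK[OF step.hyps(2)]] nbK[OF step.hyps(2)] by simp
  qed
  then have "z \<in> K" for z using connected by blast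
  then show False using ex_sphere[of x0 "n+1"] by (metis K_def mem_Collect_eq not_less_eq_eq Suc_eq_plus1 le_refl)
qed

end

context hk_graph
begin

text \<open>The cutoff equals 1 on the inner ball, so there the weight in the logarithmic estimate
  is 1. The bound does not depend on \<open>v\<close>. Positivity is required one layer further out
  because \<open>P v\<close> on the larger ball sees that layer.\<close>

lemma log_energy:
  assumes r: "r > 0" and v: "\<And>x. x \<in> B x0 (2 * r + 1) \<Longrightarrow> v x > 0"
    and sup: "\<And>x. x \<in> B x0 (2 * r) \<Longrightarrow> P v x \<le> v x"
  shows "En (B x0 r) (\<lambda>x. ln (v x)) \<le> 64 * CC * V x0 r / r powr b"
proof -
  obtain \<phi> where \<phi>: "\<And>y. 0 \<le> \<phi> y" "\<And>y. \<phi> y \<le> 1" "\<And>y. y \<in> B x0 r \<Longrightarrow> \<phi> y = 1"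
    "\<And>y. y \<notin> B x0 (2 * r) \<Longrightarrow> \<phi> y = 0" "\<And>Z. finite Z \<Longrightarrow> En Z \<phi> \<le> 4 * CC * V x0 r / r powr b"
    using cutoff[OF r] by blast
  let ?Z = "B x0 (2 * r + 1)"
  have sub: "B x0 r \<subseteq> ?Z" using r by (intro B_mono) simp
  have "En (B x0 r) (\<lambda>x. ln (v x))
      = (\<Sum>x\<in>B x0 r. \<Sum>y\<in>B x0 r. min ((\<phi> x)\<^sup>2) ((\<phi> y)\<^sup>2) * (ln (v x) - ln (v y))\<^sup>2 * mu x y)"
    unfolding En_def by (intro sum.cong refl) (simp add: \<phi>)
  also have "\<dots> \<le> (\<Sum>x\<in>B x0 r. \<Sum>y\<in>?Z. min ((\<phi> x)\<^sup>2) ((\<phi> y)\<^sup>2) * (ln (v x) - ln (v y))\<^sup>2 * mu x y)"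
    using sub mu_nonneg by (intro sum_mono sum_mono2) auto
  also have "\<dots> \<le> (\<Sum>x\<in>?Z. \<Sum>y\<in>?Z. min ((\<phi> x)\<^sup>2) ((\<phi> y)\<^sup>2) * (ln (v x) - ln (v y))\<^sup>2 * mu x y)"
    using sub mu_nonneg by (intro sum_mono2 sum_nonneg) auto
  also have "\<dots> \<le> 16 * En ?Z \<phi>"
  proof (rule log_caccioppoli[where S = "B x0 (2 * r)"])
    show "B x0 (2 * r) \<subseteq> ?Z" by (rule B_mono) simp
  qed (use v sup \<phi> nbr_B in auto)
  also have "\<dots> \<le> 16 * (4 * CC * V x0 r / r powr b)" by (intro mult_left_mono \<phi>) auto
  finally show ?thesis by simp
qed

section \<open>Poincare estimates across scales\<close>

lemma avg_sq:
  assumes S: "finite S" "S \<noteq> {}" and T: "finite T" "S \<subseteq> T"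
  shows "(avg S f - t)\<^sup>2 * (\<Sum>x\<in>S. m x) \<le> (\<Sum>x\<in>T. (f x - t)\<^sup>2 * m x)"
proof -
  define M where "M = (\<Sum>x\<in>S. m x)"
  have M: "M > 0" unfolding M_def using S m_pos by (intro sum_pos) auto
  have "avg S f - t = (\<Sum>x\<in>S. (f x - t) * m x) / M"
    using M by (simp add: avg_def M_def[symmetric] left_diff_distrib sum_subtractf diff_divide_distrib
       sum_distrib_left[symmetric])
  then have "(avg S f - t)\<^sup>2 * M = (\<Sum>x\<in>S. (f x - t) * m x)\<^sup>2 / M"
    using M by (simp add: power2_eq_square)
  also have "\<dots> = (\<Sum>x\<in>S. ((f x - t) * sqrt (m x)) * sqrt (m x))\<^sup>2 / M"
    by (simp add: mult.assoc)
  also have "\<dots> \<le> ((\<Sum>x\<in>S. ((f x - t) * sqrt (m x))\<^sup>2) * (\<Sum>x\<in>S. (sqrt (m x))\<^sup>2)) / M"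
    using M by (intro divide_right_mono Cauchy_Schwarz_ineq_sum) auto
  also have "\<dots> = (\<Sum>x\<in>S. (f x - t)\<^sup>2 * m x)"
    using M by (simp add: power_mult_distrib M_def)
  also have "\<dots> \<le> (\<Sum>x\<in>T. (f x - t)\<^sup>2 * m x)" using T by (intro sum_mono2) auto
  finally show ?thesis by (simp add: M_def)
qed

lemma avg_ball_diff:
  assumes "r \<ge> 0" "s > 0" "B y s \<subseteq> B x r"
  shows "(avg (B y s) f - avg (B x r) f)\<^sup>2 \<le> CP * r powr b * En (B x (2 * r)) f / (c_vol * s powr a)"
proof -
  have "(avg (B y s) f - avg (B x r) f)\<^sup>2 * (c_vol * s powr a)
      \<le> (avg (B y s) f - avg (B x r) f)\<^sup>2 * V y s"
    using assms by (intro mult_left_mono V_lower) auto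
  also have "\<dots> \<le> (\<Sum>z\<in>B x r. (f z - avg (B x r) f)\<^sup>2 * m z)"
    unfolding V_eq_sum using assms center_B[of s y] by (intro avg_sq) (auto simp del: center_B)
  also have "\<dots> \<le> CP * r powr b * En (B x (2 * r)) f" using assms by (intro PI)
  finally show ?thesis using c_vol_pos assms by (simp add: le_divide_eq)
qed

text \<open>If \<open>x\<close> lies in \<open>B (\<gamma> n) s\<close> then \<open>n\<close>
  differs from \<open>d x0 x\<close> by at most \<open>s\<close>, so at most
  \<open>2 * s + 1\<close> of the balls contain \<open>x\<close>. The points need not form a path;
  one per sphere is enough.\<close>

lemma sum_En_overlap:
  assumes \<gamma>: "\<And>n. n < N \<Longrightarrow> d x0 (\<gamma> n) = n" and T: "finite T" "\<And>n. n < N \<Longrightarrow> B (\<gamma> n) s \<subseteq> T"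
    and s: "s \<ge> 0"
  shows "(\<Sum>n<N. En (B (\<gamma> n) s) f) \<le> (2 * s + 1) * En T f"
proof -
  define F where "F x = (\<Sum>y\<in>T. (f x - f y)\<^sup>2 * mu x y)" for x
  have F: "F x \<ge> 0" for x unfolding F_def by (intro sum_nonneg) (simp add: mu_nonneg)
  have "En (B (\<gamma> n) s) f \<le> (\<Sum>x\<in>T. if x \<in> B (\<gamma> n) s then F x else 0)" if "n < N" for n
  proof -
    have "En (B (\<gamma> n) s) f \<le> (\<Sum>x\<in>B (\<gamma> n) s. F x)"
      unfolding En_def F_def using T that mu_nonneg by (intro sum_mono sum_mono2) auto
    also have "\<dots> = (\<Sum>x\<in>T. if x \<in> B (\<gamma> n) s then F x else 0)"
      using T that by (simp add: sum.If_cases Int_absorb1)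
    finally show ?thesis .
  qed
  then have "(\<Sum>n<N. En (B (\<gamma> n) s) f) \<le> (\<Sum>n<N. \<Sum>x\<in>T. if x \<in> B (\<gamma> n) s then F x else 0)"
    by (intro sum_mono) auto
  also have "\<dots> = (\<Sum>x\<in>T. F x * card {n\<in>{..<N}. x \<in> B (\<gamma> n) s})"
    by (subst sum.swap) (simp add: sum.If_cases mult.commute Int_def)
  also have "\<dots> \<le> (\<Sum>x\<in>T. F x * (2 * s + 1))"
  proof (intro sum_mono mult_left_mono F)
    fix x
    define q where "q = int (d x0 x)"
    have "{n\<in>{..<N}. x \<in> B (\<gamma> n) s} \<subseteq> nat ` {q - \<lfloor>s\<rfloor> .. q + \<lfloor>s\<rfloor>}"
    proof
      fix n assume n: "n \<in> {n\<in>{..<N}. x \<in> B (\<gamma> n) s}"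
      then have "real (d (\<gamma> n) x) \<le> s" by (simp add: mem_B)
      then have "int (d (\<gamma> n) x) \<le> \<lfloor>s\<rfloor>" by (simp add: le_floor_iff)
      moreover have "d x0 x \<le> n + d (\<gamma> n) x" "n \<le> d x0 x + d (\<gamma> n) x"
        using d_triangle[of x0 x "\<gamma> n"] d_triangle[of x0 "\<gamma> n" x] d_sym[of x "\<gamma> n"] \<gamma>[of n] n by auto
      ultimately have "int n \<in> {q - \<lfloor>s\<rfloor> .. q + \<lfloor>s\<rfloor>}" by (simp add: q_def)
      then show "n \<in> nat ` {q - \<lfloor>s\<rfloor> .. q + \<lfloor>s\<rfloor>}" by (metis image_eqI nat_int)
    qed
    then have "card {n\<in>{..<N}. x \<in> B (\<gamma> n) s} \<le> card {q - \<lfloor>s\<rfloor> .. q + \<lfloor>s\<rfloor>}"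
      by (meson card_image_le card_mono finite_atLeastAtMost_int finite_imageI le_trans)
    also have "\<dots> = nat (2 * \<lfloor>s\<rfloor> + 1)" by (simp add: algebra_simps)
    finally have "real (card {n\<in>{..<N}. x \<in> B (\<gamma> n) s}) \<le> real (nat (2 * \<lfloor>s\<rfloor> + 1))" by linarith
    also have "\<dots> \<le> 2 * s + 1" using s by linarith
    finally show "real (card {n\<in>{..<N}. x \<in> B (\<gamma> n) s}) \<le> 2 * s + 1" .
  qed
  also have "\<dots> = (2 * s + 1) * En T f"
    unfolding En_def F_def by (simp add: sum_distrib_left mult.commute)
  finally show ?thesis .
qed

text \<open>At radius \<open>R / 2 ^ i\<close> the capacity estimate produces the factor
  \<open>2 powr (- (1 + b - a))\<close> to the power \<open>i\<close>. Its square root is spent as a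
  Cauchy-Schwarz weight, and the other square root keeps the sum over scales convergent. The value
  is below 1 because \<open>a < 1 + b\<close>.\<close>

definition scale_weight :: real where "scale_weight = 2 powr (- ((1 + b - a) / 2))"

lemma scale_weight: "0 < scale_weight" "scale_weight < 1"
  using ab powr_less_mono[of "- ((1 + b - a) / 2)" 0 2] by (auto simp: scale_weight_def)

definition multiscale_const :: real where "multiscale_const = CP * 2 powr a / (c_vol * (1 - scale_weight))"

lemma multiscale_const_pos: "multiscale_const > 0"
  unfolding multiscale_const_def using CP1 c_vol_pos scale_weight by (intro divide_pos_pos mult_pos_pos) auto

text \<open>The averages over \<open>B y (R / 2 ^ i)\<close> telescope from radius \<open>R\<close>
  to a radius below 1, where the ball is \<open>{y}\<close> and the average is \<open>f y\<close>.
  Cauchy-Schwarz with geometric weights turns the sum of increments into a sum of local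
  energies.\<close>

lemma En_scales:
  assumes R: "R > 0" and k: "R / 2 ^ k < 1"
  shows "(avg (B y R) f - f y)\<^sup>2
    \<le> multiscale_const * (\<Sum>i<k. (R / 2 ^ i) powr (b - a) / scale_weight ^ i * En (B y (2 * (R / 2 ^ i))) f)"
proof -
  define r where "r i = R / 2 ^ i" for i
  have r: "r i > 0" "r (Suc i) = r i / 2" for i using R by (auto simp: r_def)
  define \<delta> where "\<delta> i = avg (B y (r (Suc i))) f - avg (B y (r i)) f" for i
  have "B y (r k) = {y}" using r(1)[of k] k by (intro B_small) (auto simp: r_def)
  then have "avg (B y (r k)) f = f y" by (simp add: avg_def)
  moreover have "(\<Sum>i<k. \<delta> i) = avg (B y (r k)) f - avg (B y (r 0)) f"
    unfolding \<delta>_def by (rule sum_lessThan_telescope)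
  ultimately have tel: "(\<Sum>i<k. \<delta> i) = f y - avg (B y R) f" by (simp add: r_def)
  have \<delta>: "(\<delta> i)\<^sup>2 \<le> CP * 2 powr a / c_vol * (r i powr (b - a) * En (B y (2 * r i)) f)" for i
  proof -
    have "(\<delta> i)\<^sup>2 \<le> CP * r i powr b * En (B y (2 * r i)) f / (c_vol * r (Suc i) powr a)"
      unfolding \<delta>_def using r[of i] r(1)[of "Suc i"]
      by (intro avg_ball_diff) (auto intro!: B_mono)
    also have "\<dots> = CP * 2 powr a / c_vol * (r i powr (b - a) * En (B y (2 * r i)) f)"
      unfolding r(2) using r(1)[of i] c_vol_pos by (simp add: powr_divide powr_diff)
    finally show ?thesis .
  qed
  define s where "s = sqrt scale_weight"
  have s: "s > 0" "s\<^sup>2 = scale_weight" using scale_weight by (auto simp: s_def)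
  have "(\<Sum>i<k. \<delta> i)\<^sup>2 = (\<Sum>i<k. s ^ i * (\<delta> i / s ^ i))\<^sup>2" using s by simp
  also have "\<dots> \<le> (\<Sum>i<k. (s ^ i)\<^sup>2) * (\<Sum>i<k. (\<delta> i / s ^ i)\<^sup>2)"
    by (rule Cauchy_Schwarz_ineq_sum)
  also have "\<dots> = (\<Sum>i<k. scale_weight ^ i) * (\<Sum>i<k. (\<delta> i)\<^sup>2 / scale_weight ^ i)"
    unfolding s(2)[symmetric] by (simp add: power_divide power_mult[symmetric] mult.commute)
  also have "\<dots> \<le> (1 / (1 - scale_weight)) * (\<Sum>i<k. (CP * 2 powr a / c_vol * (r i powr (b - a) * En (B y (2 * r i)) f)) / scale_weight ^ i)"
  proof (intro mult_mono sum_mono divide_right_mono \<delta>)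
    have "(\<Sum>i<k. scale_weight ^ i) = (1 - scale_weight ^ k) / (1 - scale_weight)" using scale_weight by (simp add: sum_gp_strict)
    also have "\<dots> \<le> 1 / (1 - scale_weight)" using scale_weight by (intro divide_right_mono) auto
    finally show "(\<Sum>i<k. scale_weight ^ i) \<le> 1 / (1 - scale_weight)" .
  qed (use scale_weight in \<open>auto intro!: sum_nonneg\<close>)
  also have "\<dots> = multiscale_const * (\<Sum>i<k. r i powr (b - a) / scale_weight ^ i * En (B y (2 * r i)) f)"
    unfolding multiscale_const_def sum_distrib_left by (intro sum.cong) (use c_vol_pos scale_weight in auto)
  finally show ?thesis unfolding tel r_def by (simp add: power2_commute)
qed

text \<open>A Loewner-type capacity bound.  The points \<open>\<gamma> n\<close> at distance \<open>n\<close> replace a continuum of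
  diameter \<open>R\<close>; summing the multiscale Poincare estimate over \<open>n\<close> gains a factor of \<open>1 / r\<close> at
  scale \<open>r\<close>, and the resulting geometric sum converges exactly because \<open>a < 1 + b\<close>.\<close>

lemma capacity_lower_bound:
  obtains c where "c > 0"
    "\<And>x0 R \<theta> g. R \<ge> 1 \<Longrightarrow> \<theta> \<ge> 0 \<Longrightarrow> avg (B x0 R) g \<ge> \<theta> \<Longrightarrow>
      (\<And>n. real n \<le> R \<Longrightarrow> \<exists>y. d x0 y = n \<and> g y = 0) \<Longrightarrow>
      \<theta>\<^sup>2 \<le> c * (R powr (b - a) * En (B x0 (4 * R)) g)"
proof -
  define C1 where "C1 = CP * 2 powr b / c_vol"
  have C1: "C1 > 0" unfolding C1_def using CP1 c_vol_pos by simp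
  define c where "c = 16 * C1 + 10 * multiscale_const / (1 - scale_weight)"
  have c: "c > 0" unfolding c_def using C1 multiscale_const_pos scale_weight by (intro add_pos_pos divide_pos_pos) auto
  have "\<theta>\<^sup>2 \<le> c * (R powr (b - a) * En (B x0 (4 * R)) g)"
    if R: "R \<ge> 1" and \<theta>: "\<theta> \<ge> 0" "avg (B x0 R) g \<ge> \<theta>"
      and ex: "\<And>n. real n \<le> R \<Longrightarrow> \<exists>y. d x0 y = n \<and> g y = 0" for x0 R \<theta> g
  proof -
    define E where "E = En (B x0 (4 * R)) g"
    have E: "E \<ge> 0" unfolding E_def by (rule En_nonneg)
    have "\<forall>n. \<exists>y. real n \<le> R \<longrightarrow> d x0 y = n \<and> g y = 0" using ex by blast
    then obtain \<gamma> where \<gamma>: "\<And>n. real n \<le> R \<Longrightarrow> d x0 (\<gamma> n) = n \<and> g (\<gamma> n) = 0" by metis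
    define N where "N = nat \<lfloor>R\<rfloor> + 1"
    have N: "real N \<ge> R" "real N \<le> 2 * R" "\<And>n. n < N \<Longrightarrow> real n \<le> R"
      unfolding N_def using R by linarith+
    obtain k0 where "R < 2 ^ k0" using real_arch_pow[of 2 R] by auto
    then have k0: "R / 2 ^ k0 < 1" by simp
    \<comment> \<open>Minimality keeps every radius \<open>r\<close> in use at or above 1, so that
      the overlap count \<open>4 * r + 1\<close> is at most \<open>5 * r\<close>.\<close>
    define k where "k = (LEAST k. R / 2 ^ k < 1)"
    have k: "R / 2 ^ k < 1" unfolding k_def by (rule LeastI, rule k0)
    have ki: "R / 2 ^ i \<ge> 1" if "i < k" for i
      using not_less_Least[of i "\<lambda>k. R / 2 ^ k < 1"] that k_def by force
    define D where "D = R powr (b - a) * E"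
    have D: "D \<ge> 0" using E by (simp add: D_def)
    define w where "w i = (R / 2 ^ i) powr (b - a) / scale_weight ^ i" for i
    have w: "w i \<ge> 0" for i using scale_weight by (simp add: w_def)
    \<comment> \<open>The average over \<open>B x0 R\<close> is tied to the one over
      \<open>B (\<gamma> n) R\<close> through the larger ball \<open>B x0 (2 * R)\<close>, which
      contains both; from there the scales descend to the value
      \<open>g (\<gamma> n) = 0\<close>.\<close>
    have each: "\<theta>\<^sup>2 \<le> 8 * C1 * D + 2 * multiscale_const * (\<Sum>i<k. w i * En (B (\<gamma> n) (2 * (R / 2 ^ i))) g)"
      if n: "n < N" for n
    proof -
      let ?t = "avg (B x0 (2 * R)) g"
      have dist: "(avg (B y R) g - ?t)\<^sup>2 \<le> C1 * D" if "real (d x0 y) \<le> R" for y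
      proof -
        have "(avg (B y R) g - ?t)\<^sup>2 \<le> CP * (2 * R) powr b * En (B x0 (2 * (2 * R))) g / (c_vol * R powr a)"
          using R that by (intro avg_ball_diff B_subset) auto
        also have "\<dots> = C1 * D" using R c_vol_pos
          by (simp add: C1_def D_def E_def powr_mult powr_diff)
        finally show ?thesis .
      qed
      have g: "d x0 (\<gamma> n) = n" "g (\<gamma> n) = 0" using \<gamma>[OF N(3)[OF n]] by auto
      let ?A = "avg (B x0 R) g - ?t" and ?A' = "avg (B (\<gamma> n) R) g - ?t" and ?G = "avg (B (\<gamma> n) R) g"
      have "\<theta>\<^sup>2 \<le> (avg (B x0 R) g)\<^sup>2" using \<theta> by (intro power_mono) auto
      also have "\<dots> = ((?A - ?A') + ?G)\<^sup>2" by simp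
      also have "\<dots> \<le> 2 * (?A - ?A')\<^sup>2 + 2 * ?G\<^sup>2"
        by (rule sq_add_le)
      also have "(?A - ?A')\<^sup>2 \<le> 2 * ?A\<^sup>2 + 2 * ?A'\<^sup>2"
        using sq_add_le[of "?A" "- ?A'"] by (simp add: power2_commute[of _ ?t])
      also have "?A\<^sup>2 \<le> C1 * D" using R by (intro dist) simp
      also have "?A'\<^sup>2 \<le> C1 * D" using N(3)[OF n] g by (intro dist) simp
      also have "?G\<^sup>2 \<le> multiscale_const * (\<Sum>i<k. w i * En (B (\<gamma> n) (2 * (R / 2 ^ i))) g)"
        using En_scales[of R k "\<gamma> n" g] R k g by (simp add: w_def)
      finally show ?thesis by simp
    qed
    have "R * \<theta>\<^sup>2 \<le> real N * \<theta>\<^sup>2" using N by (intro mult_right_mono) auto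
    also have "\<dots> = (\<Sum>n<N. \<theta>\<^sup>2)" by simp
    also have "\<dots> \<le> (\<Sum>n<N. 8 * C1 * D + 2 * multiscale_const * (\<Sum>i<k. w i * En (B (\<gamma> n) (2 * (R / 2 ^ i))) g))"
      using each by (intro sum_mono) auto
    also have "\<dots> = real N * (8 * C1 * D)
        + 2 * multiscale_const * (\<Sum>i<k. w i * (\<Sum>n<N. En (B (\<gamma> n) (2 * (R / 2 ^ i))) g))"
      by (simp add: sum.distrib sum_distrib_left) (subst sum.swap, simp)
    also have "\<dots> \<le> 2 * R * (8 * C1 * D) + 2 * multiscale_const * (\<Sum>i<k. w i * (5 * (R / 2 ^ i) * E))"
    proof (intro add_mono mult_left_mono sum_mono mult_right_mono w)
      fix i assume i: "i \<in> {..<k}"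
      have "(\<Sum>n<N. En (B (\<gamma> n) (2 * (R / 2 ^ i))) g) \<le> (2 * (2 * (R / 2 ^ i)) + 1) * E"
        unfolding E_def
      proof (rule sum_En_overlap)
        fix n assume n: "n < N"
        show "d x0 (\<gamma> n) = n" using \<gamma> N(3)[OF n] by blast
        have "R / 2 ^ i \<le> R" using R by (simp add: divide_le_eq mult_le_cancel_left1)
        then show "B (\<gamma> n) (2 * (R / 2 ^ i)) \<subseteq> B x0 (4 * R)"
          using \<gamma> N(3)[OF n] by (intro B_subset) simp
      qed (use R in auto)
      also have "\<dots> \<le> 5 * (R / 2 ^ i) * E"
      proof (rule mult_right_mono[OF _ E])
        have "R / 2 ^ i \<ge> 1" using ki i by simp
        then show "2 * (2 * (R / 2 ^ i)) + 1 \<le> 5 * (R / 2 ^ i)" by linarith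
      qed
      finally show "(\<Sum>n<N. En (B (\<gamma> n) (2 * (R / 2 ^ i))) g) \<le> 5 * (R / 2 ^ i) * E" .
    qed (use N C1 D multiscale_const_pos in auto)
    \<comment> \<open>At radius \<open>r\<close> a summand is \<open>r powr (b - a) * r * E\<close>,
      up to constants and the weight. Writing \<open>r = R / 2 ^ i\<close> yields
      \<open>scale_weight ^ i\<close> twice: one cancels the division in \<open>w\<close>, the other
      remains.\<close>
    also have "(\<Sum>i<k. w i * (5 * (R / 2 ^ i) * E)) = (\<Sum>i<k. 5 * R * D * scale_weight ^ i)"
    proof (intro sum.cong refl)
      fix i
      have q2: "scale_weight ^ i * scale_weight ^ i = (2 ^ i) powr (- (1 + b - a))"
      proof -
        have "scale_weight * scale_weight = 2 powr (- (1 + b - a))"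
          unfolding scale_weight_def powr_add[symmetric] by (rule arg_cong[of _ _ "\<lambda>t. 2 powr t"]) simp
        then show ?thesis by (simp add: power_mult_distrib[symmetric] powr_powr powr_realpow[symmetric] mult.commute)
      qed
      have "(R / 2 ^ i) powr (b - a) * (R / 2 ^ i) = (R / 2 ^ i) powr (1 + b - a)"
        using R by (simp add: powr_add[of _ 1 "b - a", simplified add_diff_eq] mult.commute)
      also have "\<dots> = R powr (1 + b - a) * (scale_weight ^ i * scale_weight ^ i)"
        using R unfolding q2 powr_minus by (simp add: powr_divide) (simp add: divide_inverse)
      also have "R powr (1 + b - a) = R * R powr (b - a)"
        using R by (simp add: powr_add[of _ 1 "b - a", simplified add_diff_eq])
      finally have "(R / 2 ^ i) powr (b - a) * (R / 2 ^ i) = R * R powr (b - a) * (scale_weight ^ i * scale_weight ^ i)" .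
      then show "w i * (5 * (R / 2 ^ i) * E) = 5 * R * D * scale_weight ^ i"
        using scale_weight by (auto simp: w_def D_def divide_simps)
    qed
    also have "\<dots> \<le> 5 * R * D * (1 / (1 - scale_weight))"
      unfolding sum_distrib_left[symmetric]
    proof (intro mult_left_mono)
      have "(\<Sum>i<k. scale_weight ^ i) = (1 - scale_weight ^ k) / (1 - scale_weight)" using scale_weight by (simp add: sum_gp_strict)
      also have "\<dots> \<le> 1 / (1 - scale_weight)" using scale_weight by (intro divide_right_mono) auto
      finally show "(\<Sum>i<k. scale_weight ^ i) \<le> 1 / (1 - scale_weight)" .
    qed (use R D in auto)
    finally have "R * \<theta>\<^sup>2 \<le> 2 * R * (8 * C1 * D) + 2 * multiscale_const * (5 * R * D * (1 / (1 - scale_weight)))"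
      using multiscale_const_pos by simp
    also have "\<dots> = R * (c * D)" by (simp add: c_def algebra_simps)
    finally show ?thesis using R by (simp add: D_def E_def)
  qed
  then show ?thesis using that c by blast
qed

text \<open>If \<open>u x0\<close> were below \<open>\<delta>\<close>, the truncation
  \<open>g\<close> of \<open>1 + ln v / L\<close> would be 1 where \<open>u \<ge> 1\<close> and 0 at
  one point of each sphere. Its energy is at most of order \<open>R powr (a - b) / L^2\<close>, too
  little for the capacity bound once \<open>L\<close> is large. The radius \<open>8 * R\<close> is
  twice the \<open>4 * R\<close> on which the energy is measured.\<close>

lemma weak_Harnack_center:
  assumes \<theta>: "\<theta> > 0"
  obtains \<delta> where "\<delta> > 0"
    "\<And>x0 R u. R \<ge> 1 \<Longrightarrow> (\<And>z. u z \<ge> 0) \<Longrightarrow> (\<And>z. z \<in> B x0 (8 * R) \<Longrightarrow> P u z \<le> u z) \<Longrightarrow>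
      \<theta> * V x0 R \<le> (\<Sum>z\<in>{z\<in>B x0 R. u z \<ge> 1}. m z) \<Longrightarrow> \<delta> \<le> u x0"
proof -
  obtain c where c: "c > 0" and cap:
    "\<And>x0 R \<theta> g. R \<ge> 1 \<Longrightarrow> \<theta> \<ge> 0 \<Longrightarrow> avg (B x0 R) g \<ge> \<theta> \<Longrightarrow>
      (\<And>n. real n \<le> R \<Longrightarrow> \<exists>y. d x0 y = n \<and> g y = 0) \<Longrightarrow>
      \<theta>\<^sup>2 \<le> c * (R powr (b - a) * En (B x0 (4 * R)) g)"
    using capacity_lower_bound by blast
  define C2 where "C2 = 64 * CC * CV * 4 powr (a - b)"
  have C2: "C2 > 0" unfolding C2_def using CC1 CV1 by simp
  \<comment> \<open>The final inequality reads \<open>L \<le> sqrt (c * C2) / \<theta>\<close>; the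
    added 2 contradicts it and keeps \<open>L\<close> positive.\<close>
  define L where "L = sqrt (c * C2) / \<theta> + 2"
  have L0: "sqrt (c * C2) / \<theta> \<ge> 0" using c C2 \<theta> by simp
  then have L: "L \<ge> 2" by (simp add: L_def)
  \<comment> \<open>Where \<open>u \<le> u x0 < \<delta>\<close>, the shifted function
    \<open>v = u + \<delta>\<close> is below \<open>2 * \<delta> = exp (- L)\<close>, so
    \<open>g\<close> vanishes there.\<close>
  define \<delta> where "\<delta> = exp (- L) / 2"
  have \<delta>: "\<delta> > 0" by (simp add: \<delta>_def)
  have "\<delta> \<le> u x0" if R: "R \<ge> 1" and u: "\<And>z. u z \<ge> 0"
    and sup: "\<And>z. z \<in> B x0 (8 * R) \<Longrightarrow> P u z \<le> u z"
    and meas: "\<theta> * V x0 R \<le> (\<Sum>z\<in>{z\<in>B x0 R. u z \<ge> 1}. m z)" for x0 R u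
  proof (rule ccontr)
    assume "\<not> \<delta> \<le> u x0"
    then have small: "u x0 < \<delta>" by simp
    define v where "v = (\<lambda>z. u z + \<delta>)"
    have v: "v z > 0" for z using u[of z] \<delta> by (simp add: v_def)
    define g where "g = (\<lambda>z. max 0 (min 1 (1 + ln (v z) / L)))"
    define E where "E = En (B x0 (4 * R)) g"
    have avg: "avg (B x0 R) g \<ge> \<theta>"
    proof -
      have g1: "g z = 1" if "u z \<ge> 1" for z
      proof -
        have "ln (v z) \<ge> 0" using that \<delta> by (simp add: v_def)
        then have "ln (v z) / L \<ge> 0" using L by simp
        then show ?thesis by (simp add: g_def)
      qed
      have "\<theta> * V x0 R \<le> (\<Sum>z\<in>{z\<in>B x0 R. u z \<ge> 1}. g z * m z)" using meas g1 by simp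
      also have "\<dots> \<le> (\<Sum>z\<in>B x0 R. g z * m z)" by (intro sum_mono2) (auto simp: g_def)
      finally show ?thesis using V_pos[of R x0] R
        by (simp add: avg_def V_eq_sum[symmetric] le_divide_eq)
    qed
    have "\<exists>y. d x0 y = n \<and> g y = 0" if n: "real n \<le> R" for n
    proof -
      have "P u z \<le> u z" if "d x0 z < n" for z
        using that n R by (intro sup) (simp add: mem_B)
      then obtain y where y: "d x0 y = n" "u y \<le> u x0" using minimum_principle by blast
      then have "v y \<le> exp (- L)" using small by (simp add: v_def \<delta>_def)
      then have "ln (v y) \<le> - L" using v[of y] by (metis exp_gt_zero ln_exp ln_le_cancel_iff)
      then have "ln (v y) / L \<le> -1" using L by (simp add: divide_le_eq)
      then show ?thesis using y by (auto simp: g_def)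
    qed
    then have 1: "\<theta>\<^sup>2 \<le> c * (R powr (b - a) * E)"
      unfolding E_def using R \<theta> avg by (intro cap) auto
    have "E \<le> En (B x0 (4 * R)) (\<lambda>z. ln (v z) / L)"
      unfolding E_def by (rule En_le) (auto simp: g_def max_def min_def)
    also have "\<dots> = En (B x0 (4 * R)) (\<lambda>z. ln (v z)) / L\<^sup>2"
      unfolding En_def sum_divide_distrib
      by (simp add: diff_divide_distrib[symmetric] power_divide)
    also have "\<dots> \<le> (64 * CC * V x0 (4 * R) / (4 * R) powr b) / L\<^sup>2"
    proof (intro divide_right_mono log_energy v)
      fix z assume "z \<in> B x0 (2 * (4 * R))"
      then show "P v z \<le> v z" using sup[of z] by (simp add: v_def P_add)
    qed (use R in auto)
    also have "\<dots> \<le> (64 * CC * (CV * (4 * R) powr a) / (4 * R) powr b) / L\<^sup>2"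
      using R CC1 by (intro divide_right_mono mult_left_mono V_upper) auto
    also have "\<dots> = C2 * R powr (a - b) / L\<^sup>2"
      using R by (simp add: C2_def powr_mult powr_diff)
    finally have "E \<le> C2 * R powr (a - b) / L\<^sup>2" .
    then have "c * (R powr (b - a) * E) \<le> c * (R powr (b - a) * (C2 * R powr (a - b) / L\<^sup>2))"
      using c by (intro mult_left_mono) auto
    also have "\<dots> = c * C2 / L\<^sup>2 * (R powr (b - a) * R powr (a - b))" by simp
    also have "R powr (b - a) * R powr (a - b) = 1" using R by (simp add: powr_add[symmetric])
    finally have "\<theta>\<^sup>2 \<le> c * C2 / L\<^sup>2" using 1 by simp
    then have "L\<^sup>2 * \<theta>\<^sup>2 \<le> c * C2" using L by (simp add: le_divide_eq mult.commute)
    then have "(L * \<theta>)\<^sup>2 \<le> c * C2" by (simp add: power_mult_distrib)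
    then have "L * \<theta> \<le> sqrt (c * C2)" using real_le_rsqrt by blast
    then have "L \<le> sqrt (c * C2) / \<theta>" using \<theta> by (simp add: le_divide_eq)
    then show False by (simp add: L_def)
  qed
  then show ?thesis using that \<delta> by blast
qed

text \<open>Recentring at \<open>y\<close> with radius \<open>2 * R\<close> moves the estimate off
  the centre: \<open>8 * (2 * R) + R\<close> explains the 17. Extending \<open>u\<close> by zero
  outside \<open>B x0 (17 * R + 1)\<close> makes it nonnegative everywhere and leaves
  \<open>P u\<close> unchanged on \<open>B x0 (17 * R)\<close>.\<close>

lemma weak_Harnack:
  assumes \<theta>: "\<theta> > 0"
  obtains \<delta> where "\<delta> > 0" "\<delta> \<le> 1"
    "\<And>x0 R u s y. R \<ge> 1 \<Longrightarrow> s > 0 \<Longrightarrow> (\<And>z. z \<in> B x0 (17 * R + 1) \<Longrightarrow> u z \<ge> 0) \<Longrightarrow>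
      (\<And>z. z \<in> B x0 (17 * R) \<Longrightarrow> P u z \<le> u z) \<Longrightarrow>
      \<theta> * V x0 R \<le> (\<Sum>z\<in>{z\<in>B x0 R. u z \<ge> s}. m z) \<Longrightarrow> y \<in> B x0 R \<Longrightarrow> \<delta> * s \<le> u y"
proof -
  \<comment> \<open>The fraction shrinks by the volume ratio between \<open>B x0 R\<close> and the
    ball \<open>B y (2 * R)\<close> that contains it.\<close>
  define \<theta>' where "\<theta>' = \<theta> * c_vol / (CV * 2 powr a)"
  have "\<theta>' > 0" unfolding \<theta>'_def using \<theta> c_vol_pos CV1 by simp
  then obtain \<delta> where \<delta>: "\<delta> > 0" and wh:
    "\<And>x0 R u. R \<ge> 1 \<Longrightarrow> (\<And>z. u z \<ge> 0) \<Longrightarrow> (\<And>z. z \<in> B x0 (8 * R) \<Longrightarrow> P u z \<le> u z) \<Longrightarrow>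
      \<theta>' * V x0 R \<le> (\<Sum>z\<in>{z\<in>B x0 R. u z \<ge> 1}. m z) \<Longrightarrow> \<delta> \<le> u x0"
    using weak_Harnack_center by blast
  have "min \<delta> 1 * s \<le> u y" if R: "R \<ge> 1" and s: "s > 0" and u: "\<And>z. z \<in> B x0 (17 * R + 1) \<Longrightarrow> u z \<ge> 0"
    and sup: "\<And>z. z \<in> B x0 (17 * R) \<Longrightarrow> P u z \<le> u z"
    and meas: "\<theta> * V x0 R \<le> (\<Sum>z\<in>{z\<in>B x0 R. u z \<ge> s}. m z)" and y: "y \<in> B x0 R" for x0 R u s y
  proof -
    define v where "v = (\<lambda>z. 1 / s * (if z \<in> B x0 (17 * R + 1) then u z else 0))"
    have sub: "B x0 (17 * R) \<subseteq> B x0 (17 * R + 1)" by (rule B_mono) simp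
    have sub2: "B x0 R \<subseteq> B y (2 * R)" using y R by (intro B_subset) (simp add: mem_B d_sym)
    have sub3: "B x0 R \<subseteq> B x0 (17 * R + 1)" using R by (intro B_mono) simp
    have "\<delta> \<le> v y"
    proof (rule wh[of "2 * R"])
      show "v z \<ge> 0" for z using u[of z] s by (simp add: v_def)
    next
      fix z assume "z \<in> B y (8 * (2 * R))"
      moreover have "B y (8 * (2 * R)) \<subseteq> B x0 (17 * R)" using y by (intro B_subset) (simp add: mem_B)
      ultimately have z: "z \<in> B x0 (17 * R)" by blast
      have "P v z = 1 / s * P (\<lambda>z. if z \<in> B x0 (17 * R + 1) then u z else 0) z"
        unfolding v_def by (rule P_cmult)
      also have "P (\<lambda>z. if z \<in> B x0 (17 * R + 1) then u z else 0) z = P u z"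
        using nbr_B[OF z] by (intro P_cong) auto
      also have "1 / s * P u z \<le> 1 / s * u z" using s sup[OF z] by (intro mult_left_mono) auto
      also have "\<dots> = v z" using z sub by (auto simp: v_def)
      finally show "P v z \<le> v z" .
    next
      have "\<theta>' * V y (2 * R) \<le> \<theta>' * (CV * 2 powr a * R powr a)"
        using \<open>\<theta>' > 0\<close> R by (intro mult_left_mono V_doubling_ratio) auto
      also have "\<dots> = \<theta> * (c_vol * R powr a)" using CV1 by (simp add: \<theta>'_def)
      also have "\<dots> \<le> \<theta> * V x0 R" using \<theta> R by (intro mult_left_mono V_lower) auto
      also have "\<dots> \<le> (\<Sum>z\<in>{z\<in>B x0 R. u z \<ge> s}. m z)" by (rule meas)
      also have "\<dots> \<le> (\<Sum>z\<in>{z\<in>B y (2 * R). v z \<ge> 1}. m z)"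
        using sub2 sub3 s by (intro sum_mono2) (auto simp: v_def)
      finally show "\<theta>' * V y (2 * R) \<le> (\<Sum>z\<in>{z\<in>B y (2 * R). v z \<ge> 1}. m z)" .
    qed (use R in auto)
    then have "\<delta> * s \<le> u y" using s y sub3 by (auto simp: v_def le_divide_eq)
    moreover have "min \<delta> 1 * s \<le> \<delta> * s" using s by (intro mult_right_mono) auto
    ultimately show ?thesis by linarith
  qed
  note wh' = this
  show ?thesis
    by (rule that[of "min \<delta> 1"]) (use \<delta> in simp, simp, rule wh')
qed

end

section \<open>Nash inequality and time regularity\<close>

text \<open>A convex sequence that increased once would grow at least linearly from then on. This
  replaces the spectral reason why quadratic forms of powers of \<open>P^2\<close> decrease in
  time.\<close>

lemma convex_bounded_antimono:
  fixes f :: "nat \<Rightarrow> real"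
  assumes conv: "\<And>k. f k - 2 * f (Suc k) + f (Suc (Suc k)) \<ge> 0" and bd: "\<And>k. f k \<le> K"
  shows "f (Suc k) \<le> f k"
proof (rule ccontr)
  assume "\<not> f (Suc k) \<le> f k"
  then have pos: "f (Suc k) - f k > 0" (is "?e > 0") by simp
  have step: "f (Suc (k + n)) - f (k + n) \<ge> ?e" for n
  proof (induction n)
    case (Suc n)
    then show ?case using conv[of "k + n"] by simp
  qed simp
  have grow: "f (k + n) \<ge> f k + n * ?e" for n
  proof (induction n)
    case (Suc n)
    then show ?case using step[of n] by (simp add: algebra_simps)
  qed simp
  obtain n :: nat where "n * ?e > K - f k" using pos ex_less_of_nat_mult by blast
  then show False using grow[of n] bd[of "k + n"] by simp
qed

text \<open>The \<open>k\<close> differences from index \<open>k\<close> to \<open>2 * k - 1\<close>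
  are each at least \<open>g (2 * k)\<close> and sum to at most \<open>f k\<close>. Each application
  gains a factor of order \<open>1 / k\<close>.\<close>

lemma antimono_difference_bound:
  fixes f g :: "nat \<Rightarrow> real"
  assumes g: "\<And>k. g k = f k - f (Suc k)" and f: "\<And>k. f k \<ge> 0" and anti: "\<And>k. g (Suc k) \<le> g k"
  shows "k * g (2 * k) \<le> f k"
proof -
  have ganti: "g j \<le> g i" if "i \<le> j" for i j
    using that lift_Suc_antimono_le[of g] anti by blast
  have "k * g (2 * k) = (\<Sum>i<k. g (2 * k))" by simp
  also have "\<dots> \<le> (\<Sum>i<k. g (k + i))" by (intro sum_mono ganti) auto
  also have "\<dots> = f k - f (k + k)"
    using sum_lessThan_telescope'[of "\<lambda>i. f (k + i)" k] by (simp add: g)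
  also have "\<dots> \<le> f k" using f by simp
  finally show ?thesis .
qed

text \<open>Discrete form of \<open>u' \<le> - \<kappa> u^(1+s)\<close>: the quantity
  \<open>u powr (- s)\<close> grows by at least \<open>s * \<kappa>\<close> at every step.\<close>

lemma decay_from_difference_inequality:
  fixes u :: "nat \<Rightarrow> real"
  assumes u: "\<And>k. u k > 0" and s: "s > 0" and \<kappa>: "\<kappa> > 0"
    and diff: "\<And>k. u k - u (Suc k) \<ge> \<kappa> * u k powr (1 + s)" and n: "n \<ge> 1"
  shows "u n \<le> (s * \<kappa> * real n) powr (- (1 / s))"
proof -
  have step: "u (Suc k) powr (- s) \<ge> u k powr (- s) + s * \<kappa>" for k
  proof -
    define x where "x = u (Suc k) / u k"
    have x: "x > 0" using u[of k] u[of "Suc k"] by (simp add: x_def)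
    have xk: "1 - x \<ge> \<kappa> * u k powr s"
    proof -
      have "u k * (1 - x) = u k - u (Suc k)" using u[of k] by (simp add: x_def field_simps)
      also have "\<dots> \<ge> u k * (\<kappa> * u k powr s)" using diff[of k] u[of k] by (simp add: powr_add algebra_simps)
      finally show ?thesis using u[of k] by simp
    qed
    have "x powr (- s) = exp (- s * ln x)" using x by (simp add: powr_def)
    moreover have "exp (- s * ln x) \<ge> 1 + (- s * ln x)" by (rule exp_ge_add_one_self)
    moreover have "- s * ln x \<ge> s * (1 - x)"
      using mult_left_mono[OF ln_le_minus_one[OF x], of s] s by (simp add: algebra_simps)
    moreover have "s * (1 - x) \<ge> s * (\<kappa> * u k powr s)" using xk s by simp
    ultimately have "x powr (- s) \<ge> 1 + s * (\<kappa> * u k powr s)" by simp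
    then have "u k powr (- s) * x powr (- s) \<ge> u k powr (- s) * (1 + s * (\<kappa> * u k powr s))"
      by (intro mult_left_mono) auto
    moreover have "u k powr (- s) * x powr (- s) = u (Suc k) powr (- s)"
      using u[of k] u[of "Suc k"] x by (subst powr_mult[symmetric]) (auto simp: x_def)
    moreover have "u k powr (- s) * u k powr s = 1" using u[of k] by (simp add: powr_add[symmetric])
    then have "u k powr (- s) * (1 + s * (\<kappa> * u k powr s)) = u k powr (- s) + s * \<kappa>"
      by (simp add: distrib_left mult.left_commute)
    ultimately show ?thesis by simp
  qed
  have "u n powr (- s) \<ge> s * \<kappa> * real n"
  proof (induction n)
    case (Suc n)
    then show ?case using step[of n] by (simp add: algebra_simps)
  qed simp
  then have "(u n powr (- s)) powr (- (1 / s)) \<le> (s * \<kappa> * real n) powr (- (1 / s))"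
    using s \<kappa> n by (intro powr_mono2') auto
  then show ?thesis using u[of n] s by (simp add: powr_powr)
qed

context wgraph
begin

section \<open>Differences of the diagonal heat kernel as squared norms\<close>

lemma h_inner: "finite Z \<Longrightarrow> B x (real i) \<subseteq> Z \<Longrightarrow> (\<Sum>z\<in>Z. h i x z * h j y z * m z) = h (i + j) x y"
  using h_add[of Z x i j y] by (simp add: h_sym[of j y])

lemma p_le_1: "p n x y \<le> 1"
proof -
  have "p n x y \<le> (\<Sum>z\<in>insert y (B x (real n)). p n x z)"
    by (rule member_le_sum) (auto simp: p_nonneg)
  also have "\<dots> = 1" by (intro p_sum) auto
  finally show ?thesis .
qed

lemma h_even_pos: "h (2 * n) x x > 0"
proof -
  have "\<exists>z. h n x z \<noteq> 0"
  proof (rule ccontr)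
    assume "\<nexists>z. h n x z \<noteq> 0"
    then show False using h_sum[of "B x (real n)" x n] by simp
  qed
  then obtain z where z: "h n x z \<noteq> 0" by blast
  then have zB: "z \<in> B x (real n)" using h_eq_0[of n x z] by (force simp: mem_B)
  have "0 < (\<Sum>z\<in>B x (real n). h n x z * h n x z * m z)"
    using z zB m_pos by (intro sum_pos2[of _ z]) (auto simp: h_nonneg zero_less_mult_iff less_le)
  also have "\<dots> = h (2 * n) x x" using h_inner[of "B x (real n)" x n n x] by (simp add: mult_2)
  finally show ?thesis .
qed

text \<open>The squared norm of \<open>(I - P^2) h k\<close>. It makes \<open>h (2 * k) x x\<close>
  convex in \<open>k\<close>.\<close>

lemma h_second_difference:
  assumes "finite Z" "B x (real (k + 2)) \<subseteq> Z"
  shows "(\<Sum>z\<in>Z. (h k x z - h (k + 2) x z)\<^sup>2 * m z) = h (2*k) x x - 2 * h (2*k+2) x x + h (2*k+4) x x"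
proof -
  have sub: "B x (real k) \<subseteq> Z" using assms B_mono[of "real k" "real (k+2)" x] by simp
  have "(\<Sum>z\<in>Z. (h k x z - h (k + 2) x z)\<^sup>2 * m z)
     = (\<Sum>z\<in>Z. h k x z * h k x z * m z) - 2 * (\<Sum>z\<in>Z. h k x z * h (k+2) x z * m z)
       + (\<Sum>z\<in>Z. h (k+2) x z * h (k+2) x z * m z)"
    unfolding sum_distrib_left sum_subtractf[symmetric] sum.distrib[symmetric]
    by (intro sum.cong) (auto simp: power2_eq_square algebra_simps)
  also have "\<dots> = h (k + k) x x - 2 * h (k + (k+2)) x x + h (k + 2 + (k + 2)) x x"
    using h_inner[OF assms(1) sub] h_inner[OF assms] by (simp only:)
  also have "k + k = 2 * k" by simp
  also have "k + (k + 2) = 2 * k + 2" by simp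
  also have "k + 2 + (k + 2) = 2 * k + 4" by simp
  finally show ?thesis .
qed

text \<open>The squared norm of \<open>(I - P^2)^2 h k\<close>. The coefficients 1, -4, 6, -4, 1 are
  the fourth difference of \<open>h (2 * k) x x\<close> in \<open>k\<close>, so the second
  difference of that sequence is again convex.\<close>

lemma h_third_difference:
  assumes "finite Z" "B x (real (k + 4)) \<subseteq> Z"
  shows "(\<Sum>z\<in>Z. (h k x z - 2 * h (k + 2) x z + h (k + 4) x z)\<^sup>2 * m z)
     = h (2*k) x x - 4 * h (2*k+2) x x + 6 * h (2*k+4) x x - 4 * h (2*k+6) x x + h (2*k+8) x x"
proof -
  have sub: "B x (real k) \<subseteq> Z" "B x (real (k+2)) \<subseteq> Z"
    using assms B_mono[of "real k" "real (k+4)" x] B_mono[of "real (k+2)" "real (k+4)" x] by simp_all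
  have "(\<Sum>z\<in>Z. (h k x z - 2 * h (k + 2) x z + h (k + 4) x z)\<^sup>2 * m z)
     = (\<Sum>z\<in>Z. h k x z * h k x z * m z) - 4 * (\<Sum>z\<in>Z. h k x z * h (k+2) x z * m z)
       + 4 * (\<Sum>z\<in>Z. h (k+2) x z * h (k+2) x z * m z) + 2 * (\<Sum>z\<in>Z. h k x z * h (k+4) x z * m z)
       - 4 * (\<Sum>z\<in>Z. h (k+2) x z * h (k+4) x z * m z) + (\<Sum>z\<in>Z. h (k+4) x z * h (k+4) x z * m z)"
    unfolding sum_distrib_left sum_subtractf[symmetric] sum.distrib[symmetric]
    by (intro sum.cong) (auto simp: power2_eq_square algebra_simps)
  also have "\<dots> = h (k + k) x x - 4 * h (k + (k+2)) x x + 4 * h (k + 2 + (k + 2)) x x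
     + 2 * h (k + (k+4)) x x - 4 * h (k+2 + (k+4)) x x + h (k+4+(k+4)) x x"
    using h_inner[OF assms(1) sub(1)] h_inner[OF assms(1) sub(2)] h_inner[OF assms] by (simp only:)
  also have "k + k = 2 * k" by simp
  also have "k + (k + 2) = 2 * k + 2" by simp
  also have "k + 2 + (k + 2) = 2 * k + 4" by simp
  also have "k + (k + 4) = 2 * k + 4" by simp
  also have "k + 2 + (k + 4) = 2 * k + 6" by simp
  also have "k + 4 + (k + 4) = 2 * k + 8" by simp
  finally show ?thesis by simp
qed

text \<open>For \<open>f\<close> supported well inside \<open>Z\<close> this says that
  \<open>I + P\<close> is nonnegative, since \<open>En\<close> is then twice the form of
  \<open>I - P\<close>.\<close>

lemma En_le_4_norm:
  assumes "finite Z" shows "En Z f \<le> 4 * (\<Sum>z\<in>Z. (f z)\<^sup>2 * m z)"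
proof -
  have row: "(\<Sum>x\<in>Z. \<Sum>y\<in>Z. (f x)\<^sup>2 * mu x y) \<le> (\<Sum>z\<in>Z. (f z)\<^sup>2 * m z)"
    unfolding sum_distrib_left[symmetric] using assms by (intro sum_mono mult_left_mono m_ge_sum) auto
  have col: "(\<Sum>x\<in>Z. \<Sum>y\<in>Z. (f y)\<^sup>2 * mu x y) = (\<Sum>x\<in>Z. \<Sum>y\<in>Z. (f x)\<^sup>2 * mu x y)"
    by (subst sum.swap) (simp add: mu_sym)
  have "En Z f \<le> (\<Sum>x\<in>Z. \<Sum>y\<in>Z. (2 * (f x)\<^sup>2 + 2 * (f y)\<^sup>2) * mu x y)"
    unfolding En_def
  proof (intro sum_mono mult_right_mono mu_nonneg)
    fix x y show "(f x - f y)\<^sup>2 \<le> 2 * (f x)\<^sup>2 + 2 * (f y)\<^sup>2" using sq_add_le[of "f x" "- f y"] by simp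
  qed
  also have "\<dots> = 2 * (\<Sum>x\<in>Z. \<Sum>y\<in>Z. (f x)\<^sup>2 * mu x y) + 2 * (\<Sum>x\<in>Z. \<Sum>y\<in>Z. (f y)\<^sup>2 * mu x y)"
    by (simp add: sum_distrib_left sum.distrib distrib_right mult.assoc)
  finally show ?thesis using row col by linarith
qed

text \<open>This is \<open>\<langle>(I + P) w, w\<rangle> \<ge> 0\<close> for \<open>w = (I - P) h\<^sub>n\<close>.\<close>

lemma h_alternating: "h (2*n) x x - h (2*n+1) x x - h (2*n+2) x x + h (2*n+3) x x \<ge> 0"
proof -
  define w where "w z = h n x z - h (n+1) x z" for z
  define S where "S = B x (real (n+1))"
  define Z where "Z = B x (real (n+1) + 1)"
  have SZ: "finite S" "finite Z" "S \<subseteq> Z" by (auto simp: S_def Z_def intro!: B_mono)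
  have sub: "B x (real n) \<subseteq> S" "B x (real (n+1)) \<subseteq> S" by (auto simp: S_def intro!: B_mono)
  have w0: "w z = 0" if "z \<notin> S" for z
    using that h_eq_0[of n x z] h_eq_0[of "n+1" x z] by (auto simp: w_def S_def mem_B)
  have nbr: "{y. adj z y} \<subseteq> Z" if "z \<in> S" for z
    using nbr_B[of z x "real (n+1)"] that unfolding S_def Z_def by blast
  have Pw: "P w z = h (n+1) x z - h (n+2) x z" for z
  proof -
    have "P w z = P (\<lambda>y. h n y x - h (n+1) y x) z"
      by (rule P_cong) (simp add: w_def h_sym[of _ x])
    also have "\<dots> = P (\<lambda>y. h n y x) z - P (\<lambda>y. h (n+1) y x) z" by (rule P_diff)
    finally have "P w z = P (\<lambda>y. h n y x) z - P (\<lambda>y. h (n+1) y x) z" .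
    then show ?thesis using h_Suc[of n z x] h_Suc[of "n+1" z x] by (simp add: h_sym[of _ x])
  qed
  have "(\<Sum>z\<in>S. w z * (w z - P w z) * m z) = (\<Sum>x\<in>Z. \<Sum>y\<in>Z. (w x - w y) * (w x - w y) * mu x y) / 2"
    using SZ w0 nbr by (intro Green_formula)
  also have "\<dots> = En Z w / 2" by (simp add: En_def power2_eq_square)
  also have "\<dots> \<le> 2 * (\<Sum>z\<in>Z. (w z)\<^sup>2 * m z)" using En_le_4_norm[of Z w] SZ by simp
  also have "(\<Sum>z\<in>Z. (w z)\<^sup>2 * m z) = (\<Sum>z\<in>S. (w z)\<^sup>2 * m z)"
    using SZ w0 by (intro sum.mono_neutral_right) auto
  finally have "0 \<le> 2 * (\<Sum>z\<in>S. (w z)\<^sup>2 * m z) - (\<Sum>z\<in>S. w z * (w z - P w z) * m z)" by simp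
  also have "\<dots> = (\<Sum>z\<in>S. w z * (w z + P w z) * m z)"
    unfolding sum_distrib_left sum_subtractf[symmetric]
    by (intro sum.cong) (auto simp: power2_eq_square algebra_simps)
  also have "\<dots> = (\<Sum>z\<in>S. h n x z * h n x z * m z) - (\<Sum>z\<in>S. h n x z * h (n+2) x z * m z)
       - (\<Sum>z\<in>S. h (n+1) x z * h n x z * m z) + (\<Sum>z\<in>S. h (n+1) x z * h (n+2) x z * m z)"
    unfolding Pw w_def sum_subtractf[symmetric] sum.distrib[symmetric]
    by (intro sum.cong) (auto simp: algebra_simps)
  also have "\<dots> = h (n+n) x x - h (n + (n+2)) x x - h (n+1+n) x x + h (n+1+(n+2)) x x"
    using h_inner[OF SZ(1) sub(1)] h_inner[OF SZ(1) sub(2)] by (simp only:)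
  also have "n + n = 2 * n" by simp
  also have "n + (n + 2) = 2 * n + 2" by simp
  also have "n + 1 + n = 2 * n + 1" by simp
  also have "n + 1 + (n + 2) = 2 * n + 3" by simp
  finally show ?thesis by simp
qed

text \<open>The energy of \<open>h n\<close> alone involves \<open>h (2 * n) - h (2 * n + 1)\<close>
  on the diagonal, which on a bipartite graph is all of \<open>h (2 * n)\<close>. For the pair the
  drops run over two steps, and \<open>h_alternating\<close> bounds the odd drop by the even
  one.\<close>

lemma energy_h_pair:
  assumes "finite Z"
  shows "En Z (\<lambda>z. h n x z + h (n+1) x z) \<le> 4 * (h (2*n) x x - h (2*n+2) x x)"
proof -
  define g where "g z = h n x z + h (n+1) x z" for z
  define S where "S = B x (real (n+1))"
  define Y where "Y = Z \<union> B x (real (n+1) + 1)"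
  have SY: "finite S" "finite Y" "S \<subseteq> Y" "Z \<subseteq> Y"
    using assms B_mono[of "real (n+1)" "real (n+1) + 1" x] by (auto simp: S_def Y_def)
  have sub: "B x (real n) \<subseteq> S" "B x (real (n+1)) \<subseteq> S" by (auto simp: S_def intro!: B_mono)
  have g0: "g z = 0" if "z \<notin> S" for z
    using that h_eq_0[of n x z] h_eq_0[of "n+1" x z] by (auto simp: g_def S_def mem_B)
  have nbr: "{y. adj z y} \<subseteq> Y" if "z \<in> S" for z
    using nbr_B[of z x "real (n+1)"] that unfolding S_def Y_def by blast
  have Pg: "P g z = h (n+1) x z + h (n+2) x z" for z
  proof -
    have "P g z = P (\<lambda>y. h n y x + h (n+1) y x) z"
      by (rule P_cong) (simp add: g_def h_sym[of _ x])
    also have "\<dots> = P (\<lambda>y. h n y x) z + P (\<lambda>y. h (n+1) y x) z" by (rule P_add)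
    finally have "P g z = P (\<lambda>y. h n y x) z + P (\<lambda>y. h (n+1) y x) z" .
    then show ?thesis using h_Suc[of n z x] h_Suc[of "n+1" z x] by (simp add: h_sym[of _ x])
  qed
  have "En Z g / 2 \<le> En Y g / 2" using SY by (intro divide_right_mono En_mono) auto
  also have "\<dots> = (\<Sum>x\<in>Y. \<Sum>y\<in>Y. (g x - g y) * (g x - g y) * mu x y) / 2"
    by (simp add: En_def power2_eq_square)
  also have "\<dots> = (\<Sum>z\<in>S. g z * (g z - P g z) * m z)"
    using SY g0 nbr by (intro Green_formula[symmetric])
  also have "\<dots> = (\<Sum>z\<in>S. h n x z * h n x z * m z) - (\<Sum>z\<in>S. h n x z * h (n+2) x z * m z)
       + (\<Sum>z\<in>S. h (n+1) x z * h n x z * m z) - (\<Sum>z\<in>S. h (n+1) x z * h (n+2) x z * m z)"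
    unfolding Pg g_def sum_subtractf[symmetric] sum.distrib[symmetric]
    by (intro sum.cong) (auto simp: algebra_simps)
  also have "\<dots> = h (n+n) x x - h (n + (n+2)) x x + h (n+1+n) x x - h (n+1+(n+2)) x x"
    using h_inner[OF SY(1) sub(1)] h_inner[OF SY(1) sub(2)] by (simp only:)
  also have "\<dots> = h (2*n) x x - h (2*n+2) x x + h (2*n+1) x x - h (2*n+3) x x"
  proof -
    have "n + n = 2 * n" "n + (n + 2) = 2 * n + 2" "n + 1 + n = 2 * n + 1" "n + 1 + (n + 2) = 2 * n + 3"
      by simp_all
    then show ?thesis by (simp only:)
  qed
  finally show ?thesis using h_alternating[of n x] by (simp add: g_def[abs_def])
qed

lemma double_count:
  assumes "finite X" "finite Y" "\<And>x. x \<in> X \<Longrightarrow> B x s \<subseteq> Y"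
  shows "(\<Sum>x\<in>X. m x * (\<Sum>y\<in>B x s. F y)) = (\<Sum>y\<in>Y. F y * (\<Sum>x\<in>X \<inter> B y s. m x))"
proof -
  have "(\<Sum>x\<in>X. m x * (\<Sum>y\<in>B x s. F y)) = (\<Sum>x\<in>X. \<Sum>y\<in>Y. if y \<in> B x s then m x * F y else 0)"
    using assms by (intro sum.cong) (auto simp: sum_distrib_left sum.If_cases Int_absorb1)
  also have "\<dots> = (\<Sum>y\<in>Y. \<Sum>x\<in>X. if x \<in> B y s then m x * F y else 0)"
    by (subst sum.swap) (simp add: mem_B d_sym)
  also have "\<dots> = (\<Sum>y\<in>Y. F y * (\<Sum>x\<in>X \<inter> B y s. m x))"
    using assms by (intro sum.cong) (auto simp: sum_distrib_left sum.If_cases mult.commute)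
  finally show ?thesis .
qed

end

context hk_graph
begin

lemma h_bounded: "h n x y \<le> 1 / c_vol"
proof -
  have "h n x y \<le> 1 / m y" unfolding hn_def by (intro divide_right_mono p_le_1) simp
  also have "\<dots> \<le> 1 / c_vol" using c_vol_pos m_lower by (intro divide_left_mono) (auto simp: m_pos)
  finally show ?thesis .
qed

lemma h_even_antimono: "h (2 * n + 2) x x \<le> h (2 * n) x x"
proof -
  have "h (2 * Suc n) x x \<le> h (2 * n) x x"
  proof (rule convex_bounded_antimono[where K = "1 / c_vol" and f = "\<lambda>n. h (2 * n) x x"])
    fix k
    have e: "2 * Suc k = 2 * k + 2" "2 * Suc (Suc k) = 2 * k + 4" by simp_all
    have "0 \<le> (\<Sum>z\<in>B x (real (k+2)). (h k x z - h (k + 2) x z)\<^sup>2 * m z)" by (intro sum_nonneg) auto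
    then show "h (2*k) x x - 2 * h (2 * Suc k) x x + h (2 * Suc (Suc k)) x x \<ge> 0"
      unfolding e by (subst (asm) h_second_difference) simp_all
  qed (rule h_bounded)
  then show ?thesis by simp
qed

text \<open>The radius \<open>r\<close> is left free: its later choice balances the energy term
  against the mass term. Summing the local inequalities over centres weighted by \<open>m\<close>
  counts each vertex about \<open>r powr a\<close> times on both sides, so the count
  cancels.\<close>

lemma Nash:
  obtains C where "C > 0"
    "\<And>f S r E. finite S \<Longrightarrow> (\<And>x. f x \<ge> 0) \<Longrightarrow> (\<And>x. x \<notin> S \<Longrightarrow> f x = 0) \<Longrightarrow> r \<ge> 1 \<Longrightarrow>
      (\<And>Z. finite Z \<Longrightarrow> En Z f \<le> E) \<Longrightarrow>
      (\<Sum>x\<in>S. (f x)\<^sup>2 * m x) \<le> C * (r powr b * E + r powr (- a) * (\<Sum>x\<in>S. f x * m x)\<^sup>2)"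
proof -
  define C where "C = 2 * CP * CV * 2 powr a / c_vol + 2 * CV / c_vol\<^sup>2"
  have C: "C > 0" unfolding C_def using CP1 CV1 c_vol_pos by (intro add_pos_pos divide_pos_pos mult_pos_pos) auto
  have "(\<Sum>x\<in>S. (f x)\<^sup>2 * m x) \<le> C * (r powr b * E + r powr (- a) * (\<Sum>x\<in>S. f x * m x)\<^sup>2)"
    if S: "finite S" and f: "\<And>x. f x \<ge> 0" and f0: "\<And>x. x \<notin> S \<Longrightarrow> f x = 0" and r: "r \<ge> 1"
      and E: "\<And>Z. finite Z \<Longrightarrow> En Z f \<le> E" for f S r E
  proof -
    define F1 where "F1 = (\<Sum>x\<in>S. f x * m x)"
    \<comment> \<open>All centres whose \<open>r\<close>-ball meets \<open>S\<close>. For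
      \<open>y\<close> in \<open>S\<close> the whole ball \<open>B y r\<close> then consists of such
      centres, which gives the lower count.\<close>
    define X where "X = (\<Union>s\<in>S. B s r)"
    define Y where "Y = S \<union> (\<Union>x\<in>X. B x (2 * r))"
    have X: "finite X" "finite Y" "X \<subseteq> Y" "S \<subseteq> Y"
    proof -
      show "X \<subseteq> Y" using r center_B[of "2 * r"] by (auto simp: Y_def simp del: center_B)
    qed (use S in \<open>auto simp: X_def Y_def\<close>)
    have Y2: "B x (2 * r) \<subseteq> Y" if "x \<in> X" for x using that by (auto simp: Y_def)
    have Y1: "B x r \<subseteq> Y" if "x \<in> X" for x using Y2[OF that] B_mono[of r "2 * r" x] r by auto
    define D where "D x = (\<Sum>y\<in>Y. (f x - f y)\<^sup>2 * mu x y)" for x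
    have D: "D x \<ge> 0" for x unfolding D_def by (intro sum_nonneg) (simp add: mu_nonneg)
    have F1: "F1 \<ge> 0" unfolding F1_def using f by (intro sum_nonneg) auto
    have sumS: "(\<Sum>y\<in>A. f y * m y) \<le> F1" if "finite A" for A
    proof -
      have "(\<Sum>y\<in>A. f y * m y) \<le> (\<Sum>y\<in>A \<union> S. f y * m y)" using that S f by (intro sum_mono2) auto
      also have "\<dots> = F1" unfolding F1_def using that S f0 by (intro sum.mono_neutral_right) auto
      finally show ?thesis .
    qed
    have V2: "V y r \<le> CV * r powr a" for y using r by (rule V_upper)
    have local: "(\<Sum>y\<in>B x r. (f y)\<^sup>2 * m y)
        \<le> 2 * CP * r powr b * (\<Sum>y\<in>B x (2 * r). D y) + 2 * F1 / (c_vol * r powr a) * (\<Sum>y\<in>B x r. f y * m y)"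
      if x: "x \<in> X" for x
    proof -
      define t where "t = avg (B x r) f"
      have "(\<Sum>y\<in>B x r. (f y)\<^sup>2 * m y) \<le> (\<Sum>y\<in>B x r. (2 * (f y - t)\<^sup>2 + 2 * t\<^sup>2) * m y)"
        using sq_add_le[of "f _ - t" t] by (intro sum_mono mult_right_mono) auto
      also have "\<dots> = 2 * (\<Sum>y\<in>B x r. (f y - t)\<^sup>2 * m y) + 2 * (t\<^sup>2 * V x r)"
        by (simp add: distrib_right sum.distrib sum_distrib_left V_eq_sum mult.assoc)
      also have "(\<Sum>y\<in>B x r. (f y - t)\<^sup>2 * m y) \<le> CP * r powr b * En (B x (2 * r)) f"
        unfolding t_def using r by (intro PI) simp
      also have "En (B x (2 * r)) f \<le> (\<Sum>y\<in>B x (2 * r). D y)"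
        unfolding En_def D_def using X Y2[OF x] mu_nonneg by (intro sum_mono sum_mono2) auto
      \<comment> \<open>One of the two factors in the squared average is bounded by the total mass
        \<open>F1\<close>. The other stays local, so that double counting applies to it.\<close>
      also have "t\<^sup>2 * V x r \<le> F1 / (c_vol * r powr a) * (\<Sum>y\<in>B x r. f y * m y)"
      proof -
        let ?s = "\<Sum>y\<in>B x r. f y * m y"
        have s: "0 \<le> ?s" "?s \<le> F1" using f sumS by (auto intro!: sum_nonneg)
        have V: "0 < c_vol * r powr a" "c_vol * r powr a \<le> V x r" using r c_vol_pos V_lower[of r x] by auto
        have "t\<^sup>2 * V x r = ?s * ?s / V x r"
          using V by (simp add: t_def avg_def V_eq_sum[symmetric] power2_eq_square)
        also have "\<dots> \<le> F1 * ?s / V x r" using s V by (intro divide_right_mono mult_right_mono) auto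
        also have "\<dots> \<le> F1 * ?s / (c_vol * r powr a)" using s V F1 by (intro divide_left_mono mult_nonneg_nonneg mult_pos_pos[OF V(1)]) auto
        finally show ?thesis by simp
      qed
      finally show ?thesis using CP1 by (simp add: mult.assoc mult_left_mono)
    qed
    have "c_vol * r powr a * (\<Sum>x\<in>S. (f x)\<^sup>2 * m x) = (\<Sum>y\<in>S. (f y)\<^sup>2 * m y * (c_vol * r powr a))"
      by (simp add: sum_distrib_left mult.commute)
    also have "\<dots> \<le> (\<Sum>y\<in>S. (f y)\<^sup>2 * m y * (\<Sum>x\<in>X \<inter> B y r. m x))"
    proof (intro sum_mono mult_left_mono)
      fix y assume "y \<in> S"
      then have "X \<inter> B y r = B y r" by (auto simp: X_def)
      then show "c_vol * r powr a \<le> (\<Sum>x\<in>X \<inter> B y r. m x)" using V_lower[of r y] r by (simp add: V_eq_sum)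
    qed auto
    also have "\<dots> = (\<Sum>y\<in>Y. (f y)\<^sup>2 * m y * (\<Sum>x\<in>X \<inter> B y r. m x))"
      using X f0 by (intro sum.mono_neutral_left) auto
    also have "\<dots> = (\<Sum>x\<in>X. m x * (\<Sum>y\<in>B x r. (f y)\<^sup>2 * m y))"
      using X Y1 by (intro double_count[symmetric])
    also have "\<dots> \<le> (\<Sum>x\<in>X. m x * (2 * CP * r powr b * (\<Sum>y\<in>B x (2 * r). D y)
        + 2 * F1 / (c_vol * r powr a) * (\<Sum>y\<in>B x r. f y * m y)))"
      by (intro sum_mono mult_left_mono local) auto
    also have "\<dots> = 2 * CP * r powr b * (\<Sum>x\<in>X. m x * (\<Sum>y\<in>B x (2 * r). D y))
       + 2 * F1 / (c_vol * r powr a) * (\<Sum>x\<in>X. m x * (\<Sum>y\<in>B x r. f y * m y))"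
      by (simp add: distrib_left sum.distrib sum_distrib_left sum_divide_distrib mult_ac)
    also have "(\<Sum>x\<in>X. m x * (\<Sum>y\<in>B x (2 * r). D y)) \<le> CV * 2 powr a * r powr a * E"
    proof -
      have "(\<Sum>x\<in>X. m x * (\<Sum>y\<in>B x (2 * r). D y)) = (\<Sum>y\<in>Y. D y * (\<Sum>x\<in>X \<inter> B y (2 * r). m x))"
        using X Y2 by (intro double_count)
      also have "\<dots> \<le> (\<Sum>y\<in>Y. D y * (CV * 2 powr a * r powr a))"
      proof (intro sum_mono mult_left_mono D)
        fix y
        have "(\<Sum>x\<in>X \<inter> B y (2 * r). m x) \<le> V y (2 * r)" unfolding V_eq_sum by (intro sum_mono2) auto
        then show "(\<Sum>x\<in>X \<inter> B y (2 * r). m x) \<le> CV * 2 powr a * r powr a"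
          using V_doubling_ratio[OF r, of y] by linarith
      qed
      also have "\<dots> = CV * 2 powr a * r powr a * En Y f"
        by (simp add: En_def D_def sum_distrib_left mult.commute)
      also have "\<dots> \<le> CV * 2 powr a * r powr a * E" using E X CV1 by (intro mult_left_mono) auto
      finally show ?thesis .
    qed
    also have "(\<Sum>x\<in>X. m x * (\<Sum>y\<in>B x r. f y * m y)) \<le> CV * r powr a * F1"
    proof -
      have "(\<Sum>x\<in>X. m x * (\<Sum>y\<in>B x r. f y * m y)) = (\<Sum>y\<in>Y. f y * m y * (\<Sum>x\<in>X \<inter> B y r. m x))"
        using X Y1 by (intro double_count)
      also have "\<dots> \<le> (\<Sum>y\<in>Y. f y * m y * (CV * r powr a))"
      proof (intro sum_mono mult_left_mono)
        fix y
        have "(\<Sum>x\<in>X \<inter> B y r. m x) \<le> V y r" unfolding V_eq_sum by (intro sum_mono2) auto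
        then show "(\<Sum>x\<in>X \<inter> B y r. m x) \<le> CV * r powr a" using V2[of y] by linarith
      qed (use f in auto)
      also have "\<dots> = CV * r powr a * (\<Sum>y\<in>Y. f y * m y)" by (simp add: sum_distrib_left mult.commute)
      also have "\<dots> \<le> CV * r powr a * F1" using sumS X CV1 by (intro mult_left_mono) auto
      finally show ?thesis .
    qed
    finally have fin: "c_vol * r powr a * (\<Sum>x\<in>S. (f x)\<^sup>2 * m x)
       \<le> 2 * CP * r powr b * (CV * 2 powr a * r powr a * E) + 2 * F1 / (c_vol * r powr a) * (CV * r powr a * F1)"
      using CP1 F1 c_vol_pos r by (simp add: mult_left_mono divide_right_mono)
    have E0: "E \<ge> 0" using E[of "{}"] by (simp add: En_def)
    have "(\<Sum>x\<in>S. (f x)\<^sup>2 * m x)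
       \<le> (2 * CP * r powr b * (CV * 2 powr a * r powr a * E) + 2 * F1 / (c_vol * r powr a) * (CV * r powr a * F1)) / (c_vol * r powr a)"
      using fin c_vol_pos r by (simp add: le_divide_eq mult.commute)
    also have "\<dots> = 2 * CP * CV * 2 powr a / c_vol * (r powr b * E) + 2 * CV / c_vol\<^sup>2 * (r powr (- a) * F1\<^sup>2)"
    proof -
      have "(2 * CP * e * (CV * t * q * E) + 2 * F1 / (c_vol * q) * (CV * q * F1)) / (c_vol * q)
          = 2 * CP * CV * t / c_vol * (e * E) + 2 * CV / c_vol\<^sup>2 * (inverse q * F1\<^sup>2)" if "q > 0" for q e t :: real
        using that c_vol_pos by (simp add: field_simps power2_eq_square)
      from this[of "r powr a"] show ?thesis using r by (simp add: powr_minus)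
    qed
    also have "\<dots> \<le> C * (r powr b * E) + C * (r powr (- a) * F1\<^sup>2)"
      using E0 CP1 CV1 c_vol_pos by (intro add_mono mult_right_mono) (simp_all add: C_def)
    finally show ?thesis by (simp only: F1_def distrib_left)
  qed
  note main = this
  show ?thesis by (rule that[OF C], rule main)
qed

end

context wgraph
begin

lemma weighted_Cauchy_Schwarz:
  "(\<Sum>z\<in>Z. f z * g z * m z)\<^sup>2 \<le> (\<Sum>z\<in>Z. (f z)\<^sup>2 * m z) * (\<Sum>z\<in>Z. (g z)\<^sup>2 * m z)"
proof -
  have "(\<Sum>z\<in>Z. f z * g z * m z) = (\<Sum>z\<in>Z. (f z * sqrt (m z)) * (g z * sqrt (m z)))"
    by (intro sum.cong) (auto simp: mult_ac)
  then show ?thesis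
    using Cauchy_Schwarz_ineq_sum[of "\<lambda>z. f z * sqrt (m z)" "\<lambda>z. g z * sqrt (m z)" Z]
    by (simp add: power_mult_distrib)
qed

lemma h_norm: "finite Z \<Longrightarrow> B x (real n) \<subseteq> Z \<Longrightarrow> (\<Sum>z\<in>Z. (h n x z)\<^sup>2 * m z) = h (2 * n) x x"
  using h_inner[of Z x n n x] by (simp add: power2_eq_square mult_2)

end

context hk_graph
begin

section \<open>Decay and time regularity of the heat kernel\<close>

definition \<gamma> :: real where "\<gamma> = a / b"

lemma ab_pos: "a > 0" "b > 0" "\<gamma> > 0"
  using a_ge_1 b_ge_2 by (auto simp: \<gamma>_def)

lemma h_diagonal_upper:
  obtains C where "C > 0" "\<And>n x. n \<ge> 1 \<Longrightarrow> h (2 * n) x x \<le> C * real n powr (- \<gamma>)"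
proof -
  obtain C where C: "C > 0" and nash:
    "\<And>f S r E. finite S \<Longrightarrow> (\<And>x. f x \<ge> 0) \<Longrightarrow> (\<And>x. x \<notin> S \<Longrightarrow> f x = 0) \<Longrightarrow> r \<ge> 1 \<Longrightarrow>
      (\<And>Z. finite Z \<Longrightarrow> En Z f \<le> E) \<Longrightarrow>
      (\<Sum>x\<in>S. (f x)\<^sup>2 * m x) \<le> C * (r powr b * E + r powr (- a) * (\<Sum>x\<in>S. f x * m x)\<^sup>2)"
    using Nash by blast
  \<comment> \<open>\<open>K \<ge> 8 * C\<close> makes the mass term at most half of the left side,
    and \<open>K \<ge> 1 / c_vol\<close> bounds every diagonal value, which makes the radius below
    at least 1.\<close>
  define K where "K = 8 * max C (1 / c_vol)"
  have K: "K > 0" "8 * C \<le> K" "1 / c_vol \<le> K"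
    using C c_vol_pos by (auto simp: K_def max_def not_le intro: order.trans[of "1 / c_vol" "8 * (1 / c_vol)"])
  define s where "s = b / a"
  have s: "s > 0" using ab_pos by (simp add: s_def)
  define \<kappa> where "\<kappa> = K powr (- (1 + s))"
  have \<kappa>: "\<kappa> > 0" using K by (simp add: \<kappa>_def)
  have ineq: "h (2 * n) x x \<le> C * (r powr b * (4 * (h (2 * n) x x - h (2 * n + 2) x x)) + r powr (- a) * 4)"
    if r: "r \<ge> 1" for r n x
  proof -
    let ?g = "\<lambda>z. h n x z + h (n+1) x z"
    let ?S = "B x (real (n+1))"
    have sub: "B x (real n) \<subseteq> ?S" by (rule B_mono) simp
    have "h (2 * n) x x = (\<Sum>z\<in>?S. (h n x z)\<^sup>2 * m z)" using sub by (intro h_norm[symmetric]) auto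
    also have "\<dots> \<le> (\<Sum>z\<in>?S. (?g z)\<^sup>2 * m z)"
      by (intro sum_mono mult_right_mono power_mono) (auto simp: h_nonneg)
    also have "\<dots> \<le> C * (r powr b * (4 * (h (2 * n) x x - h (2 * n + 2) x x)) + r powr (- a) * (\<Sum>z\<in>?S. ?g z * m z)\<^sup>2)"
    proof (rule nash)
      fix z assume "z \<notin> ?S"
      then show "?g z = 0" using h_eq_0[of n x z] h_eq_0[of "n+1" x z] by (auto simp: mem_B)
    qed (use r energy_h_pair in \<open>auto simp: h_nonneg\<close>)
    also have "(\<Sum>z\<in>?S. ?g z * m z) = 2"
      using h_sum[of ?S x n] h_sum[of ?S x "n+1"] sub by (simp add: distrib_right sum.distrib)
    finally show ?thesis by simp
  qed
  have "h (2 * n) x x \<le> (s * \<kappa>) powr (- \<gamma>) * real n powr (- \<gamma>)" if n: "n \<ge> 1" for n x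
  proof -
    define u where "u k = h (2 * k) x x" for k
    have u: "u k > 0" "u k \<le> K" for k
      using h_even_pos h_bounded[of "2 * k" x x] K by (auto simp: u_def)
    have "u n \<le> (s * \<kappa> * real n) powr (- (1 / s))"
    proof (rule decay_from_difference_inequality[OF u(1) s \<kappa> _ n])
      fix k
      \<comment> \<open>Chosen so that \<open>r powr (- a) = u k / K\<close>; the mass term is
        absorbed and a lower bound for the drop \<open>u k - u (Suc k)\<close> is left.\<close>
      define r where "r = (K / u k) powr (1 / a)"
      have Ku: "K / u k \<ge> 1" using u[of k] by simp
      have r: "r \<ge> 1" unfolding r_def using Ku ab_pos by (intro ge_one_powr_ge_zero) auto
      have ra: "r powr (- a) = u k / K"
        using Ku ab_pos K u[of k] by (simp add: r_def powr_powr powr_minus)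
      have rb: "r powr b = (K / u k) powr s" by (simp add: r_def powr_powr s_def)
      have D: "0 \<le> u k - u (Suc k)" using h_even_antimono[of k x] by (simp add: u_def)
      have "u k \<le> C * (r powr b * (4 * (u k - u (Suc k))) + r powr (- a) * 4)"
        using ineq[OF r, of k x] by (simp add: u_def)
      also have "\<dots> = 4 * C * (r powr b * (u k - u (Suc k))) + 4 * C * (u k / K)"
        unfolding ra by (simp add: algebra_simps)
      also have "4 * C * (u k / K) \<le> u k / 2"
        using K u[of k] C by (simp add: divide_le_eq)
      also have "4 * C * (r powr b * (u k - u (Suc k))) \<le> K / 2 * (r powr b * (u k - u (Suc k)))"
        using K D by (intro mult_right_mono) auto
      finally have "u k \<le> K * (r powr b * (u k - u (Suc k)))" by simp
      then have "\<kappa> * u k powr s * u k \<le> \<kappa> * u k powr s * (K * (r powr b * (u k - u (Suc k))))"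
        using \<kappa> by (intro mult_left_mono) auto
      also have "\<dots> = (\<kappa> * K * (u k powr s * r powr b)) * (u k - u (Suc k))" by simp
      also have "u k powr s * r powr b = K powr s" using u[of k] K unfolding rb by (simp add: powr_divide)
      also have "\<kappa> * K * K powr s = 1"
      proof -
        have "K * K powr s = K powr (1 + s)" using K by (simp add: powr_add)
        then show ?thesis using K by (simp add: \<kappa>_def mult.assoc powr_add[symmetric])
      qed
      finally show "\<kappa> * u k powr (1 + s) \<le> u k - u (Suc k)"
        using u[of k] by (simp add: powr_add mult_ac)
    qed
    also have "1 / s = \<gamma>" by (simp add: s_def \<gamma>_def)
    finally show ?thesis using s \<kappa> by (simp add: u_def powr_mult)
  qed
  moreover have "(s * \<kappa>) powr (- \<gamma>) > 0" using s \<kappa> by simp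
  ultimately show ?thesis using that by blast
qed

lemma h_even_le_sqrt: "(h (2 * k) x y)\<^sup>2 \<le> h (2 * k) x x * h (2 * k) y y"
proof -
  let ?Z = "B x (real k) \<union> B y (real k)"
  have "h (2 * k) x y = (\<Sum>z\<in>?Z. h k x z * h k y z * m z)"
    using h_inner[of ?Z x k k y] by (simp add: mult_2)
  then show ?thesis using weighted_Cauchy_Schwarz[of "h k x" "h k y" ?Z] by (simp add: h_norm)
qed

lemma h_upper:
  obtains C where "C > 0" "\<And>n x y. n \<ge> 1 \<Longrightarrow> h n x y \<le> C * real n powr (- \<gamma>)"
proof -
  obtain C where C: "C > 0" and diag: "\<And>n x. n \<ge> 1 \<Longrightarrow> h (2 * n) x x \<le> C * real n powr (- \<gamma>)"
    using h_diagonal_upper by blast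
  have even: "h (2 * k) x y \<le> C * real k powr (- \<gamma>)" if "k \<ge> 1" for k x y
  proof -
    have "(h (2 * k) x y)\<^sup>2 \<le> h (2 * k) x x * h (2 * k) y y" by (rule h_even_le_sqrt)
    also have "\<dots> \<le> (C * real k powr (- \<gamma>)) * (C * real k powr (- \<gamma>))"
      using that C by (intro mult_mono diag) (auto simp: h_nonneg)
    finally have "(h (2 * k) x y)\<^sup>2 \<le> (C * real k powr (- \<gamma>))\<^sup>2" by (simp add: power2_eq_square)
    then show ?thesis using C by (intro power2_le_imp_le[of "h (2*k) x y"]) auto
  qed
  define D where "D = max (C * 3 powr \<gamma>) (1 / c_vol)"
  have D: "D > 0" using C by (simp add: D_def less_max_iff_disj)
  have "h n x y \<le> D * real n powr (- \<gamma>)" if n: "n \<ge> 1" for n x y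
  proof (cases "n = 1")
    case True
    then show ?thesis using h_bounded[of 1 x y] by (simp add: D_def)
  next
    case False
    define k where "k = n div 2"
    have "k \<ge> 1" "n \<le> 3 * k" using False n unfolding k_def by presburger+
    then have k: "k \<ge> 1" "real n \<le> 3 * real k" by linarith+
    have "h n x y \<le> C * real k powr (- \<gamma>)"
    proof (cases "even n")
      case True
      then have "n = 2 * k" by (simp add: k_def)
      then show ?thesis using even k by simp
    next
      case False
      then have "n = Suc (2 * k)" by (simp add: k_def)
      then have "h n x y = P (\<lambda>z. h (2 * k) z y) x" by (simp add: h_Suc)
      also have "\<dots> \<le> P (\<lambda>z. C * real k powr (- \<gamma>)) x" using even k by (intro P_mono)
      finally show ?thesis by simp
    qed
    also have "real k powr (- \<gamma>) \<le> (real n / 3) powr (- \<gamma>)"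
      using k n ab_pos by (intro powr_mono2') auto
    also have "(real n / 3) powr (- \<gamma>) = 3 powr \<gamma> * real n powr (- \<gamma>)"
      using n by (simp add: powr_divide powr_minus_divide)
    finally have "h n x y \<le> C * (3 powr \<gamma> * real n powr (- \<gamma>))" using C by simp
    also have "\<dots> = C * 3 powr \<gamma> * real n powr (- \<gamma>)" by simp
    also have "\<dots> \<le> D * real n powr (- \<gamma>)" by (intro mult_right_mono) (auto simp: D_def)
    finally show ?thesis .
  qed
  then show ?thesis using that D by blast
qed

text \<open>Along even times the diagonal \<open>A\<close>, its drop \<open>b1\<close> and the drop
  \<open>c1\<close> of that drop are nonnegative and decreasing, so two applications of
  \<open>antimono_difference_bound\<close> give \<open>c1\<close> an extra factor of order
  \<open>1 / k^2\<close>. The difference at time \<open>n\<close> is an inner product of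
  \<open>h (4 * k) x - h (4 * k + 2) x\<close>, whose squared norm is a value of \<open>c1\<close>,
  with \<open>h l y\<close>.\<close>

lemma h_time_difference:
  obtains C where "C > 0" "\<And>n x y. n \<ge> 1 \<Longrightarrow> \<bar>h n x y - h (n + 2) x y\<bar> \<le> C * real n powr (- 1 - \<gamma>)"
proof -
  obtain C where C: "C > 0" and diag: "\<And>n x. n \<ge> 1 \<Longrightarrow> h (2 * n) x x \<le> C * real n powr (- \<gamma>)"
    using h_diagonal_upper by blast
  define A where "A x k = h (2 * k) x x" for x k
  define b1 where "b1 x k = A x k - A x (Suc k)" for x k
  define c1 where "c1 x k = b1 x k - b1 x (Suc k)" for x k
  have e: "2 * Suc k = 2 * k + 2" "2 * k + 2 + 2 = 2 * k + 4" "2 * k + 4 + 2 = 2 * k + 6"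
     "2 * k + 6 + 2 = 2 * k + 8" for k :: nat by simp_all
  have A: "A x k \<ge> 0" "A x (Suc k) \<le> A x k" for x k
    using h_even_antimono[of k x] by (auto simp: A_def h_nonneg)
  have b1: "b1 x k \<ge> 0" for x k using A by (simp add: b1_def)
  have c1_eq: "c1 x k = (\<Sum>z\<in>Z. (h k x z - h (k + 2) x z)\<^sup>2 * m z)"
    if "finite Z" "B x (real (k + 2)) \<subseteq> Z" for x k Z
    unfolding c1_def b1_def A_def e h_second_difference[OF that] by simp
  have c1: "c1 x k \<ge> 0" for x k
    unfolding c1_eq[OF finite_B subset_refl] by (intro sum_nonneg) auto
  have c1_anti: "c1 x (Suc k) \<le> c1 x k" for x k
  proof (rule convex_bounded_antimono[where K = "1 / c_vol"])
    fix k
    have "0 \<le> (\<Sum>z\<in>B x (real (k+4)). (h k x z - 2 * h (k + 2) x z + h (k + 4) x z)\<^sup>2 * m z)"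
      by (intro sum_nonneg) auto
    then have "0 \<le> h (2*k) x x - 4 * h (2*k+2) x x + 6 * h (2*k+4) x x - 4 * h (2*k+6) x x + h (2*k+8) x x"
      by (subst (asm) h_third_difference) simp_all
    then show "c1 x k - 2 * c1 x (Suc k) + c1 x (Suc (Suc k)) \<ge> 0"
      unfolding c1_def b1_def A_def e by simp
  next
    fix k
    have "c1 x k \<le> A x k" using b1[of x "Suc k"] A(1)[of x "Suc k"] by (simp add: c1_def b1_def[of x k])
    then show "c1 x k \<le> 1 / c_vol" using h_bounded[of "2 * k" x x] by (simp add: A_def)
  qed
  have A_anti: "A x j \<le> A x i" if "i \<le> j" for x i j
    using that lift_Suc_antimono_le[of "A x"] A by blast
  have c1_bound: "2 * (real k)\<^sup>2 * c1 x (4 * k) \<le> A x k" for x k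
  proof -
    have "real k * b1 x (2 * k) \<le> A x k"
    proof (rule antimono_difference_bound)
      show "b1 x (Suc j) \<le> b1 x j" for j using c1[of x j] by (simp add: c1_def)
    qed (auto simp: b1_def A)
    moreover have "real (2 * k) * c1 x (2 * (2 * k)) \<le> b1 x (2 * k)"
      by (rule antimono_difference_bound) (auto simp: c1_def[of x] b1 c1_anti[of x, unfolded c1_def[of x]])
    then have "real k * (real (2 * k) * c1 x (4 * k)) \<le> real k * b1 x (2 * k)"
      by (intro mult_left_mono) simp_all
    ultimately show ?thesis by (simp add: power2_eq_square mult_ac)
  qed
  define D where "D = max (C * 16 powr (1 + \<gamma>)) (8 powr (1 + \<gamma>) / c_vol)"
  have D: "D > 0" using C by (simp add: D_def less_max_iff_disj)
  have "\<bar>h n x y - h (n + 2) x y\<bar> \<le> D * real n powr (- 1 - \<gamma>)" if n: "n \<ge> 1" for n x y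
  proof (cases "n < 8")
    case True
    have "\<bar>h n x y - h (n + 2) x y\<bar> \<le> 1 / c_vol"
      using h_nonneg[of n x y] h_nonneg[of "n+2" x y] h_bounded[of n x y] h_bounded[of "n+2" x y] by linarith
    also have "\<dots> = 8 powr (1 + \<gamma>) / c_vol * 8 powr (- 1 - \<gamma>)" by (simp add: powr_add[symmetric])
    also have "\<dots> \<le> 8 powr (1 + \<gamma>) / c_vol * real n powr (- 1 - \<gamma>)"
      using n True ab_pos c_vol_pos by (intro mult_left_mono powr_mono2') auto
    also have "\<dots> \<le> D * real n powr (- 1 - \<gamma>)" by (intro mult_right_mono) (auto simp: D_def)
    finally show ?thesis .
  next
    case False
    \<comment> \<open>\<open>4 * k\<close> is the index at which \<open>c1_bound\<close> applies,
      and with \<open>k = n div 8\<close> the remaining time \<open>l\<close> is still at least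
      \<open>k\<close>, hence comparable to \<open>n\<close>.\<close>
    define k where "k = n div 8"
    define l where "l = n - 4 * k"
    have nk: "n = 8 * k + n mod 8" "n mod 8 < 8" by (simp_all add: k_def)
    have k: "k \<ge> 1" using False nk by linarith
    then have k: "k \<ge> 1" "n \<le> 16 * k" "l \<ge> k" "n = 4 * k + l"
      using nk unfolding l_def by linarith+
    then have n16: "real n \<le> 16 * real k" by linarith
    let ?Z = "B x (real (4 * k + 2)) \<union> B y (real l)"
    have sub: "B x (real (4 * k)) \<subseteq> B x (real (4 * k + 2))" by (rule B_mono) simp
    have "h n x y - h (n + 2) x y = (\<Sum>z\<in>?Z. h (4*k) x z * h l y z * m z) - (\<Sum>z\<in>?Z. h (4*k+2) x z * h l y z * m z)"
    proof -
      have "n + 2 = 4 * k + 2 + l" using k(4) by simp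
      moreover have "finite ?Z" "B x (real (4*k)) \<subseteq> ?Z" "B x (real (4*k+2)) \<subseteq> ?Z" using sub by auto
      ultimately show ?thesis using h_inner[of ?Z x "4*k" l y] h_inner[of ?Z x "4*k+2" l y] k(4) by (simp only:)
    qed
    also have "\<dots> = (\<Sum>z\<in>?Z. (h (4*k) x z - h (4*k+2) x z) * h l y z * m z)"
      by (simp add: sum_subtractf[symmetric] left_diff_distrib)
    finally have inner: "h n x y - h (n + 2) x y
       = (\<Sum>z\<in>?Z. (h (4*k) x z - h (4*k+2) x z) * h l y z * m z)" .
    have "(h n x y - h (n + 2) x y)\<^sup>2
       \<le> (\<Sum>z\<in>?Z. (h (4*k) x z - h (4*k+2) x z)\<^sup>2 * m z) * (\<Sum>z\<in>?Z. (h l y z)\<^sup>2 * m z)"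
      unfolding inner by (rule weighted_Cauchy_Schwarz)
    also have "\<dots> = c1 x (4 * k) * A y l"
      using c1_eq[of ?Z x "4*k"] h_norm[of ?Z y l] by (simp add: A_def)
    also have "\<dots> \<le> (A x k / (2 * (real k)\<^sup>2)) * A y k"
      using c1_bound[of k x] k A_anti[of k l y] c1 A
      by (intro mult_mono) (auto simp: le_divide_eq mult.commute)
    also have "\<dots> \<le> (A x k / (real k)\<^sup>2) * A y k"
      using A k by (intro mult_right_mono divide_left_mono) auto
    also have "\<dots> \<le> (C * real k powr (- \<gamma>) / (real k)\<^sup>2) * (C * real k powr (- \<gamma>))"
      using diag[OF k(1)] C A by (intro mult_mono divide_right_mono) (auto simp: A_def)
    also have "\<dots> = (C * real k powr (- 1 - \<gamma>))\<^sup>2"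
    proof -
      have e: "- 1 - \<gamma> = - \<gamma> - 1" by simp
      show ?thesis unfolding e powr_diff using k by (simp add: power2_eq_square)
    qed
    finally have "\<bar>h n x y - h (n + 2) x y\<bar> \<le> C * real k powr (- 1 - \<gamma>)"
      using C by (intro power2_le_imp_le[of "\<bar>h n x y - h (n + 2) x y\<bar>"]) auto
    also have "real k powr (- 1 - \<gamma>) \<le> (real n / 16) powr (- 1 - \<gamma>)"
      using n16 n ab_pos by (intro powr_mono2') auto
    also have "(real n / 16) powr (- 1 - \<gamma>) = 16 powr (1 + \<gamma>) * real n powr (- 1 - \<gamma>)"
    proof -
      have e: "- 1 - \<gamma> = - (1 + \<gamma>)" by simp
      show ?thesis unfolding e powr_minus using n by (simp add: powr_divide) (simp add: divide_inverse)
    qed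
    finally have "\<bar>h n x y - h (n + 2) x y\<bar> \<le> C * (16 powr (1 + \<gamma>) * real n powr (- 1 - \<gamma>))" using C by simp
    also have "\<dots> = C * 16 powr (1 + \<gamma>) * real n powr (- 1 - \<gamma>)" by simp
    also have "\<dots> \<le> D * real n powr (- 1 - \<gamma>)" by (intro mult_right_mono) (auto simp: D_def)
    finally show ?thesis .
  qed
  then show ?thesis using that D by blast
qed

end

section \<open>Exit times\<close>

context wgraph
begin

text \<open>The expectation of \<open>min \<tau> k\<close> for the exit time \<open>\<tau>\<close>
  from \<open>U\<close>, obtained without a measure on paths. The limit defining
  \<open>exit_time\<close> is meaningful under a bound uniform in \<open>k\<close>, which the lemmas
  about it assume.\<close>

primrec truncated_exit :: "'a set \<Rightarrow> nat \<Rightarrow> 'a \<Rightarrow> real" where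
  "truncated_exit U 0 z = 0"
| "truncated_exit U (Suc k) z = (if z \<in> U then 1 + P (truncated_exit U k) z else 0)"

definition exit_time :: "'a set \<Rightarrow> 'a \<Rightarrow> real" where
  "exit_time U z = lim (\<lambda>k. truncated_exit U k z)"

lemma truncated_exit_nonneg: "truncated_exit U k z \<ge> 0"
proof (induction k arbitrary: z)
  case (Suc k)
  then have "0 \<le> P (truncated_exit U k) z" by (intro P_nonneg)
  then show ?case by simp
qed simp

lemma truncated_exit_outside: "z \<notin> U \<Longrightarrow> truncated_exit U k z = 0"
  by (cases k) auto

lemma truncated_exit_le_Suc: "truncated_exit U k z \<le> truncated_exit U (Suc k) z"
proof (induction k arbitrary: z)
  case 0
  then show ?case by (simp add: P_nonneg)
next
  case (Suc k)
  have "P (truncated_exit U k) z \<le> P (truncated_exit U (Suc k)) z" by (rule P_mono) (rule Suc)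
  then show ?case by simp
qed

lemma truncated_exit_mono: "k \<le> l \<Longrightarrow> truncated_exit U k z \<le> truncated_exit U l z"
  using lift_Suc_mono_le[of "\<lambda>k. truncated_exit U k z"] truncated_exit_le_Suc by blast

lemma truncated_exit_mono_set: "U \<subseteq> W \<Longrightarrow> truncated_exit U k z \<le> truncated_exit W k z"
proof (induction k arbitrary: z)
  case 0
  then show ?case by simp
next
  case (Suc k)
  have "P (truncated_exit U k) z \<le> P (truncated_exit W k) z" using Suc by (intro P_mono)
  moreover have "P (truncated_exit W k) z \<ge> 0" by (rule P_nonneg) (rule truncated_exit_nonneg)
  ultimately show ?case using Suc.prems by auto
qed

lemma truncated_exit_Markov:
  assumes U: "finite U"
  shows "truncated_exit U (k + N) z \<le> real N + (\<Sum>y\<in>U. p N z y * truncated_exit U k y)"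
proof (induction N arbitrary: z)
  case 0
  show ?case
  proof (cases "z \<in> U")
    case True
    then show ?thesis using U by (simp add: if_distrib[of "\<lambda>u. u * _"] sum.delta' cong: if_cong)
  next
    case False
    then show ?thesis using truncated_exit_outside[OF False]
      by (auto intro!: sum_nonneg mult_nonneg_nonneg truncated_exit_nonneg)
  qed
next
  case (Suc N)
  have nn: "0 \<le> real (Suc N) + (\<Sum>y\<in>U. p (Suc N) z y * truncated_exit U k y)"
    by (intro add_nonneg_nonneg sum_nonneg mult_nonneg_nonneg truncated_exit_nonneg p_nonneg) simp
  have "P (truncated_exit U (k + N)) z \<le> P (\<lambda>w. real N + (\<Sum>y\<in>U. p N w y * truncated_exit U k y)) z"
    by (rule P_mono) (rule Suc)
  also have "\<dots> = real N + (\<Sum>y\<in>U. P (\<lambda>w. p N w y * truncated_exit U k y) z)"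
    by (simp add: P_add P_sum)
  also have "(\<Sum>y\<in>U. P (\<lambda>w. p N w y * truncated_exit U k y) z) = (\<Sum>y\<in>U. p (Suc N) z y * truncated_exit U k y)"
    unfolding p_Suc using P_cmult[of "truncated_exit U k _"] by (simp add: mult.commute)
  finally have "P (truncated_exit U (k + N)) z \<le> real N + (\<Sum>y\<in>U. p (Suc N) z y * truncated_exit U k y)" .
  then show ?case using nn by (simp del: pn.simps)
qed

text \<open>If after \<open>N\<close> steps the walk is in \<open>U\<close> with probability at most
  1/2 from any start, the supremum \<open>s\<close> satisfies \<open>s \<le> N + s / 2\<close>.
  Truncation and finiteness of \<open>U\<close> make \<open>s\<close> finite, so this can be
  solved.\<close>

lemma truncated_exit_bound:
  assumes U: "finite U" and half: "\<And>z. (\<Sum>y\<in>U. p N z y) \<le> 1 / 2"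
  shows "truncated_exit U k z \<le> 2 * real N"
proof (cases "z \<in> U")
  case True
  define s where "s = Max (truncated_exit U k ` U)"
  have s: "truncated_exit U k y \<le> s" if "y \<in> U" for y using U that by (simp add: s_def)
  have s0: "s \<ge> 0" using s[OF True] truncated_exit_nonneg[of U k z] by linarith
  have *: "truncated_exit U k y \<le> real N + s / 2" for y
  proof -
    have "truncated_exit U k y \<le> truncated_exit U (k + N) y" by (rule truncated_exit_mono) simp
    also have "\<dots> \<le> real N + (\<Sum>w\<in>U. p N y w * truncated_exit U k w)" by (rule truncated_exit_Markov[OF U])
    also have "(\<Sum>w\<in>U. p N y w * truncated_exit U k w) \<le> (\<Sum>w\<in>U. p N y w * s)"
      using s by (intro sum_mono mult_left_mono p_nonneg)
    also have "\<dots> = (\<Sum>w\<in>U. p N y w) * s" by (simp add: sum_distrib_right)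
    also have "\<dots> \<le> 1 / 2 * s" using half s0 by (intro mult_right_mono)
    finally show ?thesis by simp
  qed
  have "s \<in> truncated_exit U k ` U" unfolding s_def using U True by (intro Max_in) auto
  then have "s \<le> real N + s / 2" using * by auto
  then show ?thesis using s[OF True] by simp
next
  case False
  then show ?thesis by (simp add: truncated_exit_outside)
qed

lemma
  assumes bd: "\<And>k z. truncated_exit U k z \<le> T"
  shows exit_time_LIMSEQ: "(\<lambda>k. truncated_exit U k z) \<longlonglongrightarrow> exit_time U z"
    and exit_time_le: "exit_time U z \<le> T"
    and exit_time_nonneg: "0 \<le> exit_time U z"
    and exit_time_outside: "z \<notin> U \<Longrightarrow> exit_time U z = 0"
    and exit_time_inside: "z \<in> U \<Longrightarrow> exit_time U z = 1 + P (exit_time U) z"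
proof -
  have lim: "(\<lambda>k. truncated_exit U k z) \<longlonglongrightarrow> exit_time U z" for z
  proof -
    obtain L where "(\<lambda>k. truncated_exit U k z) \<longlonglongrightarrow> L"
    proof (rule incseq_convergent[of "\<lambda>k. truncated_exit U k z" T])
      show "incseq (\<lambda>k. truncated_exit U k z)" using truncated_exit_mono by (auto simp: incseq_def)
      show "\<forall>k. truncated_exit U k z \<le> T" using bd by blast
    qed
    then show ?thesis unfolding exit_time_def by (simp add: limI)
  qed
  then show "(\<lambda>k. truncated_exit U k z) \<longlonglongrightarrow> exit_time U z" .
  show "exit_time U z \<le> T" using lim by (rule LIMSEQ_le_const2) (use bd in auto)
  show "0 \<le> exit_time U z" using lim by (rule LIMSEQ_le_const) (use truncated_exit_nonneg in auto)
  show "exit_time U z = 0" if "z \<notin> U"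
    using lim[of z] truncated_exit_outside[OF that] by (simp add: LIMSEQ_const_iff)
  show "exit_time U z = 1 + P (exit_time U) z" if "z \<in> U"
  proof -
    have "(\<lambda>k. 1 + P (truncated_exit U k) z) \<longlonglongrightarrow> 1 + P (exit_time U) z"
      unfolding P_def by (intro tendsto_intros lim)
    moreover have "(\<lambda>k. 1 + P (truncated_exit U k) z) = (\<lambda>k. truncated_exit U (Suc k) z)" using that by simp
    ultimately show ?thesis using LIMSEQ_Suc[OF lim[of z]] LIMSEQ_unique by metis
  qed
qed

lemma exit_time_mono:
  assumes "\<And>k z. truncated_exit U k z \<le> T" "\<And>k z. truncated_exit W k z \<le> T'" "U \<subseteq> W"
  shows "exit_time U z \<le> exit_time W z"
  using exit_time_LIMSEQ[OF assms(1)] exit_time_LIMSEQ[OF assms(2)]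
  by (rule LIMSEQ_le) (use truncated_exit_mono_set[OF assms(3)] in auto)

text \<open>The probability of having left \<open>U\<close> at some time up to
  \<open>n\<close>.\<close>

primrec exit_prob :: "'a set \<Rightarrow> nat \<Rightarrow> 'a \<Rightarrow> real" where
  "exit_prob U 0 z = (if z \<in> U then 0 else 1)"
| "exit_prob U (Suc n) z = (if z \<in> U then P (exit_prob U n) z else 1)"

lemma exit_prob_le_1: "exit_prob U n z \<le> 1"
proof (induction n arbitrary: z)
  case (Suc n)
  have "P (exit_prob U n) z \<le> P (\<lambda>_. 1) z" by (rule P_mono) (rule Suc)
  then show ?case by simp
qed simp

lemma p_outside_le_exit_prob:
  assumes "finite U"
  shows "1 - (\<Sum>y\<in>U. p n z y) \<le> exit_prob U n z"
proof (induction n arbitrary: z)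
  case 0
  then show ?case using assms by (simp add: sum.delta')
next
  case (Suc n)
  have "1 - (\<Sum>y\<in>U. p (Suc n) z y) = P (\<lambda>w. 1 - (\<Sum>y\<in>U. p n w y)) z"
    unfolding P_diff P_sum p_Suc by simp
  also have "\<dots> \<le> P (exit_prob U n) z" by (rule P_mono) (rule Suc)
  finally have 1: "1 - (\<Sum>y\<in>U. p (Suc n) z y) \<le> P (exit_prob U n) z" .
  have "0 \<le> (\<Sum>y\<in>U. p (Suc n) z y)" by (intro sum_nonneg p_nonneg)
  with 1 show ?case by (simp del: pn.simps)
qed

text \<open>Comparison with the barrier \<open>\<Lambda> ^ n * (M * \<psi> w)\<close>. Leaving
  \<open>B z r\<close> costs one step, which ends in \<open>B z (r + 1)\<close>, where the bound
  \<open>M\<close> takes over. Starting at \<open>w\<close> the estimate improves by the factor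
  \<open>\<psi> w\<close>.\<close>

lemma exit_prob_step:
  assumes U: "B z r \<subseteq> U" and r: "r \<ge> 0" and \<Lambda>: "\<Lambda> \<ge> 1" and M: "M \<ge> 0"
    and out: "\<And>w n. w \<in> B z (r + 1) \<Longrightarrow> exit_prob U n w \<le> \<Lambda> ^ n * M"
    and \<psi>: "\<And>w. 0 \<le> \<psi> w" "\<And>w. w \<notin> B z r \<Longrightarrow> \<psi> w = 1" "\<And>w. w \<in> B z r \<Longrightarrow> P \<psi> w \<le> \<Lambda> * \<psi> w"
    and w: "w \<in> B z r"
  shows "exit_prob U n w \<le> \<Lambda> ^ n * (M * \<psi> w)"
  using w
proof (induction n arbitrary: w)
  case 0
  then show ?case using U M \<psi>(1) by auto
next
  case (Suc n)
  have "P (exit_prob U n) w \<le> P (\<lambda>v. (\<Lambda> ^ n * M) * \<psi> v) w"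
  proof (rule P_mono)
    fix v assume v: "adj w v"
    show "exit_prob U n v \<le> \<Lambda> ^ n * M * \<psi> v"
    proof (cases "v \<in> B z r")
      case True
      then show ?thesis using Suc.IH[OF True] by (simp add: mult.assoc)
    next
      case False
      then show ?thesis using \<psi>(2)[OF False] out[OF nbr_B[OF Suc.prems v]] by simp
    qed
  qed
  also have "\<dots> = (\<Lambda> ^ n * M) * P \<psi> w" by (rule P_cmult)
  also have "\<dots> \<le> (\<Lambda> ^ n * M) * (\<Lambda> * \<psi> w)"
    using \<psi>(3)[OF Suc.prems] \<Lambda> M by (intro mult_left_mono) auto
  finally show ?case using U Suc.prems by (auto simp: mult_ac)
qed

end

context hk_graph
begin

section \<open>Mean exit times from balls and the sub-Gaussian tail\<close>

lemma truncated_exit_upper: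
  obtains T where "T > 0" "\<And>x R k z. R \<ge> 1 \<Longrightarrow> truncated_exit (B x R) k z \<le> T * R powr b"
proof -
  obtain C where C: "C > 0" and up: "\<And>n x y. n \<ge> 1 \<Longrightarrow> h n x y \<le> C * real n powr (- \<gamma>)"
    using h_upper by blast
  \<comment> \<open>After \<open>N \<ge> K * R powr b\<close> steps the on-diagonal bound times the
    volume of the ball is at most \<open>C * CV * K powr (- \<gamma>) = 1 / 2\<close>.\<close>
  define K where "K = (2 * C * CV) powr (1 / \<gamma>)"
  have K: "K > 0" unfolding K_def using C CV1 by simp
  have "truncated_exit (B x R) k z \<le> 2 * (K + 1) * R powr b" if R: "R \<ge> 1" for x R k z
  proof -
    define N where "N = nat \<lceil>K * R powr b\<rceil>"
    have Rb: "R powr b \<ge> 1" using R ab_pos by (intro ge_one_powr_ge_zero) auto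
    have KR: "K * R powr b > 0" using K R by simp
    have N: "real N \<ge> K * R powr b" "real N \<le> K * R powr b + 1" "N \<ge> 1"
      unfolding N_def using KR by linarith+
    have "truncated_exit (B x R) k z \<le> 2 * real N"
    proof (rule truncated_exit_bound)
      fix w
      have "(\<Sum>y\<in>B x R. p N w y) \<le> (\<Sum>y\<in>B x R. (C * real N powr (- \<gamma>)) * m y)"
        unfolding p_h using up N(3) by (intro sum_mono mult_right_mono) auto
      also have "\<dots> = C * real N powr (- \<gamma>) * V x R" by (simp add: V_eq_sum sum_distrib_left)
      also have "\<dots> \<le> C * real N powr (- \<gamma>) * (CV * R powr a)"
        using C V_upper[OF R] by (intro mult_left_mono) auto
      also have "\<dots> \<le> C * (K * R powr b) powr (- \<gamma>) * (CV * R powr a)"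
        using C CV1 N KR ab_pos by (intro mult_right_mono mult_left_mono powr_mono2') auto
      also have "(K * R powr b) powr (- \<gamma>) = inverse (2 * C * CV) * R powr (- a)"
      proof -
        have "K powr (- \<gamma>) = inverse (2 * C * CV)"
          using ab_pos C CV1 by (simp add: K_def powr_powr powr_minus)
        moreover have "(R powr b) powr (- \<gamma>) = R powr (- a)"
          using ab_pos by (simp add: powr_powr \<gamma>_def)
        ultimately show ?thesis using K R by (simp add: powr_mult)
      qed
      also have "C * (inverse (2 * C * CV) * R powr (- a)) * (CV * R powr a) = 1 / 2"
      proof -
        have "R powr (- a) * R powr a = 1" using R by (simp add: powr_add[symmetric])
        moreover have "C * (inverse (2 * C * CV) * R powr (- a)) * (CV * R powr a)
            = (C * inverse (2 * C * CV) * CV) * (R powr (- a) * R powr a)"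
          by (simp only: mult_ac)
        moreover have "C * inverse (2 * C * CV) * CV = 1 / 2" using C CV1 by (simp add: field_simps)
        ultimately show ?thesis by (simp only:)
      qed
      finally show "(\<Sum>y\<in>B x R. p N w y) \<le> 1 / 2" .
    qed simp
    also have "2 * real N \<le> 2 * (K + 1) * R powr b" using N Rb by (simp add: algebra_simps)
    finally show ?thesis .
  qed
  then show ?thesis using that[of "2 * (K + 1)"] K by simp
qed

text \<open>Inside the ball \<open>e - P e = 1\<close>, so pairing with \<open>e\<close> shows that
  the energy of \<open>e\<close> is its integral, and pairing with a cutoff bounds the inner volume
  by a mixed energy. Cauchy-Schwarz and the capacity bound give the claim.\<close>

lemma exit_time_mass:
  assumes R: "R \<ge> 1" and bd: "\<And>k z. truncated_exit (B x R) k z \<le> T"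
  shows "V x (R / 2) * (R / 2) powr b \<le> 2 * CC * (\<Sum>z\<in>B x R. exit_time (B x R) z * m z)"
proof -
  define e where "e = exit_time (B x R)"
  have e: "0 \<le> e z" "z \<notin> B x R \<Longrightarrow> e z = 0" "z \<in> B x R \<Longrightarrow> e z = 1 + P e z" for z
    unfolding e_def by (rule exit_time_nonneg[OF bd] exit_time_outside[OF bd] exit_time_inside[OF bd]; assumption)+
  obtain \<phi> where \<phi>: "\<And>y. 0 \<le> \<phi> y" "\<And>y. \<phi> y \<le> 1" "\<And>y. y \<in> B x (R / 2) \<Longrightarrow> \<phi> y = 1"
    "\<And>y. y \<notin> B x (2 * (R / 2)) \<Longrightarrow> \<phi> y = 0"
    "\<And>Z. finite Z \<Longrightarrow> En Z \<phi> \<le> 4 * CC * V x (R / 2) / (R / 2) powr b"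
    using cutoff[of "R / 2" x] R by auto
  define I where "I = (\<Sum>z\<in>B x R. e z * m z)"
  define W where "W = V x (R / 2)"
  have W: "W > 0" unfolding W_def using R by (intro V_pos) simp
  let ?Z = "B x (R + 1)"
  have sub: "B x R \<subseteq> ?Z" by (rule B_mono) simp
  have nbr: "{y. adj z y} \<subseteq> ?Z" if "z \<in> B x R" for z using nbr_B[OF that] by blast
  have I0: "I \<ge> 0" unfolding I_def by (intro sum_nonneg mult_nonneg_nonneg e(1)) simp
  have "I = (\<Sum>z\<in>B x R. e z * (e z - P e z) * m z)"
    unfolding I_def by (intro sum.cong) (auto simp: e(3))
  also have "\<dots> = (\<Sum>x\<in>?Z. \<Sum>y\<in>?Z. (e x - e y) * (e x - e y) * mu x y) / 2"
    using sub nbr e by (intro Green_formula) auto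
  also have "\<dots> = En ?Z e / 2" by (simp add: En_def power2_eq_square)
  finally have EI: "En ?Z e = 2 * I" by simp
  have "W = (\<Sum>z\<in>B x (R / 2). \<phi> z * m z)" by (simp add: W_def V_eq_sum \<phi>)
  also have "\<dots> \<le> (\<Sum>z\<in>B x R. \<phi> z * m z)"
    using R \<phi> B_mono[of "R / 2" R x] by (intro sum_mono2) auto
  also have "\<dots> = (\<Sum>z\<in>B x R. \<phi> z * (e z - P e z) * m z)" by (intro sum.cong) (auto simp: e(3))
  also have "\<dots> = (\<Sum>x\<in>?Z. \<Sum>y\<in>?Z. (\<phi> x - \<phi> y) * (e x - e y) * mu x y) / 2"
    using sub nbr \<phi> by (intro Green_formula) auto
  finally have "2 * W \<le> (\<Sum>x\<in>?Z. \<Sum>y\<in>?Z. (\<phi> x - \<phi> y) * (e x - e y) * mu x y)" by simp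
  then have "(2 * W)\<^sup>2 \<le> (\<Sum>x\<in>?Z. \<Sum>y\<in>?Z. (\<phi> x - \<phi> y) * (e x - e y) * mu x y)\<^sup>2"
    using W by (intro power_mono) auto
  also have "(\<Sum>x\<in>?Z. \<Sum>y\<in>?Z. (\<phi> x - \<phi> y) * (e x - e y) * mu x y)
      = (\<Sum>q\<in>?Z \<times> ?Z. ((\<phi> (fst q) - \<phi> (snd q)) * sqrt (mu (fst q) (snd q)))
          * ((e (fst q) - e (snd q)) * sqrt (mu (fst q) (snd q))))"
    unfolding sum.cartesian_product
    by (intro sum.cong) (auto simp: split_def mult_ac mu_nonneg)
  also have "\<dots>\<^sup>2 \<le> (\<Sum>q\<in>?Z \<times> ?Z. ((\<phi> (fst q) - \<phi> (snd q)) * sqrt (mu (fst q) (snd q)))\<^sup>2)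
      * (\<Sum>q\<in>?Z \<times> ?Z. ((e (fst q) - e (snd q)) * sqrt (mu (fst q) (snd q)))\<^sup>2)"
    by (rule Cauchy_Schwarz_ineq_sum)
  also have "\<dots> = En ?Z \<phi> * En ?Z e"
    unfolding En_def sum.cartesian_product by (simp add: power_mult_distrib mu_nonneg split_def)
  also have "\<dots> \<le> (4 * CC * W / (R / 2) powr b) * (2 * I)"
    unfolding EI W_def using I0 \<phi>(5) by (intro mult_right_mono) auto
  finally have "W * (4 * W) \<le> W * (8 * CC * I / (R / 2) powr b)"
    by (simp add: power2_eq_square mult_ac)
  then have "4 * W \<le> 8 * CC * I / (R / 2) powr b" using W by (simp only: mult_le_cancel_left_pos)
  moreover have "(R / 2) powr b > 0" using R by simp
  ultimately have "W * (R / 2) powr b \<le> 2 * CC * I" by (simp add: le_divide_eq)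
  then show ?thesis by (simp add: W_def I_def e_def)
qed

text \<open>The lower bound at the centre combines three facts: the integral of the exit time is
  large, its supremum is bounded, hence it is large on a fixed fraction of the ball; the weak
  Harnack inequality carries this to the centre. For \<open>R < 17\<close> the trivial bound 1
  suffices, which is why \<open>c2\<close> contains a minimum with 1.\<close>

lemma exit_time_bounds:
  obtains T c where "T > 0" "c > 0" "c \<le> T"
    "\<And>x R z. R \<ge> 1 \<Longrightarrow> 0 \<le> exit_time (B x R) z \<and> exit_time (B x R) z \<le> T * R powr b"
    "\<And>x R z. R \<ge> 1 \<Longrightarrow> z \<notin> B x R \<Longrightarrow> exit_time (B x R) z = 0"
    "\<And>x R z. R \<ge> 1 \<Longrightarrow> z \<in> B x R \<Longrightarrow> exit_time (B x R) z = 1 + P (exit_time (B x R)) z"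
    "\<And>x R. R \<ge> 1 \<Longrightarrow> c * R powr b \<le> exit_time (B x R) x"
proof -
  obtain T where T: "T > 0" and tr: "\<And>x R k z. R \<ge> 1 \<Longrightarrow> truncated_exit (B x R) k z \<le> T * R powr b"
    using truncated_exit_upper by blast
  note le = exit_time_le[OF tr] and nonneg = exit_time_nonneg[OF tr]
    and outside = exit_time_outside[OF tr] and inside = exit_time_inside[OF tr]
  define c1 where "c1 = c_vol * (1/2) powr a * (1/2) powr b / (2 * CC)"
  have c1: "c1 > 0" unfolding c1_def using c_vol_pos CC1 by simp
  define \<theta> where "\<theta> = c1 / (2 * T * CV)"
  have \<theta>: "\<theta> > 0" unfolding \<theta>_def using c1 T CV1 by simp
  obtain \<delta> where \<delta>: "\<delta> > 0" "\<delta> \<le> 1" and wh: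
    "\<And>x0 R u s y. R \<ge> 1 \<Longrightarrow> s > 0 \<Longrightarrow> (\<And>z. z \<in> B x0 (17 * R + 1) \<Longrightarrow> u z \<ge> 0) \<Longrightarrow>
      (\<And>z. z \<in> B x0 (17 * R) \<Longrightarrow> P u z \<le> u z) \<Longrightarrow>
      \<theta> * V x0 R \<le> (\<Sum>z\<in>{z\<in>B x0 R. u z \<ge> s}. m z) \<Longrightarrow> y \<in> B x0 R \<Longrightarrow> \<delta> * s \<le> u y"
    using weak_Harnack[OF \<theta>] by blast
  define c2 where "c2 = min (\<delta> * c1 / (2 * CV)) 1 * (1/17) powr b"
  have c2: "c2 > 0" unfolding c2_def using \<delta> c1 CV1 by simp
  have lower: "c2 * R powr b \<le> exit_time (B x R) x" if R: "R \<ge> 1" for x R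
  proof (cases "R \<ge> 17")
    case False
    have "c2 * R powr b \<le> (1 * (1/17) powr b) * R powr b"
      unfolding c2_def by (intro mult_right_mono) auto
    also have "\<dots> = (R / 17) powr b" using R by (simp add: powr_divide)
    also have "\<dots> \<le> 1" using False R ab_pos powr_mono2[of b "R / 17" 1] by simp
    also have "1 \<le> exit_time (B x R) x"
      using inside[OF R, of x x] R P_nonneg[of x "exit_time (B x R)"] nonneg[OF R] by simp
    finally show ?thesis .
  next
    case True
    define r where "r = R / 17"
    have r: "r \<ge> 1" "R = 17 * r" using True by (auto simp: r_def)
    define e where "e = exit_time (B x r)"
    \<comment> \<open>Vertices with \<open>e z < s\<close> contribute at most half of the integral;
      as \<open>e \<le> T * r powr b\<close>, the others must fill a fraction
      \<open>\<theta>\<close> of the ball.\<close>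
    define s where "s = c1 * r powr b / (2 * CV)"
    have s: "s > 0" unfolding s_def using c1 r CV1 by simp
    define M where "M = (\<Sum>z\<in>{z\<in>B x r. e z \<ge> s}. m z)"
    have "2 * CC * (c1 * (r powr a * r powr b)) = c_vol * (r / 2) powr a * (r / 2) powr b"
      unfolding c1_def using r CC1 by (simp add: powr_divide)
    also have "\<dots> \<le> V x (r / 2) * (r / 2) powr b" using r by (intro mult_right_mono V_lower) auto
    also have "\<dots> \<le> 2 * CC * (\<Sum>z\<in>B x r. e z * m z)"
      unfolding e_def by (rule exit_time_mass[OF r(1) tr[OF r(1)]])
    finally have "c1 * (r powr a * r powr b) \<le> (\<Sum>z\<in>B x r. e z * m z)" using CC1 by simp
    also have "\<dots> \<le> (\<Sum>z\<in>B x r. s * m z + (if e z \<ge> s then T * r powr b * m z else 0))"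
      using le[OF r(1)] s by (intro sum_mono) (auto simp: e_def mult_right_mono add_increasing)
    also have "\<dots> = s * V x r + T * r powr b * M"
      by (simp add: sum.distrib sum_distrib_left V_eq_sum M_def sum.If_cases Int_def)
    also have "s * V x r \<le> s * (CV * r powr a)" using s V_upper[OF r(1)] by (intro mult_left_mono) auto
    also have "s * (CV * r powr a) = c1 * (r powr a * r powr b) / 2" using CV1 by (simp add: s_def)
    finally have "r powr b * (c1 / 2 * r powr a) \<le> r powr b * (T * M)" by (simp add: mult_ac)
    then have "c1 / 2 * r powr a \<le> T * M" using r by (subst (asm) mult_le_cancel_left_pos) auto
    moreover have "\<theta> * V x r \<le> \<theta> * (CV * r powr a)" using \<theta> V_upper[OF r(1)] by (intro mult_left_mono) auto
    moreover have "\<theta> * (CV * r powr a) = c1 / 2 * r powr a / T" using CV1 T by (simp add: \<theta>_def)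
    moreover have "c1 / 2 * r powr a / T \<le> M \<longleftrightarrow> c1 / 2 * r powr a \<le> T * M"
      using T by (simp add: divide_le_eq mult_ac)
    ultimately have meas: "\<theta> * V x r \<le> M" by linarith
    have ee: "e z \<le> exit_time (B x R) z" for z
      unfolding e_def by (rule exit_time_mono[OF tr[OF r(1)] tr[OF R]]) (use r in \<open>auto intro!: B_mono\<close>)
    have "\<delta> * s \<le> exit_time (B x R) x"
    proof (rule wh[OF r(1) s, where u = "exit_time (B x R)" and y = x and ?x0.0 = x])
      have "M \<le> (\<Sum>z\<in>{z \<in> B x r. s \<le> exit_time (B x R) z}. m z)"
        unfolding M_def using ee by (intro sum_mono2) (auto intro: order_trans)
      then show "\<theta> * V x r \<le> (\<Sum>z\<in>{z \<in> B x r. s \<le> exit_time (B x R) z}. m z)" using meas by linarith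
    next
      fix z assume "z \<in> B x (17 * r)"
      then show "P (exit_time (B x R)) z \<le> exit_time (B x R) z"
        using inside[OF R, of z x] r by simp
    qed (use r nonneg[OF R] in auto)
    moreover have "c2 * R powr b \<le> \<delta> * s"
    proof -
      have "c2 * R powr b \<le> (\<delta> * c1 / (2 * CV) * (1/17) powr b) * R powr b"
        unfolding c2_def by (intro mult_right_mono) auto
      also have "\<dots> = \<delta> * c1 / (2 * CV) * (R / 17) powr b" using R by (simp add: powr_divide)
      finally show ?thesis by (simp add: s_def r_def)
    qed
    ultimately show ?thesis by linarith
  qed
  have "c2 \<le> T" using order_trans[OF lower[OF order_refl, of undefined] le[OF order_refl]] by simp
  show ?thesis
  proof (rule that[OF T c2 \<open>c2 \<le> T\<close>])
    fix x z and R :: real assume R: "R \<ge> 1"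
    show "0 \<le> exit_time (B x R) z \<and> exit_time (B x R) z \<le> T * R powr b"
      using le[OF R] nonneg[OF R] by simp
    show "exit_time (B x R) z = 0" if "z \<notin> B x R" by (rule outside[OF R that])
    show "exit_time (B x R) z = 1 + P (exit_time (B x R)) z" if "z \<in> B x R" by (rule inside[OF R that])
    show "c2 * R powr b \<le> exit_time (B x R) x" by (rule lower[OF R])
  qed
qed

text \<open>To leave \<open>B x (k * (r + 1))\<close> the walk has to exit \<open>k\<close>
  successive balls of radius \<open>r\<close>, each overshooting by at most one step. Each exit
  contributes a factor \<open>1 - \<delta>\<close>, and each unit of time costs
  \<open>1 + A * r powr (- b)\<close>.\<close>

lemma exit_prob_decay:
  obtains A \<delta> where "A > 0" "\<delta> > 0"
    "\<And>x r k n U. r \<ge> 1 \<Longrightarrow> B x (real k * (r + 1)) \<subseteq> U \<Longrightarrow>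
       exit_prob U n x \<le> exp (A * real n * r powr (- b) - \<delta> * real k)"
proof -
  obtain T c where T: "T > 0" and c: "c > 0" "c \<le> T"
    and e: "\<And>x R z. R \<ge> 1 \<Longrightarrow> 0 \<le> exit_time (B x R) z \<and> exit_time (B x R) z \<le> T * R powr b"
    and out: "\<And>x R z. R \<ge> 1 \<Longrightarrow> z \<notin> B x R \<Longrightarrow> exit_time (B x R) z = 0"
    and ins: "\<And>x R z. R \<ge> 1 \<Longrightarrow> z \<in> B x R \<Longrightarrow> exit_time (B x R) z = 1 + P (exit_time (B x R)) z"
    and low: "\<And>x R. R \<ge> 1 \<Longrightarrow> c * R powr b \<le> exit_time (B x R) x"
    by (rule exit_time_bounds) blast
  define A where "A = 1 / T"
  define \<delta> where "\<delta> = c / (2 * T)"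
  have A: "A > 0" and \<delta>: "\<delta> > 0" "\<delta> \<le> 1/2" using T c by (auto simp: A_def \<delta>_def)
  have main: "exit_prob U n x \<le> (1 + A * r powr (- b)) ^ n * (1 - \<delta>) ^ k"
    if r: "r \<ge> 1" and U: "B x (real k * (r + 1)) \<subseteq> U" for x r k n U
    using U
  proof (induction k arbitrary: x n)
    case 0
    have "1 \<le> (1 + A * r powr (- b)) ^ n" using A by (intro one_le_power) simp
    then show ?case using exit_prob_le_1[of U n x] by simp
  next
    case (Suc k)
    let ?\<Lambda> = "1 + A * r powr (- b)"
    let ?K = "2 * T * r powr b"
    have rb: "r powr b > 0" using r by simp
    have K: "?K > 0" using T rb by simp
    define E where "E = exit_time (B x r)"
    \<comment> \<open>Normalised so that \<open>\<psi>\<close> lies between 1/2 and 1. Since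
      \<open>P E = E - 1\<close> in the ball, \<open>P \<psi>\<close> exceeds \<open>\<psi>\<close>
      by the constant \<open>1 / ?K\<close>, which is at most a multiple of \<open>\<psi>\<close>,
      and the lower exit time bound gives \<open>\<psi> x \<le> 1 - \<delta>\<close>.\<close>
    define \<psi> where "\<psi> z = 1 - 1 / ?K * E z" for z
    have E2: "1 / ?K * E z \<le> 1 / 2" for z
    proof -
      have "E z \<le> T * r powr b" using e[OF r] by (simp add: E_def)
      then show ?thesis using K by (simp add: divide_le_eq)
    qed
    have "exit_prob U n x \<le> ?\<Lambda> ^ n * ((1 - \<delta>) ^ k * \<psi> x)"
    proof (rule exit_prob_step[where r = r and z = x])
      have "r + 1 \<le> real (Suc k) * (r + 1)" using r by simp
      then have "B x r \<subseteq> B x (real (Suc k) * (r + 1))" by (intro B_mono) linarith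
      then show "B x r \<subseteq> U" using Suc.prems by blast
    next
      fix w n assume w: "w \<in> B x (r + 1)"
      have "B w (real k * (r + 1)) \<subseteq> B x (real (Suc k) * (r + 1))"
        using w by (intro B_subset) (simp add: mem_B algebra_simps)
      then show "exit_prob U n w \<le> ?\<Lambda> ^ n * (1 - \<delta>) ^ k" using Suc.prems by (intro Suc.IH) blast
    next
      fix w show "0 \<le> \<psi> w" using E2[of w] by (simp add: \<psi>_def)
    next
      fix w assume "w \<notin> B x r"
      then show "\<psi> w = 1" using out[OF r] by (simp add: \<psi>_def E_def)
    next
      fix w assume w: "w \<in> B x r"
      have "P \<psi> w = 1 - 1 / ?K * P E w" unfolding \<psi>_def P_diff P_cmult by simp
      also have "P E w = E w - 1" using ins[OF r w] by (simp add: E_def)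
      also have "1 - 1 / ?K * (E w - 1) = \<psi> w + 1 / ?K" by (simp add: \<psi>_def right_diff_distrib)
      also have "1 / ?K = A * r powr (- b) * (1 / 2)" unfolding A_def powr_minus_divide by simp
      also have "A * r powr (- b) * (1 / 2) \<le> A * r powr (- b) * \<psi> w"
        using A E2[of w] by (intro mult_left_mono) (auto simp: \<psi>_def)
      finally show "P \<psi> w \<le> ?\<Lambda> * \<psi> w" by (simp add: distrib_right)
    qed (use r A \<delta> in auto)
    also have "\<psi> x \<le> 1 - \<delta>"
    proof -
      have "\<delta> = 1 / ?K * (c * r powr b)" using T r by (simp add: \<delta>_def)
      also have "\<dots> \<le> 1 / ?K * E x" using low[OF r, of x] K unfolding E_def by (intro mult_left_mono) auto
      finally show ?thesis by (simp add: \<psi>_def)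
    qed
    finally show ?case using A \<delta> by (simp add: mult_ac mult_right_mono)
  qed
  have fin: "exit_prob U n x \<le> exp (A * real n * r powr (- b) - \<delta> * real k)"
    if r: "r \<ge> 1" and U: "B x (real k * (r + 1)) \<subseteq> U" for x r k n U
  proof -
    have "exit_prob U n x \<le> (1 + A * r powr (- b)) ^ n * (1 - \<delta>) ^ k" by (rule main[OF that])
    also have "\<dots> \<le> exp (A * r powr (- b)) ^ n * exp (- \<delta>) ^ k"
      using A \<delta> exp_ge_add_one_self[of "A * r powr (- b)"] exp_ge_add_one_self[of "- \<delta>"]
      by (intro mult_mono power_mono) auto
    also have "\<dots> = exp (A * real n * r powr (- b) - \<delta> * real k)"
      by (simp add: exp_of_nat_mult[symmetric] exp_add[symmetric] mult_ac)
    finally show ?thesis .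
  qed
  show ?thesis by (rule that[OF A \<delta>(1)], rule fin)
qed

lemma tail_bound:
  obtains C c where "C > 0" "c > 0"
    "\<And>x n \<rho>. n \<ge> 1 \<Longrightarrow> 0 \<le> \<rho> \<Longrightarrow> \<rho> \<le> real n \<Longrightarrow>
       1 - (\<Sum>y\<in>B x \<rho>. p n x y) \<le> C * exp (- c * (\<rho> powr b / real n) powr (1 / (b - 1)))"
proof -
  obtain A \<delta> where A: "A > 0" and \<delta>: "\<delta> > 0" and decay:
    "\<And>x r k n U. r \<ge> 1 \<Longrightarrow> B x (real k * (r + 1)) \<subseteq> U \<Longrightarrow>
       exit_prob U n x \<le> exp (A * real n * r powr (- b) - \<delta> * real k)"
    using exit_prob_decay by blast
  \<comment> \<open>Makes the time cost at most \<open>\<delta> / 4 * (\<rho> / r)\<close>, half of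
    the gain \<open>\<delta> / 2 * (\<rho> / r)\<close> from the crossings.\<close>
  define K where "K = max 1 (4 * A / \<delta>)"
  have K: "K \<ge> 1" "A / K \<le> \<delta> / 4" using A \<delta> by (auto simp: K_def divide_simps max_def)
  define \<omega> where "\<omega> = 1 / (b - 1)"
  have \<omega>: "\<omega> > 0" "(b - 1) * \<omega> = 1" using b_ge_2 by (auto simp: \<omega>_def)
  define c where "c = \<delta> / 4 * K powr (- \<omega>)"
  have c: "c > 0" using \<delta> K by (simp add: c_def)
  have "1 - (\<Sum>y\<in>B x \<rho>. p n x y) \<le> exp \<delta> * exp (- c * (\<rho> powr b / real n) powr \<omega>)"
    if n: "n \<ge> 1" and \<rho>: "0 \<le> \<rho>" "\<rho> \<le> real n" for x n \<rho>
  proof (cases "\<rho> = 0")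
    case True
    have "0 \<le> (\<Sum>y\<in>B x \<rho>. p n x y)" by (intro sum_nonneg p_nonneg)
    moreover have "1 \<le> exp \<delta>" using \<delta> by simp
    ultimately have "1 - (\<Sum>y\<in>B x \<rho>. p n x y) \<le> exp \<delta>" by linarith
    then show ?thesis using True by simp
  next
    case False
    then have \<rho>0: "\<rho> > 0" using \<rho> by simp
    \<comment> \<open>Balances the cost \<open>n * r powr (- b)\<close> against the number
      \<open>\<rho> / r\<close> of crossings, that is
      \<open>r powr (b - 1) = K * n / \<rho>\<close>. The hypothesis \<open>\<rho> \<le> n\<close>
      gives \<open>r \<ge> 1\<close>.\<close>
    define r where "r = (K * real n / \<rho>) powr \<omega>"
    have n\<rho>: "K * real n / \<rho> \<ge> 1"
    proof -
      have "\<rho> \<le> 1 * real n" using \<rho> by simp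
      also have "\<dots> \<le> K * real n" using K by (intro mult_right_mono) auto
      finally show ?thesis using \<rho>0 by simp
    qed
    have r: "r \<ge> 1" unfolding r_def using n\<rho> \<omega> by (intro ge_one_powr_ge_zero) auto
    have rb1: "r powr (b - 1) = K * real n / \<rho>"
      using \<omega> n\<rho> \<rho>0 K by (simp add: r_def powr_powr mult.commute)
    have rbm: "real n * r powr (- b) = \<rho> / (K * r)"
    proof -
      have "r powr b = r * r powr (b - 1)" using r by (simp add: powr_diff)
      also have "\<dots> = r * (K * real n / \<rho>)" unfolding rb1 ..
      finally have "r powr b = r * (K * real n / \<rho>)" .
      then show ?thesis using n by (simp add: powr_minus)
    qed
    define k where "k = nat \<lfloor>\<rho> / (r + 1)\<rfloor>"
    have "\<rho> / (r + 1) \<ge> 0" using \<rho> r by simp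
    then have k: "real k \<le> \<rho> / (r + 1)" "real k \<ge> \<rho> / (r + 1) - 1"
      unfolding k_def by linarith+
    have "\<rho> / (2 * r) \<le> \<rho> / (r + 1)" using \<rho>0 r by (intro divide_left_mono) auto
    then have k2: "real k \<ge> \<rho> / (2 * r) - 1" using k by linarith
    have "1 - (\<Sum>y\<in>B x \<rho>. p n x y) \<le> exit_prob (B x \<rho>) n x"
      by (rule p_outside_le_exit_prob) simp
    also have "\<dots> \<le> exp (A * real n * r powr (- b) - \<delta> * real k)"
    proof (rule decay[OF r])
      show "B x (real k * (r + 1)) \<subseteq> B x \<rho>" using k r by (intro B_mono) (simp add: le_divide_eq)
    qed
    also have "A * real n * r powr (- b) - \<delta> * real k \<le> \<delta> - \<delta> / 4 * (\<rho> / r)"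
    proof -
      have "A * real n * r powr (- b) = A / K * (\<rho> / r)" using rbm by (simp add: mult.assoc)
      also have "\<dots> \<le> \<delta> / 4 * (\<rho> / r)" using K \<rho>0 r by (intro mult_right_mono) auto
      finally have 1: "A * real n * r powr (- b) \<le> \<delta> / 4 * (\<rho> / r)" .
      have "\<delta> * (\<rho> / (2 * r) - 1) \<le> \<delta> * real k" using k2 \<delta> by (intro mult_left_mono) auto
      moreover have "\<delta> * (\<rho> / (2 * r) - 1) = \<delta> / 2 * (\<rho> / r) - \<delta>" by (simp add: right_diff_distrib)
      ultimately show ?thesis using 1 by simp
    qed
    also have "\<delta> / 4 * (\<rho> / r) = c * (\<rho> powr b / real n) powr \<omega>"
    proof -
      have "\<rho> / r = \<rho> * (\<rho> / (K * real n)) powr \<omega>"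
        using n K \<rho>0 by (simp add: r_def powr_divide)
      also have "\<dots> = (\<rho> powr (b - 1)) powr \<omega> * (\<rho> / (K * real n)) powr \<omega>"
        using \<omega> \<rho>0 by (simp add: powr_powr)
      also have "\<dots> = (\<rho> powr (b - 1) * (\<rho> / (K * real n))) powr \<omega>"
        using \<rho>0 n K by (subst powr_mult) auto
      also have "\<rho> powr (b - 1) * (\<rho> / (K * real n)) = (1 / K) * (\<rho> powr b / real n)"
        using \<rho>0 by (simp add: powr_diff)
      also have "((1 / K) * (\<rho> powr b / real n)) powr \<omega> = K powr (- \<omega>) * (\<rho> powr b / real n) powr \<omega>"
        using K by (simp add: powr_mult powr_divide powr_minus_divide)
      finally show ?thesis by (simp add: c_def)
    qed
    finally show ?thesis by (simp add: exp_diff exp_minus divide_inverse)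
  qed
  then show ?thesis using that[of "exp \<delta>" c] c unfolding \<omega>_def by simp
qed

section \<open>Off-diagonal upper bound and oscillation\<close>

text \<open>The time is split into two parts of length at least \<open>n / 3\<close>. Any
  intermediate vertex is far from \<open>x\<close> or from \<open>y\<close>; the factor starting
  there is summed by the tail bound, and the other is bounded by its supremum.\<close>

lemma off_diagonal_upper:
  obtains C c where "C > 0" "c > 0"
    "\<And>n x y. n \<ge> 1 \<Longrightarrow>
       h n x y \<le> C * real n powr (- \<gamma>) * exp (- c * (real (d x y) powr b / real n) powr (1 / (b - 1)))"
proof -
  obtain C1 where C1: "C1 > 0" and up: "\<And>n x y. n \<ge> 1 \<Longrightarrow> h n x y \<le> C1 * real n powr (- \<gamma>)"
    using h_upper by blast
  define \<omega> where "\<omega> = 1 / (b - 1)"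
  have \<omega>: "\<omega> > 0" using b_ge_2 by (simp add: \<omega>_def)
  obtain Ct ct where Ct: "Ct > 0" and ct: "ct > 0" and tail:
    "\<And>x n \<rho>. n \<ge> 1 \<Longrightarrow> 0 \<le> \<rho> \<Longrightarrow> \<rho> \<le> real n \<Longrightarrow>
       1 - (\<Sum>y\<in>B x \<rho>. p n x y) \<le> Ct * exp (- ct * (\<rho> powr b / real n) powr \<omega>)"
    unfolding \<omega>_def using tail_bound by blast
  define c where "c = ct * (3 powr (- b)) powr \<omega>"
  have c: "c > 0" unfolding c_def using ct by simp
  define C where "C = max (C1 * exp c) (2 * Ct * C1 * 3 powr \<gamma>)"
  have C: "C > 0" unfolding C_def using C1 by (simp add: less_max_iff_disj)
  have main: "h n x y \<le> C * real n powr (- \<gamma>) * exp (- c * (real (d x y) powr b / real n) powr \<omega>)"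
    if n: "n \<ge> 1" for n x y
  proof (cases "n < d x y")
    case True
    then show ?thesis using C by (simp add: h_eq_0)
  next
    case False
    show ?thesis
    proof (cases "n = 1 \<or> d x y = 0")
      case True
      \<comment> \<open>A time of 1 cannot be split into two positive parts. Here the distance is at
        most 1 or zero, so the exponent is at most \<open>c\<close> and is absorbed by
        \<open>exp c\<close> in \<open>C\<close>.\<close>
      have "real (d x y) powr b / real n \<le> 1"
      proof (cases "d x y = 0")
        case 2: False
        then have "n = 1" using True by simp
        moreover from this have "d x y = 1" using 2 False by linarith
        ultimately have "n = 1" "d x y = 1" by simp_all
        then show ?thesis by simp
      qed simp
      then have "(real (d x y) powr b / real n) powr \<omega> \<le> 1" using \<omega> powr_mono2[of \<omega> _ 1] by simp
      then have "c * (real (d x y) powr b / real n) powr \<omega> \<le> c * 1" using c by (intro mult_left_mono) auto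
      then have "exp (- c) \<le> exp (- c * (real (d x y) powr b / real n) powr \<omega>)" by simp
      then have "C1 * exp c * exp (- c) \<le> C * exp (- c * (real (d x y) powr b / real n) powr \<omega>)"
        using C by (intro mult_mono) (auto simp: C_def)
      moreover have "C1 * exp c * exp (- c) = C1" by (simp add: exp_minus)
      ultimately have "C1 \<le> C * exp (- c * (real (d x y) powr b / real n) powr \<omega>)" by (simp only:)
      then have "real n powr (- \<gamma>) * C1
          \<le> real n powr (- \<gamma>) * (C * exp (- c * (real (d x y) powr b / real n) powr \<omega>))"
        by (intro mult_left_mono) auto
      then show ?thesis using up[OF n, of x y] by (simp add: mult_ac)
    next
      case 1: False
      define i where "i = n div 2"
      define j where "j = n - i"
      have n2: "n = 2 * i + n mod 2" "n mod 2 < 2" "n \<ge> 2" using n 1 by (simp_all add: i_def)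
      then have "n \<le> 3 * i" "i \<ge> 1" by linarith+
      then have ij: "i \<ge> 1" "j \<ge> 1" "real n / 3 \<le> real i" "real n / 3 \<le> real j" "i \<le> n" "j \<le> n" "i + j = n"
        using n2 unfolding j_def by linarith+
      \<comment> \<open>A third of the distance keeps the two balls disjoint and, as
        \<open>d x y \<le> n\<close>, stays below both time parts, as the tail bound
        demands.\<close>
      define \<rho> where "\<rho> = real (d x y) / 3"
      have \<rho>: "\<rho> \<ge> 0" "\<rho> \<le> real i" "\<rho> \<le> real j" "real (d x y) = 3 * \<rho>" "\<rho> > 0"
      proof -
        have "0 < d x y" using 1 by (metis gr0I)
        then show "\<rho> > 0" by (simp add: \<rho>_def)
      qed (use False ij in \<open>auto simp: \<rho>_def\<close>)
      define T where "T = Ct * exp (- c * (real (d x y) powr b / real n) powr \<omega>)"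
      have T: "1 - (\<Sum>v\<in>B w \<rho>. p k w v) \<le> T" if k: "k \<ge> 1" "\<rho> \<le> real k" "k \<le> n" for w k
      proof -
        have "1 - (\<Sum>v\<in>B w \<rho>. p k w v) \<le> Ct * exp (- ct * (\<rho> powr b / real k) powr \<omega>)"
          using k \<rho> by (intro tail)
        also have "\<dots> \<le> Ct * exp (- ct * (\<rho> powr b / real n) powr \<omega>)"
        proof -
          have "\<rho> powr b / real n \<le> \<rho> powr b / real k" using k by (intro divide_left_mono) auto
          then have "(\<rho> powr b / real n) powr \<omega> \<le> (\<rho> powr b / real k) powr \<omega>"
            using \<omega> by (intro powr_mono2) auto
          then show ?thesis using ct Ct by simp
        qed
        also have "(\<rho> powr b / real n) powr \<omega> = (3 powr (- b)) powr \<omega> * (real (d x y) powr b / real n) powr \<omega>"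
        proof -
          have "\<rho> powr b / real n = 3 powr (- b) * (real (d x y) powr b / real n)"
            by (simp add: \<rho>_def powr_divide powr_minus_divide)
          then show ?thesis by (simp only:) (rule powr_mult; simp)
        qed
        finally show ?thesis by (simp add: T_def c_def mult.assoc)
      qed
      define S where "S = C1 * (real n / 3) powr (- \<gamma>)"
      have S: "h k w v \<le> S" if "k \<ge> 1" "real n / 3 \<le> real k" for k w v
      proof -
        have "real k powr (- \<gamma>) \<le> (real n / 3) powr (- \<gamma>)"
          using that n ab_pos by (intro powr_mono2') auto
        then have "C1 * real k powr (- \<gamma>) \<le> S" unfolding S_def using C1 by (intro mult_left_mono) auto
        then show ?thesis using up[OF that(1), of w v] by linarith
      qed
      have S0: "S \<ge> 0" unfolding S_def using C1 by simp
      let ?Z = "B x (real i) \<union> B y (real j)"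
      have out: "(\<Sum>z\<in>?Z. if z \<in> B w \<rho> then 0 else p k w z) = 1 - (\<Sum>v\<in>B w \<rho>. p k w v)"
        if "B w (real k) \<subseteq> ?Z" "\<rho> \<le> real k" for w k
      proof -
        have sub: "B w \<rho> \<subseteq> ?Z" using that B_mono[of \<rho> "real k" w] by blast
        have "(\<Sum>z\<in>?Z. if z \<in> B w \<rho> then 0 else p k w z) = (\<Sum>z\<in>?Z. p k w z - (if z \<in> B w \<rho> then p k w z else 0))"
          by (intro sum.cong) auto
        also have "\<dots> = 1 - (\<Sum>z\<in>?Z. if z \<in> B w \<rho> then p k w z else 0)"
          using p_sum[of ?Z w k] that by (simp add: sum_subtractf)
        also have "(\<Sum>z\<in>?Z. if z \<in> B w \<rho> then p k w z else 0) = (\<Sum>z\<in>B w \<rho>. p k w z)"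
          using sub by (subst sum.inter_restrict[symmetric]) (auto simp: Int_absorb1)
        finally show ?thesis .
      qed
      have "h n x y = (\<Sum>z\<in>?Z. h i x z * h j y z * m z)"
        using h_inner[of ?Z x i j y] ij by simp
      also have "\<dots> \<le> (\<Sum>z\<in>?Z. S * (if z \<in> B x \<rho> then 0 else p i x z) + S * (if z \<in> B y \<rho> then 0 else p j y z))"
      proof (intro sum_mono)
        fix z
        have t1: "h i x z * h j y z * m z \<le> S * p i x z"
          unfolding p_h using mult_right_mono[OF S[of j y z], of "h i x z * m z"] ij
          by (simp add: mult_ac h_nonneg)
        have t2: "h i x z * h j y z * m z \<le> S * p j y z"
          unfolding p_h using mult_right_mono[OF S[of i x z], of "h j y z * m z"] ij
          by (simp add: mult_ac h_nonneg)
        have "\<not> (z \<in> B x \<rho> \<and> z \<in> B y \<rho>)"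
        proof
          assume "z \<in> B x \<rho> \<and> z \<in> B y \<rho>"
          then have "real (d x y) \<le> 2 * \<rho>" using d_triangle[of x y z] d_sym[of y z] by (simp add: mem_B)
          then show False using \<rho> by simp
        qed
        moreover have "0 \<le> S * p i x z" "0 \<le> S * p j y z" using S0 p_nonneg by simp_all
        ultimately show "h i x z * h j y z * m z
            \<le> S * (if z \<in> B x \<rho> then 0 else p i x z) + S * (if z \<in> B y \<rho> then 0 else p j y z)"
          using t1 t2 by auto
      qed
      also have "\<dots> = S * (1 - (\<Sum>v\<in>B x \<rho>. p i x v)) + S * (1 - (\<Sum>v\<in>B y \<rho>. p j y v))"
        using out[of x i] out[of y j] \<rho> by (simp add: sum.distrib sum_distrib_left[symmetric])
      also have "\<dots> \<le> S * T + S * T" using T ij \<rho> S0 by (intro add_mono mult_left_mono) auto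
      also have "\<dots> = (2 * Ct * C1 * 3 powr \<gamma>) * (real n powr (- \<gamma>) * exp (- c * (real (d x y) powr b / real n) powr \<omega>))"
      proof -
        have "(real n / 3) powr (- \<gamma>) = 3 powr \<gamma> * real n powr (- \<gamma>)" by (simp add: powr_divide powr_minus_divide)
        then show ?thesis by (simp add: S_def T_def)
      qed
      also have "\<dots> \<le> C * (real n powr (- \<gamma>) * exp (- c * (real (d x y) powr b / real n) powr \<omega>))"
        by (intro mult_right_mono) (auto simp: C_def)
      finally show ?thesis by (simp add: mult.assoc)
    qed
  qed
  show ?thesis by (rule that[OF C c]) (rule main[unfolded \<omega>_def])
qed

text \<open>At least half of the mass of the walk at time \<open>n\<close> lies in a ball of radius
  \<open>K * n powr (1 / b)\<close>; Cauchy-Schwarz bounds its square by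
  \<open>h (2 * n) x x\<close> times the volume. If that radius exceeds \<open>n\<close>, the walk
  cannot have left the ball.\<close>

lemma h_diagonal_lower:
  obtains c where "c > 0" "\<And>n x. n \<ge> 1 \<Longrightarrow> c * real n powr (- \<gamma>) \<le> h (2 * n) x x"
proof -
  define \<omega> where "\<omega> = 1 / (b - 1)"
  have \<omega>: "\<omega> > 0" "b * \<omega> \<ge> 1" using b_ge_2 by (simp_all add: \<omega>_def le_divide_eq)
  obtain C c where C: "C > 0" and c: "c > 0" and tail:
    "\<And>x n \<rho>. n \<ge> 1 \<Longrightarrow> 0 \<le> \<rho> \<Longrightarrow> \<rho> \<le> real n \<Longrightarrow>
       1 - (\<Sum>y\<in>B x \<rho>. p n x y) \<le> C * exp (- c * (\<rho> powr b / real n) powr \<omega>)"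
    unfolding \<omega>_def using tail_bound by blast
  define K where "K = max 1 (ln (2 * C) / c)"
  have K: "K \<ge> 1" by (simp add: K_def)
  have CK: "C * exp (- c * K powr (b * \<omega>)) \<le> 1 / 2"
  proof -
    have "K powr 1 \<le> K powr (b * \<omega>)" using K \<omega> by (intro powr_mono) auto
    then have "ln (2 * C) / c \<le> K powr (b * \<omega>)" using K by (simp add: K_def)
    then have "ln (2 * C) \<le> c * K powr (b * \<omega>)" using c by (simp add: divide_le_eq mult.commute)
    then have "exp (- c * K powr (b * \<omega>)) \<le> exp (- ln (2 * C))" by simp
    also have "\<dots> = 1 / (2 * C)" using C by (simp add: exp_minus inverse_eq_divide)
    finally have "C * exp (- c * K powr (b * \<omega>)) \<le> C * (1 / (2 * C))" using C by (intro mult_left_mono) auto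
    then show ?thesis using C by simp
  qed
  define c' where "c' = 1 / (4 * CV * K powr a)"
  have c': "c' > 0" unfolding c'_def using CV1 K by simp
  have main: "c' * real n powr (- \<gamma>) \<le> h (2 * n) x x" if n: "n \<ge> 1" for n x
  proof -
    define \<rho> where "\<rho> = K * real n powr (1 / b)"
    have "real n powr (1 / b) \<ge> 1" using n ab_pos by (intro ge_one_powr_ge_zero) auto
    then have \<rho>: "\<rho> \<ge> 1" unfolding \<rho>_def using K mult_mono[of 1 K 1 "real n powr (1/b)"] by simp
    have half: "(\<Sum>y\<in>B x \<rho>. p n x y) \<ge> 1 / 2"
    proof (cases "\<rho> \<le> real n")
      case True
      have "\<rho> powr b / real n = K powr b"
        unfolding \<rho>_def using n K ab_pos by (simp add: powr_mult powr_powr)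
      then have "(\<rho> powr b / real n) powr \<omega> = K powr (b * \<omega>)" by (simp add: powr_powr)
      then show ?thesis using tail[OF n _ True, of x] \<rho> CK by simp
    next
      case False
      then have "B x (real n) \<subseteq> B x \<rho>" by (intro B_mono) simp
      then show ?thesis using p_sum[of "B x \<rho>" x n] by simp
    qed
    have "(1 / 2)\<^sup>2 \<le> (\<Sum>y\<in>B x \<rho>. p n x y)\<^sup>2" using half by (intro power_mono) auto
    also have "\<dots> = (\<Sum>y\<in>B x \<rho>. h n x y * 1 * m y)\<^sup>2" by (simp add: p_h)
    also have "\<dots> \<le> (\<Sum>y\<in>B x \<rho>. (h n x y)\<^sup>2 * m y) * (\<Sum>y\<in>B x \<rho>. 1\<^sup>2 * m y)"
      by (rule weighted_Cauchy_Schwarz)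
    also have "(\<Sum>y\<in>B x \<rho>. (h n x y)\<^sup>2 * m y) \<le> (\<Sum>y\<in>B x \<rho> \<union> B x (real n). (h n x y)\<^sup>2 * m y)"
      by (intro sum_mono2) auto
    also have "\<dots> = h (2 * n) x x" by (intro h_norm) auto
    also have "(\<Sum>y\<in>B x \<rho>. 1\<^sup>2 * m y) = V x \<rho>" by (simp add: V_eq_sum)
    also have "h (2 * n) x x * V x \<rho> \<le> h (2 * n) x x * (CV * \<rho> powr a)"
      using V_upper[OF \<rho>] by (intro mult_left_mono) (auto simp: h_nonneg)
    also have "\<rho> powr a = K powr a * real n powr \<gamma>"
      unfolding \<rho>_def using n K by (simp add: powr_mult powr_powr \<gamma>_def)
    finally have "1 / 4 \<le> h (2 * n) x x * (CV * (K powr a * real n powr \<gamma>))"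
      by (simp add: power2_eq_square mult_right_mono sum_nonneg)
    moreover have "CV * (K powr a * real n powr \<gamma>) > 0" using CV1 K n by simp
    ultimately have "1 / 4 / (CV * (K powr a * real n powr \<gamma>)) \<le> h (2 * n) x x" by (simp add: divide_le_eq)
    then show ?thesis by (simp add: c'_def powr_minus_divide mult_ac)
  qed
  show ?thesis by (rule that[OF c'], rule main)
qed

section \<open>Oscillation decay and the near-diagonal lower bound\<close>

lemma h_pair_diagonal_lower:
  obtains c where "c > 0" "\<And>n x. n \<ge> 1 \<Longrightarrow> c * real n powr (- \<gamma>) \<le> h n x x + h (n + 1) x x"
proof -
  obtain c where c: "c > 0" and low: "\<And>n x. n \<ge> 1 \<Longrightarrow> c * real n powr (- \<gamma>) \<le> h (2 * n) x x"
    using h_diagonal_lower by blast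
  have "c * real n powr (- \<gamma>) \<le> h n x x + h (n + 1) x x" if n: "n \<ge> 1" for n x
  proof -
    define k where "k = (n + 1) div 2"
    have "n = 2 * k \<or> n + 1 = 2 * k" unfolding k_def by presburger
    then have k: "k \<ge> 1" "k \<le> n" "h (2 * k) x x \<le> h n x x + h (n + 1) x x"
      using n h_nonneg[of n x x] h_nonneg[of "n+1" x x] by auto
    have "c * real n powr (- \<gamma>) \<le> c * real k powr (- \<gamma>)"
      using k c ab_pos by (intro mult_left_mono powr_mono2') auto
    then show ?thesis using low[OF k(1), of x] k(3) by linarith
  qed
  then show ?thesis using that c by blast
qed

text \<open>Either \<open>f - lo\<close> or \<open>lo + w - f\<close> is at least
  \<open>w / 2\<close> on half of the ball. Both have defect at most \<open>F\<close> from being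
  superharmonic, and adding \<open>F * E\<close> repairs it because \<open>P E = E - 1\<close>. The
  radius \<open>18 * R\<close> leaves room for \<open>17 * R + 1\<close>.\<close>

lemma oscillation_step:
  obtains \<delta> C where "\<delta> > 0" "\<delta> < 1" "C > 0"
    "\<And>x R f F lo w. R \<ge> 1 \<Longrightarrow> F \<ge> 0 \<Longrightarrow> w \<ge> 0 \<Longrightarrow> (\<And>z. \<bar>f z - P f z\<bar> \<le> F) \<Longrightarrow>
      (\<And>z. z \<in> B x (18 * R) \<Longrightarrow> lo \<le> f z \<and> f z \<le> lo + w) \<Longrightarrow>
      \<exists>lo'. \<forall>z\<in>B x R. lo' \<le> f z \<and> f z \<le> lo' + ((1 - \<delta>) * w + C * F * R powr b)"
proof -
  obtain T c where T: "T > 0"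
    and e: "\<And>x R z. R \<ge> 1 \<Longrightarrow> 0 \<le> exit_time (B x R) z \<and> exit_time (B x R) z \<le> T * R powr b"
    and ins: "\<And>x R z. R \<ge> 1 \<Longrightarrow> z \<in> B x R \<Longrightarrow> exit_time (B x R) z = 1 + P (exit_time (B x R)) z"
    by (rule exit_time_bounds) blast
  have half: "(1/2::real) > 0" by simp
  obtain \<delta> where \<delta>: "\<delta> > 0" "\<delta> \<le> 1" and wh:
    "\<And>x0 R u s y. R \<ge> 1 \<Longrightarrow> s > 0 \<Longrightarrow> (\<And>z. z \<in> B x0 (17 * R + 1) \<Longrightarrow> u z \<ge> 0) \<Longrightarrow>
      (\<And>z. z \<in> B x0 (17 * R) \<Longrightarrow> P u z \<le> u z) \<Longrightarrow>
      1/2 * V x0 R \<le> (\<Sum>z\<in>{z\<in>B x0 R. u z \<ge> s}. m z) \<Longrightarrow> y \<in> B x0 R \<Longrightarrow> \<delta> * s \<le> u y"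
    using weak_Harnack[OF half] by blast
  define C where "C = T * 17 powr b"
  have C: "C > 0" using T by (simp add: C_def)
  have main: "\<exists>lo'. \<forall>z\<in>B x R. lo' \<le> f z \<and> f z \<le> lo' + ((1 - \<delta> / 2) * w + C * F * R powr b)"
    if R: "R \<ge> 1" and F: "F \<ge> 0" and w: "w \<ge> 0" and fF: "\<And>z. \<bar>f z - P f z\<bar> \<le> F"
      and bd: "\<And>z. z \<in> B x (18 * R) \<Longrightarrow> lo \<le> f z \<and> f z \<le> lo + w" for x R f F lo w
  proof -
    define E where "E = exit_time (B x (17 * R))"
    have R17: "17 * R \<ge> 1" using R by simp
    have E: "0 \<le> F * E z" "F * E z \<le> C * F * R powr b" for z
    proof -
      have E0: "0 \<le> E z \<and> E z \<le> T * (17 * R) powr b" unfolding E_def by (rule e[OF R17])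
      then show "0 \<le> F * E z" using F by simp
      have "F * E z \<le> F * (T * (17 * R) powr b)" using E0 F by (intro mult_left_mono) auto
      then show "F * E z \<le> C * F * R powr b" using R by (simp add: C_def powr_mult mult_ac)
    qed
    have PE: "P E z = E z - 1" if "z \<in> B x (17 * R)" for z
      using ins[OF R17 that] by (simp add: E_def)
    have sub: "B x R \<subseteq> B x (18 * R)" "B x (17 * R + 1) \<subseteq> B x (18 * R)" using R by (auto intro!: B_mono)
    have CF: "0 \<le> C * F * R powr b" using C F by simp
    show ?thesis
    proof (cases "w = 0")
      case True
      then show ?thesis using bd sub CF by (intro exI[of _ lo]) force
    next
      case False
      then have w2: "w / 2 > 0" using w by simp
      define Hi where "Hi = {z\<in>B x R. f z \<ge> lo + w / 2}"
      define Lo where "Lo = {z\<in>B x R. f z < lo + w / 2}"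
      have "V x R = (\<Sum>z\<in>Hi. m z) + (\<Sum>z\<in>Lo. m z)"
        unfolding V_eq_sum Hi_def Lo_def by (subst sum.union_disjoint[symmetric]) (auto intro!: sum.cong)
      then consider "1/2 * V x R \<le> (\<Sum>z\<in>Hi. m z)" | "1/2 * V x R \<le> (\<Sum>z\<in>Lo. m z)" by linarith
      then show ?thesis
      proof cases
        case 1
        define u where "u z = (f z - lo) + F * E z" for z
        have low: "\<delta> * (w / 2) \<le> u z" if z: "z \<in> B x R" for z
        proof (rule wh[of R "w / 2" x u z, OF R w2])
          fix v assume "v \<in> B x (17 * R + 1)"
          then show "0 \<le> u v" using bd[of v] sub E(1)[of v] by (auto simp: u_def)
        next
          fix v assume v: "v \<in> B x (17 * R)"
          have "P u v = P f v - lo + F * (E v - 1)"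
            unfolding u_def P_add P_diff P_cmult using PE[OF v] by simp
          also have "\<dots> = P f v - lo + F * E v - F" by (simp add: right_diff_distrib)
          also have "\<dots> \<le> u v" using fF[of v] by (simp add: u_def)
          finally show "P u v \<le> u v" .
        next
          have "w / 2 \<le> u z" if "z \<in> Hi" for z using that E(1)[of z] by (simp add: Hi_def u_def)
          then have "(\<Sum>z\<in>Hi. m z) \<le> (\<Sum>z\<in>{z \<in> B x R. w / 2 \<le> u z}. m z)"
            by (intro sum_mono2) (auto simp: Hi_def)
          then show "1/2 * V x R \<le> (\<Sum>z\<in>{z \<in> B x R. w / 2 \<le> u z}. m z)" using 1 by linarith
        qed (rule z)
        show ?thesis
        proof (intro exI[of _ "lo + \<delta> * (w / 2) - C * F * R powr b"] ballI conjI)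
          fix z assume z: "z \<in> B x R"
          show "lo + \<delta> * (w / 2) - C * F * R powr b \<le> f z"
            using low[OF z] E(2)[of z] by (simp add: u_def)
          have "f z \<le> lo + w" using bd z sub by blast
          then show "f z \<le> lo + \<delta> * (w / 2) - C * F * R powr b + ((1 - \<delta> / 2) * w + C * F * R powr b)"
            by (simp add: left_diff_distrib)
        qed
      next
        case 2
        define u where "u z = (lo + w - f z) + F * E z" for z
        have low: "\<delta> * (w / 2) \<le> u z" if z: "z \<in> B x R" for z
        proof (rule wh[of R "w / 2" x u z, OF R w2])
          fix v assume "v \<in> B x (17 * R + 1)"
          then show "0 \<le> u v" using bd[of v] sub E(1)[of v] by (auto simp: u_def)
        next
          fix v assume v: "v \<in> B x (17 * R)"
          have "P u v = lo + w - P f v + F * (E v - 1)"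
            unfolding u_def P_add P_diff P_cmult using PE[OF v] by simp
          also have "\<dots> = lo + w - P f v + F * E v - F" by (simp add: right_diff_distrib)
          also have "\<dots> \<le> u v" using fF[of v] by (simp add: u_def)
          finally show "P u v \<le> u v" .
        next
          have "w / 2 \<le> u z" if "z \<in> Lo" for z using that E(1)[of z] by (simp add: Lo_def u_def)
          then have "(\<Sum>z\<in>Lo. m z) \<le> (\<Sum>z\<in>{z \<in> B x R. w / 2 \<le> u z}. m z)"
            by (intro sum_mono2) (auto simp: Lo_def)
          then show "1/2 * V x R \<le> (\<Sum>z\<in>{z \<in> B x R. w / 2 \<le> u z}. m z)" using 2 by linarith
        qed (rule z)
        show ?thesis
        proof (intro exI[of _ lo] ballI conjI)
          fix z assume z: "z \<in> B x R"
          show "lo \<le> f z" using bd z sub by blast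
          show "f z \<le> lo + ((1 - \<delta> / 2) * w + C * F * R powr b)"
            using low[OF z] E(2)[of z] by (simp add: u_def left_diff_distrib)
        qed
      qed
    qed
  qed
  have "\<delta> / 2 > 0" "\<delta> / 2 < 1" using \<delta> by auto
  then show ?thesis by (rule that[OF _ _ C]) (rule main)
qed

text \<open>For \<open>f = h n x + h (n + 1) x\<close> the middle terms of \<open>f - P f\<close>
  cancel and leave \<open>h n x - h (n + 2) x\<close>, which the time regularity makes small. If the
  oscillation near \<open>x\<close> is at most half of the diagonal lower bound, the other half
  survives at \<open>y\<close>.\<close>

lemma near_diagonal_lower:
  obtains \<epsilon> c where "\<epsilon> > 0" "c > 0"
    "\<And>n x y. n \<ge> 1 \<Longrightarrow> real (d x y) \<le> \<epsilon> * real n powr (1 / b) \<Longrightarrow>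
       c * real n powr (- \<gamma>) \<le> h n x y + h (n + 1) x y"
proof -
  obtain c0 where c0: "c0 > 0"
    and diag: "\<And>n x. n \<ge> 1 \<Longrightarrow> c0 * real n powr (- \<gamma>) \<le> h n x x + h (n + 1) x x"
    using h_pair_diagonal_lower by blast
  obtain Cu where Cu: "Cu > 0" and up: "\<And>n x y. n \<ge> 1 \<Longrightarrow> h n x y \<le> Cu * real n powr (- \<gamma>)"
    using h_upper by blast
  obtain Ct where Ct: "Ct > 0"
    and td: "\<And>n x y. n \<ge> 1 \<Longrightarrow> \<bar>h n x y - h (n + 2) x y\<bar> \<le> Ct * real n powr (- 1 - \<gamma>)"
    using h_time_difference by blast
  obtain \<delta> C where \<delta>: "\<delta> > 0" "\<delta> < 1" and C: "C > 0" and osc: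
    "\<And>x R f F lo w. R \<ge> 1 \<Longrightarrow> F \<ge> 0 \<Longrightarrow> w \<ge> 0 \<Longrightarrow> (\<And>z. \<bar>f z - P f z\<bar> \<le> F) \<Longrightarrow>
      (\<And>z. z \<in> B x (18 * R) \<Longrightarrow> lo \<le> f z \<and> f z \<le> lo + w) \<Longrightarrow>
      \<exists>lo'. \<forall>z\<in>B x R. lo' \<le> f z \<and> f z \<le> lo' + ((1 - \<delta>) * w + C * F * R powr b)"
    by (rule oscillation_step) blast
  \<comment> \<open>The error is evaluated at the largest radius \<open>18 ^ j * R\<close>. Division
    by \<open>\<delta>\<close> makes it stable under a step:
    \<open>(1 - \<delta>) * (K / \<delta>) + K = K / \<delta>\<close>.\<close>
  have iter: "\<exists>lo. \<forall>z\<in>B x R. lo \<le> f z \<and> f z \<le> lo + ((1 - \<delta>) ^ j * w + C * F * (18 ^ j * R) powr b / \<delta>)"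
    if F: "F \<ge> 0" and w: "w \<ge> 0" and fF: "\<And>z. \<bar>f z - P f z\<bar> \<le> F" and bd: "\<And>z. 0 \<le> f z \<and> f z \<le> w"
      and R: "R \<ge> 1" for x R f F w j
    using R
  proof (induction j arbitrary: R)
    case 0
    have "0 \<le> C * F * R powr b / \<delta>" using C F \<delta> by simp
    then show ?case using bd by (intro exI[of _ 0]) (auto simp: add_increasing2)
  next
    case (Suc j)
    let ?K = "C * F * (18 ^ Suc j * R) powr b"
    have K: "?K \<ge> 0" using C F by simp
    have e: "18 ^ j * (18 * R) = 18 ^ Suc j * R" by simp
    obtain lo where lo: "\<forall>z\<in>B x (18 * R). lo \<le> f z \<and> f z \<le> lo + ((1 - \<delta>) ^ j * w + ?K / \<delta>)"
      using Suc.IH[of "18 * R"] Suc.prems unfolding e by auto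
    let ?w = "(1 - \<delta>) ^ j * w + ?K / \<delta>"
    have "\<exists>lo'. \<forall>z\<in>B x R. lo' \<le> f z \<and> f z \<le> lo' + ((1 - \<delta>) * ?w + C * F * R powr b)"
      using Suc.prems F w \<delta> K lo by (intro osc[where lo = lo] fF) auto
    then obtain lo' where lo': "\<forall>z\<in>B x R. lo' \<le> f z \<and> f z \<le> lo' + ((1 - \<delta>) * ?w + C * F * R powr b)"
      by blast
    have "(1 - \<delta>) * ?w + C * F * R powr b \<le> (1 - \<delta>) ^ Suc j * w + ?K / \<delta>"
    proof -
      have "1 * R \<le> 18 ^ Suc j * R" using Suc.prems by (intro mult_right_mono one_le_power) auto
      then have "R powr b \<le> (18 ^ Suc j * R) powr b" using Suc.prems ab_pos by (intro powr_mono2) auto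
      then have "C * F * R powr b \<le> ?K" using C F by (intro mult_left_mono) auto
      moreover have "(1 - \<delta>) * ?w = (1 - \<delta>) ^ Suc j * w + (?K / \<delta> - ?K)"
      proof -
        have "(1 - \<delta>) * (K / \<delta>) = K / \<delta> - K" for K using \<delta> by (simp add: field_simps)
        then show ?thesis by (simp only: distrib_left power_Suc mult.assoc)
      qed
      ultimately show ?thesis by linarith
    qed
    then show ?case using lo' by (intro exI[of _ lo']) force
  qed
  \<comment> \<open>Half of the allowed oscillation goes to the defect term. It depends on the outer
    radius \<open>\<epsilon>1 * n powr (1 / b)\<close> and not on the number of iterations, so
    \<open>\<epsilon>1\<close> can be fixed before \<open>j\<close>.\<close>
  define \<epsilon>1 where "\<epsilon>1 = (c0 * \<delta> / (4 * C * Ct)) powr (1 / b)"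
  have \<epsilon>1: "\<epsilon>1 > 0" unfolding \<epsilon>1_def using c0 \<delta> C Ct by simp
  have \<epsilon>1b: "C * Ct * \<epsilon>1 powr b / \<delta> = c0 / 4"
    unfolding \<epsilon>1_def using c0 \<delta> C Ct ab_pos by (simp add: powr_powr)
  obtain j where "(1 - \<delta>) ^ j < c0 / (8 * Cu)"
    using real_arch_pow_inv[of "c0 / (8 * Cu)" "1 - \<delta>"] c0 Cu \<delta> by auto
  then have j: "(1 - \<delta>) ^ j * (2 * Cu) \<le> c0 / 4" using Cu by (simp add: less_divide_eq mult_ac)
  define \<epsilon> where "\<epsilon> = \<epsilon>1 / 18 ^ j"
  have \<epsilon>: "\<epsilon> > 0" using \<epsilon>1 by (simp add: \<epsilon>_def)
  have "c0 / 2 * real n powr (- \<gamma>) \<le> h n x y + h (n + 1) x y"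
    if n: "n \<ge> 1" and dist: "real (d x y) \<le> \<epsilon> * real n powr (1 / b)" for n x y
  proof (cases "\<epsilon> * real n powr (1 / b) \<ge> 1")
    case False
    then have "d x y = 0" using dist by linarith
    then have "x = y" by simp
    moreover have "c0 / 2 * real n powr (- \<gamma>) \<le> c0 * real n powr (- \<gamma>)" using c0 by simp
    ultimately show ?thesis using diag[OF n, of x] by simp
  next
    case True
    define R where "R = \<epsilon> * real n powr (1 / b)"
    define f where "f z = h n x z + h (n + 1) x z" for z
    define F where "F = Ct * real n powr (- 1 - \<gamma>)"
    have Pf: "P f z = h (n+1) x z + h (n+2) x z" for z
    proof -
      have "P f z = P (\<lambda>y. h n y x + h (n+1) y x) z"
        by (rule P_cong) (simp add: f_def h_sym[of _ x])
      also have "\<dots> = P (\<lambda>y. h n y x) z + P (\<lambda>y. h (n+1) y x) z" by (rule P_add)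
      finally show ?thesis using h_Suc[of n z x] h_Suc[of "n+1" z x] by (simp add: h_sym[of _ x])
    qed
    have fF: "\<bar>f z - P f z\<bar> \<le> F" for z
      using td[OF n, of x z] unfolding Pf f_def F_def by simp
    have "real (n + 1) powr (- \<gamma>) \<le> real n powr (- \<gamma>)" using n ab_pos by (intro powr_mono2') auto
    then have "Cu * real (n + 1) powr (- \<gamma>) \<le> Cu * real n powr (- \<gamma>)" using Cu by (intro mult_left_mono) auto
    then have bd: "0 \<le> f z \<and> f z \<le> 2 * Cu * real n powr (- \<gamma>)" for z
      using up[OF n, of x z] up[of "n+1" x z] h_nonneg[of n x z] h_nonneg[of "n+1" x z]
      by (simp add: f_def)
    obtain lo where lo: "\<forall>z\<in>B x R. lo \<le> f z \<and> f z \<le> lo + ((1 - \<delta>) ^ j * (2 * Cu * real n powr (- \<gamma>))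
        + C * F * (18 ^ j * R) powr b / \<delta>)"
      using iter[OF _ _ fF bd, where R = R and j = j and x = x] True Ct Cu by (auto simp: R_def F_def)
    have R18: "18 ^ j * R = \<epsilon>1 * real n powr (1 / b)" by (simp add: R_def \<epsilon>_def)
    have "C * F * (18 ^ j * R) powr b / \<delta> = c0 / 4 * real n powr (- \<gamma>)"
    proof -
      have "(18 ^ j * R) powr b = \<epsilon>1 powr b * real n"
        unfolding R18 using \<epsilon>1 n ab_pos by (simp add: powr_mult powr_powr)
      moreover have "real n powr (- 1 - \<gamma>) * real n = real n powr (- \<gamma>)"
      proof -
        have "- 1 - \<gamma> = - \<gamma> - 1" by simp
        then show ?thesis unfolding \<open>- 1 - \<gamma> = - \<gamma> - 1\<close> powr_diff using n by simp
      qed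
      ultimately have "C * F * (18 ^ j * R) powr b / \<delta> = (C * Ct * \<epsilon>1 powr b / \<delta>) * real n powr (- \<gamma>)"
        by (simp add: F_def mult_ac)
      then show ?thesis unfolding \<epsilon>1b .
    qed
    moreover have "(1 - \<delta>) ^ j * (2 * Cu * real n powr (- \<gamma>)) \<le> c0 / 4 * real n powr (- \<gamma>)"
      using mult_right_mono[OF j, of "real n powr (- \<gamma>)"] by (simp add: mult_ac)
    moreover have "lo \<le> f y" using lo dist by (simp add: mem_B R_def)
    moreover have "f x \<le> lo + ((1 - \<delta>) ^ j * (2 * Cu * real n powr (- \<gamma>)) + C * F * (18 ^ j * R) powr b / \<delta>)"
      using lo True by (simp add: mem_B R_def)
    ultimately have "f x \<le> f y + c0 / 2 * real n powr (- \<gamma>)" by simp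
    moreover have "c0 * real n powr (- \<gamma>) \<le> f x" using diag[OF n, of x] by (simp add: f_def)
    ultimately show ?thesis by (simp add: f_def)
  qed
  then show ?thesis using that[of \<epsilon> "c0 / 2"] \<epsilon> c0 by simp
qed

section \<open>Chaining along geodesics\<close>

definition q :: "nat \<Rightarrow> 'a \<Rightarrow> 'a \<Rightarrow> real" where
  "q n x y = p n x y + p (n + 1) x y"

lemma q_nonneg: "q n x y \<ge> 0"
  unfolding q_def by (intro add_nonneg_nonneg p_nonneg)

lemma p_mult_le: "p i x z * p j z y \<le> p (i + j) x y"
proof -
  have "p i x z * p j z y \<le> (\<Sum>w\<in>insert z (B x (real i)). p i x w * p j w y)"
    by (rule member_le_sum) (auto intro: mult_nonneg_nonneg p_nonneg)
  also have "\<dots> = p (i + j) x y" by (rule p_add[symmetric]) auto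
  finally show ?thesis .
qed

text \<open>Every neighbour steps back with probability at least \<open>p0\<close>. This allows two
  units of time to be spent at the price of a factor \<open>p0\<close>.\<close>

lemma p_2_lower: "p0 \<le> p 2 y y"
proof -
  have "p0 = P (\<lambda>z. p0) y" by simp
  also have "\<dots> \<le> P (\<lambda>z. p 1 z y) y"
    unfolding p_1 using p0 adj_sym by (intro P_mono) auto
  also have "\<dots> = p 2 y y" using p_Suc[of 1 y y] by (simp del: pn.simps add: numeral_2_eq_2)
  finally show ?thesis .
qed

lemma p_plus_2: "p0 * p n x y \<le> p (n + 2) x y"
proof -
  have "p0 * p n x y \<le> p 2 y y * p n x y" by (intro mult_right_mono p_2_lower p_nonneg)
  also have "\<dots> \<le> p (n + 2) x y" using p_mult_le[of n x y 2 y] by (simp add: mult.commute del: pn.simps)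
  finally show ?thesis .
qed

text \<open>The product of two pairs contains the times \<open>i + j\<close>, twice
  \<open>i + j + 1\<close>, and \<open>i + j + 2\<close>. Delaying the earliest term by two steps
  leaves \<open>2 * q (i + j + 1)\<close>, so each link of a chain takes one extra unit of
  time.\<close>

lemma q_convolution:
  assumes "finite Z"
  shows "p0 / 2 * (\<Sum>z\<in>Z. q i x z * q j z y) \<le> q (i + j + 1) x y"
proof -
  let ?Y = "Z \<union> B x (real (i + 1))"
  have Y: "finite ?Y" "B x (real i) \<subseteq> ?Y" "B x (real (i+1)) \<subseteq> ?Y"
    using assms B_mono[of "real i" "real (i+1)" x] by auto
  have "(\<Sum>z\<in>Z. q i x z * q j z y) \<le> (\<Sum>z\<in>?Y. q i x z * q j z y)"
    using Y by (intro sum_mono2) (auto intro: mult_nonneg_nonneg q_nonneg)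
  also have "\<dots> = (\<Sum>z\<in>?Y. p i x z * p j z y) + (\<Sum>z\<in>?Y. p i x z * p (j+1) z y)
     + ((\<Sum>z\<in>?Y. p (i+1) x z * p j z y) + (\<Sum>z\<in>?Y. p (i+1) x z * p (j+1) z y))"
    unfolding q_def sum.distrib[symmetric] by (intro sum.cong) (simp_all add: algebra_simps del: pn.simps)
  also have "\<dots> = p (i+j) x y + p (i+(j+1)) x y + (p (i+1+j) x y + p (i+1+(j+1)) x y)"
    using p_add[OF Y(1) Y(2)] p_add[OF Y(1) Y(3)] by (simp only:)
  also have "\<dots> = p (i+j) x y + 2 * p (i+j+1) x y + p (i+j+2) x y"
  proof -
    have "i + (j + 1) = i + j + 1" "i + 1 + j = i + j + 1" "i + 1 + (j + 1) = i + j + 2" by simp_all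
    then show ?thesis by (simp only:)
  qed
  finally have "p0 * (\<Sum>z\<in>Z. q i x z * q j z y) \<le> p0 * (p (i+j) x y + 2 * p (i+j+1) x y + p (i+j+2) x y)"
    using p0_pos by (intro mult_left_mono) auto
  also have "\<dots> = p0 * p (i+j) x y + p0 * (2 * p (i+j+1) x y + p (i+j+2) x y)" by (simp add: distrib_left)
  also have "\<dots> \<le> p (i+j+2) x y + 1 * (2 * p (i+j+1) x y + p (i+j+2) x y)"
    using p0_le_1 by (intro add_mono p_plus_2 mult_right_mono add_nonneg_nonneg) (auto simp: p_nonneg simp del: pn.simps)
  finally show ?thesis by (simp add: q_def del: pn.simps)
qed

lemma p_distance_lower: "p0 ^ d x y \<le> p (d x y) x y"
proof (induction "d x y" arbitrary: x)
  case 0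
  then have "x = y" by simp
  then show ?case by simp
next
  case (Suc k)
  have "1 \<le> d x y" using Suc.hyps(2) by simp
  then obtain z where z: "d x z = 1" "d z y = d x y - 1" by (rule geodesic_point)
  have k: "k = d z y" using z Suc.hyps(2) by simp
  have "p0 ^ d x y = p0 * p0 ^ d z y"
  proof -
    have "d x y = Suc (d z y)" using Suc.hyps(2) k by simp
    then show ?thesis by simp
  qed
  also have "\<dots> \<le> p 1 x z * p (d z y) z y"
    unfolding p_1 using Suc.hyps(1)[OF k] p0[OF d_1_adj[OF z(1)]] p0_pos ptr_nonneg
    by (intro mult_mono) auto
  also have "\<dots> \<le> p (1 + d z y) x y" by (rule p_mult_le)
  also have "1 + d z y = d x y" using z Suc.hyps(2) by simp
  finally show ?case .
qed

lemma p_plus_even: "p0 ^ i * p n x y \<le> p (n + 2 * i) x y"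
proof (induction i)
  case (Suc i)
  have "p0 ^ Suc i * p n x y \<le> p0 * p (n + 2 * i) x y" using Suc p0_pos by (simp add: mult.assoc)
  also have "\<dots> \<le> p (n + 2 * i + 2) x y" by (rule p_plus_2)
  finally show ?case by (simp add: del: pn.simps)
qed simp

text \<open>Follow a geodesic and spend the remaining time in back-and-forth pairs; one of
  \<open>n\<close> and \<open>n + 1\<close> has the parity of the distance.\<close>

lemma q_path_lower:
  assumes "d x y \<le> n"
  shows "p0 ^ (n + 1) \<le> q n x y"
proof -
  have *: "p0 ^ (n + 1) \<le> p (d x y + 2 * i) x y" if "d x y + 2 * i \<le> n + 1" for i
  proof -
    have "p0 ^ (n + 1) \<le> p0 ^ (i + d x y)" using that p0_pos p0_le_1 by (intro power_decreasing) auto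
    also have "\<dots> = p0 ^ i * p0 ^ d x y" by (rule power_add)
    also have "\<dots> \<le> p0 ^ i * p (d x y) x y" using p0_pos by (intro mult_left_mono p_distance_lower) auto
    also have "\<dots> \<le> p (d x y + 2 * i) x y" by (rule p_plus_even)
    finally show ?thesis .
  qed
  define i where "i = (n + 1 - d x y) div 2"
  have "d x y + 2 * i = n \<or> d x y + 2 * i = n + 1" unfolding i_def using assms by presburger
  then show ?thesis
    using *[of i] p_nonneg[of n x y] p_nonneg[of "n+1" x y] by (auto simp: q_def simp del: pn.simps)
qed

text \<open>Each of the \<open>k\<close> links takes \<open>l + 1\<close> units of time and gains
  distance \<open>s\<close>; the last one uses \<open>n'\<close> units and covers
  \<open>2 * s\<close>. Links end anywhere in a ball of radius \<open>s\<close>, so that each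
  contributes a probability, bounded below by \<open>\<eta>\<close>, instead of a density.\<close>

lemma q_chain_lower:
  obtains \<epsilon> \<eta> c where "\<epsilon> > 0" "0 < \<eta>" "\<eta> \<le> 1" "c > 0"
    "\<And>l s k n' n x y. l \<ge> 1 \<Longrightarrow> s \<ge> 1 \<Longrightarrow> 3 * real s \<le> \<epsilon> * real l powr (1 / b) \<Longrightarrow>
       \<epsilon> * real l powr (1 / b) \<le> 6 * real s \<Longrightarrow> l \<le> n' \<Longrightarrow> n' \<le> 2 * l + 1 \<Longrightarrow>
       d x y \<le> (k + 2) * s \<Longrightarrow> n = k * (l + 1) + n' \<Longrightarrow>
       \<eta> ^ k * c * real n powr (- \<gamma>) \<le> q n x y"
proof -
  obtain \<epsilon> c0 where \<epsilon>: "\<epsilon> > 0" and c0: "c0 > 0" and near: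
    "\<And>n x y. n \<ge> 1 \<Longrightarrow> real (d x y) \<le> \<epsilon> * real n powr (1 / b) \<Longrightarrow>
       c0 * real n powr (- \<gamma>) \<le> h n x y + h (n + 1) x y"
    using near_diagonal_lower by blast
  have qh: "q n x y = m y * (h n x y + h (n + 1) x y)" for n x y
    by (simp add: q_def p_h distrib_left mult.commute del: pn.simps)
  have q_near: "m y * (c0 * real n powr (- \<gamma>)) \<le> q n x y"
    if "n \<ge> 1" "real (d x y) \<le> \<epsilon> * real n powr (1 / b)" for n x y
    unfolding qh by (intro mult_left_mono near that) simp
  \<comment> \<open>\<open>p0 / 2\<close> is lost in the convolution, \<open>c0\<close> comes from
    the near-diagonal bound, and the rest is the volume of a ball of radius
    \<open>s \<ge> \<epsilon> / 6 * l powr (1 / b)\<close> relative to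
    \<open>l powr \<gamma>\<close>.\<close>
  define \<eta> where "\<eta> = min 1 (p0 / 2 * (c0 * (c_vol * (\<epsilon> / 6) powr a)))"
  have \<eta>: "0 < \<eta>" "\<eta> \<le> 1" unfolding \<eta>_def using p0_pos c0 c_vol_pos \<epsilon> by auto
  define c where "c = c_vol * (c0 * 3 powr (- \<gamma>))"
  have c: "c > 0" unfolding c_def using c_vol_pos c0 by simp
  have main: "\<eta> ^ k * c * real n powr (- \<gamma>) \<le> q n x y"
    if l: "l \<ge> 1" and s: "s \<ge> 1" "3 * real s \<le> \<epsilon> * real l powr (1 / b)" "\<epsilon> * real l powr (1 / b) \<le> 6 * real s"
      and n': "l \<le> n'" "n' \<le> 2 * l + 1" and dk: "d x y \<le> (k + 2) * s" and n: "n = k * (l + 1) + n'"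
    for l s k n' n x y
  proof -
    have "\<eta> ^ k * (c * real l powr (- \<gamma>)) \<le> q (k * (l + 1) + n') x y"
      using dk
    proof (induction k arbitrary: x)
      case 0
      have "real l powr (1 / b) \<le> real n' powr (1 / b)" using n' ab_pos by (intro powr_mono2) auto
      then have "\<epsilon> * real l powr (1 / b) \<le> \<epsilon> * real n' powr (1 / b)" using \<epsilon> by simp
      moreover have "real (d x y) \<le> 2 * real s" using 0 by simp
      ultimately have "m y * (c0 * real n' powr (- \<gamma>)) \<le> q n' x y"
        using l n' s by (intro q_near) auto
      moreover have "c_vol * (c0 * (3 * real l) powr (- \<gamma>)) \<le> m y * (c0 * real n' powr (- \<gamma>))"
        using m_lower c0 c_vol_pos l n' ab_pos by (intro mult_mono mult_left_mono powr_mono2') auto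
      moreover have "c_vol * (c0 * (3 * real l) powr (- \<gamma>)) = c * real l powr (- \<gamma>)"
        by (simp add: c_def powr_mult)
      ultimately show ?case by simp
    next
      case (Suc k)
      define L where "L = \<eta> ^ k * (c * real l powr (- \<gamma>))"
      have L: "L \<ge> 0" using \<eta> c by (simp add: L_def)
      obtain w where w: "d x w \<le> 2 * s" "d w y \<le> (k + 1) * s"
      proof (cases "d x y \<le> 2 * s")
        case True
        then show ?thesis using that[of y] by simp
      next
        case False
        then have "2 * s \<le> d x y" by simp
        then obtain w where "d x w = 2 * s" "d w y = d x y - 2 * s" by (rule geodesic_point)
        then show ?thesis using Suc.prems by (intro that[of w]) auto
      qed
      let ?M = "k * (l + 1) + n'"
      have "c0 * real l powr (- \<gamma>) * V w (real s) * L
          = (\<Sum>z\<in>B w (real s). m z * (c0 * real l powr (- \<gamma>)) * L)"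
        by (simp add: V_eq_sum sum_distrib_left sum_distrib_right mult_ac)
      also have "\<dots> \<le> (\<Sum>z\<in>B w (real s). q l x z * q ?M z y)"
      proof (intro sum_mono mult_mono)
        fix z assume z: "z \<in> B w (real s)"
        have "d x z \<le> 3 * s" using z w(1) d_triangle[of x z w] by (simp add: mem_B)
        then have "real (d x z) \<le> 3 * real s" by linarith
        then show "m z * (c0 * real l powr (- \<gamma>)) \<le> q l x z" using l s by (intro q_near) auto
        have "d z y \<le> (k + 2) * s" using z w(2) d_triangle[of z y w] d_sym[of z w] by (simp add: mem_B)
        then show "L \<le> q ?M z y" unfolding L_def by (rule Suc.IH)
      qed (use L q_nonneg in auto)
      finally have "p0 / 2 * (c0 * real l powr (- \<gamma>) * V w (real s) * L)
          \<le> p0 / 2 * (\<Sum>z\<in>B w (real s). q l x z * q ?M z y)"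
        using p0_pos by (intro mult_left_mono) auto
      also have "\<dots> \<le> q (l + ?M + 1) x y" by (rule q_convolution) simp
      also have "l + ?M + 1 = Suc k * (l + 1) + n'" by simp
      finally have 1: "p0 / 2 * (c0 * real l powr (- \<gamma>) * V w (real s) * L) \<le> q (Suc k * (l + 1) + n') x y" .
      have "c_vol * (\<epsilon> / 6) powr a \<le> real l powr (- \<gamma>) * V w (real s)"
      proof -
        have "(\<epsilon> / 6 * real l powr (1 / b)) powr a \<le> real s powr a"
          using s \<epsilon> ab_pos by (intro powr_mono2) auto
        moreover have "(\<epsilon> / 6 * real l powr (1 / b)) powr a = (\<epsilon> / 6) powr a * real l powr \<gamma>"
          unfolding powr_mult powr_powr using \<epsilon> by (simp add: \<gamma>_def)
        ultimately have "c_vol * ((\<epsilon> / 6) powr a * real l powr \<gamma>) \<le> c_vol * real s powr a"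
          using c_vol_pos by simp
        also have "\<dots> \<le> V w (real s)" using s by (intro V_lower) auto
        finally have "real l powr (- \<gamma>) * (c_vol * ((\<epsilon> / 6) powr a * real l powr \<gamma>)) \<le> real l powr (- \<gamma>) * V w (real s)"
          by (intro mult_left_mono) auto
        moreover have "real l powr (- \<gamma>) * real l powr \<gamma> = 1" using l by (simp add: powr_add[symmetric])
        then have "real l powr (- \<gamma>) * (c_vol * ((\<epsilon> / 6) powr a * real l powr \<gamma>)) = c_vol * (\<epsilon> / 6) powr a"
          by (simp add: mult.left_commute)
        ultimately show ?thesis by simp
      qed
      then have "p0 / 2 * (c0 * (c_vol * (\<epsilon> / 6) powr a)) \<le> p0 / 2 * (c0 * (real l powr (- \<gamma>) * V w (real s)))"
        using p0_pos c0 by (intro mult_left_mono) auto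
      then have "\<eta> \<le> p0 / 2 * (c0 * (real l powr (- \<gamma>) * V w (real s)))" by (simp add: \<eta>_def min_le_iff_disj)
      then have "\<eta> * L \<le> p0 / 2 * (c0 * (real l powr (- \<gamma>) * V w (real s))) * L" using L by (rule mult_right_mono)
      then show ?case using 1 by (simp add: L_def mult_ac)
    qed
    moreover have "l \<le> n" using n n' by (metis le_add2 le_trans)
    then have "real n powr (- \<gamma>) \<le> real l powr (- \<gamma>)"
      using l ab_pos by (intro powr_mono2') auto
    then have "\<eta> ^ k * (c * real n powr (- \<gamma>)) \<le> \<eta> ^ k * (c * real l powr (- \<gamma>))"
      using \<eta> c by (intro mult_left_mono) auto
    ultimately show ?thesis unfolding n by (simp add: mult.assoc)
  qed
  show ?thesis by (rule that[OF \<epsilon> \<eta> c]) (rule main)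
qed

text \<open>Three regimes: distances up to order \<open>n powr (1 / b)\<close>, covered by the
  near-diagonal bound; \<open>n\<close> at most a multiple of the distance, covered by single paths;
  and chaining in between.\<close>

lemma subgaussian_lower:
  obtains C c where "C > 0" "c > 0"
    "\<And>n x y. n \<ge> 1 \<Longrightarrow> d x y \<le> n \<Longrightarrow>
       c * real n powr (- \<gamma>) * exp (- C * (real (d x y) powr b / real n) powr (1 / (b - 1)))
       \<le> h n x y + h (n + 1) x y"
proof -
  obtain \<epsilon>1 c1 where \<epsilon>1: "\<epsilon>1 > 0" and c1: "c1 > 0" and near:
    "\<And>n x y. n \<ge> 1 \<Longrightarrow> real (d x y) \<le> \<epsilon>1 * real n powr (1 / b) \<Longrightarrow>
       c1 * real n powr (- \<gamma>) \<le> h n x y + h (n + 1) x y"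
    using near_diagonal_lower by blast
  obtain \<epsilon>2 \<eta> c2 where \<epsilon>2: "\<epsilon>2 > 0" and \<eta>: "0 < \<eta>" "\<eta> \<le> 1" and c2: "c2 > 0" and chain:
    "\<And>l s k n' n x y. l \<ge> 1 \<Longrightarrow> s \<ge> 1 \<Longrightarrow> 3 * real s \<le> \<epsilon>2 * real l powr (1 / b) \<Longrightarrow>
       \<epsilon>2 * real l powr (1 / b) \<le> 6 * real s \<Longrightarrow> l \<le> n' \<Longrightarrow> n' \<le> 2 * l + 1 \<Longrightarrow>
       d x y \<le> (k + 2) * s \<Longrightarrow> n = k * (l + 1) + n' \<Longrightarrow>
       \<eta> ^ k * c2 * real n powr (- \<gamma>) \<le> q n x y"
    by (rule q_chain_lower) blast
  define \<omega> where "\<omega> = 1 / (b - 1)"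
  have \<omega>: "\<omega> > 0" "(b - 1) * \<omega> = 1" using b_ge_2 by (auto simp: \<omega>_def)
  define \<beta> where "\<beta> = b * \<omega>"
  have \<beta>: "\<beta> \<ge> 1" "\<beta> = 1 + \<omega>" using \<omega> b_ge_2 by (simp_all add: \<beta>_def \<omega>_def divide_simps)
  \<comment> \<open>The first bound makes the links long enough for \<open>k + 2\<close> of them to
    cover the distance, the second keeps the link duration below \<open>n / 2\<close>.\<close>
  define \<kappa> where "\<kappa> = min ((\<epsilon>2 / 12) powr \<beta>) ((\<epsilon>1 powr \<beta>) / 2)"
  have \<kappa>: "\<kappa> > 0" "\<kappa> \<le> (\<epsilon>2 / 12) powr \<beta>" "\<kappa> \<le> \<epsilon>1 powr \<beta> / 2" using \<epsilon>1 \<epsilon>2 by (auto simp: \<kappa>_def)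
  \<comment> \<open>Durations of at least \<open>l0\<close> give links of length
    \<open>s \<ge> 1\<close>; \<open>A\<close> is then such that \<open>n > A * D\<close> forces
    \<open>Y \<ge> l0 + 1\<close>.\<close>
  define l0 where "l0 = (3 / \<epsilon>2) powr b"
  define A where "A = ((l0 + 1) / \<kappa>) powr (1 / \<beta>)"
  have l0: "l0 \<ge> 0" by (simp add: l0_def)
  have A: "A > 0" unfolding A_def using l0 \<kappa> by (simp add: add_nonneg_pos)
  \<comment> \<open>The two logarithmic terms pay for the single path and for the \<open>k\<close>
    links respectively; the 1 ensures positivity.\<close>
  define C where "C = A powr \<beta> * ln (1 / p0) + (1 / \<kappa>) * ln (1 / \<eta>) + 1"
  have lnp: "ln (1 / p0) \<ge> 0" "ln (1 / \<eta>) \<ge> 0" using p0_pos p0_le_1 \<eta> by auto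
  have C: "C > 0" "A powr \<beta> * ln (1 / p0) \<le> C" "(1 / \<kappa>) * ln (1 / \<eta>) \<le> C"
    unfolding C_def using lnp \<kappa> by (auto intro!: add_nonneg_pos add_nonneg_nonneg)
  define c where "c = min c1 (min (p0 / CV) (c2 / CV))"
  have c: "c > 0" "c \<le> c1" "c \<le> p0 / CV" "c \<le> c2 / CV"
    unfolding c_def using c1 c2 p0_pos CV1 by auto
  have hq: "K / CV \<le> h n x y + h (n + 1) x y" if "K \<le> q n x y" "K \<ge> 0" for K n x y
  proof -
    have "h n x y + h (n + 1) x y = q n x y / m y" by (simp add: q_def hn_def add_divide_distrib del: pn.simps)
    moreover have "K / CV \<le> q n x y / m y"
      using that m_upper m_pos CV1 q_nonneg by (intro frac_le) auto
    ultimately show ?thesis by simp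
  qed
  have main: "c * real n powr (- \<gamma>) * exp (- C * (real (d x y) powr b / real n) powr \<omega>) \<le> h n x y + h (n + 1) x y"
    if n: "n \<ge> 1" and dn: "d x y \<le> n" for n x y
  proof -
    define D where "D = real (d x y)"
    define X where "X = (D powr b / real n) powr \<omega>"
    have X: "X \<ge> 0" by (simp add: X_def)
    have reduce: "c * real n powr (- \<gamma>) * exp (- C * X) \<le> h n x y + h (n + 1) x y"
      if "K * exp (- C * X) * real n powr (- \<gamma>) \<le> q n x y" "c \<le> K / CV" for K
    proof -
      have "0 < K / CV" using that(2) c(1) by linarith
      then have K: "K \<ge> 0" using CV1 by (simp add: zero_less_divide_iff)
      have "c * (real n powr (- \<gamma>) * exp (- C * X)) \<le> K / CV * (real n powr (- \<gamma>) * exp (- C * X))"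
        using that by (intro mult_right_mono) auto
      also have "\<dots> = (K * exp (- C * X) * real n powr (- \<gamma>)) / CV" by simp
      also have "\<dots> \<le> h n x y + h (n + 1) x y" using that(1) K by (intro hq) auto
      finally show ?thesis by (simp add: mult.assoc)
    qed
    have npow: "real n powr (- \<gamma>) \<le> 1"
      using n ab_pos powr_mono2'[of "- \<gamma>" 1 "real n"] by simp
    show ?thesis
    proof (cases "D \<le> \<epsilon>1 * real n powr (1 / b)")
      case True
      have "exp (- C * X) \<le> 1" using C X by simp
      then have "c * real n powr (- \<gamma>) * exp (- C * X) \<le> c1 * real n powr (- \<gamma>) * 1"
        using c c1 by (intro mult_mono) auto
      then show ?thesis using near[OF n, of x y] True by (simp add: D_def X_def)
    next
      case far: False
      then have D: "D > 0" using \<epsilon>1 by (smt (verit) D_def mult_nonneg_nonneg of_nat_0_le_iff powr_ge_zero)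
      \<comment> \<open>In this form the exponent is, up to a constant, the number of links: the
        total time divided by the link duration \<open>(n / D) powr \<beta>\<close>.\<close>
      have X_eq: "X = real n * (D / real n) powr \<beta>"
      proof -
        have "D powr b / real n = (D / real n) powr b * real n powr (b - 1)"
          using D n by (simp add: powr_divide powr_diff)
        then have "X = ((D / real n) powr b) powr \<omega> * (real n powr (b - 1)) powr \<omega>"
          unfolding X_def by (simp add: powr_mult)
        also have "\<dots> = (D / real n) powr \<beta> * real n" using \<omega> n by (simp add: powr_powr \<beta>_def)
        finally show ?thesis by simp
      qed
      show ?thesis
      proof (cases "real n \<le> A * D")
        case True
        have "1 \<le> A * (D / real n)" using True n by simp
        then have "1 powr \<beta> \<le> (A * (D / real n)) powr \<beta>" using \<beta> by (intro powr_mono2) auto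
        also have "\<dots> = A powr \<beta> * (D / real n) powr \<beta>" by (rule powr_mult)
        finally have "real n * 1 \<le> real n * (A powr \<beta> * (D / real n) powr \<beta>)" by (intro mult_left_mono) auto
        then have nX: "real n \<le> A powr \<beta> * X" by (simp add: X_eq mult_ac)
        have "real n * ln (1 / p0) \<le> A powr \<beta> * X * ln (1 / p0)" using nX lnp(1) by (rule mult_right_mono)
        also have "\<dots> = A powr \<beta> * ln (1 / p0) * X" by simp
        also have "\<dots> \<le> C * X" using C X by (intro mult_right_mono)
        finally have "exp (- C * X) \<le> exp (real n * ln p0)" using p0_pos by (simp add: ln_div)
        also have "\<dots> = p0 ^ n" using p0_pos by (simp add: exp_of_nat_mult)
        finally have "p0 * exp (- C * X) * real n powr (- \<gamma>) \<le> p0 * p0 ^ n * 1"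
          using npow p0_pos by (intro mult_mono) auto
        also have "\<dots> \<le> q n x y" using q_path_lower[OF dn] by simp
        finally show ?thesis using c(3) unfolding D_def[symmetric] X_def[symmetric] by (intro reduce)
      next
        case False
        define Y where "Y = \<kappa> * (real n / D) powr \<beta>"
        define l where "l = nat \<lfloor>Y\<rfloor>"
        have Y0: "Y \<ge> l0 + 1"
        proof -
          have "A \<le> real n / D" using False D by (simp add: le_divide_eq)
          then have "A powr \<beta> \<le> (real n / D) powr \<beta>" using A \<beta> by (intro powr_mono2) auto
          moreover have "A powr \<beta> = (l0 + 1) / \<kappa>" unfolding A_def using \<beta> l0 \<kappa> by (simp add: powr_powr)
          ultimately show ?thesis using \<kappa> by (simp add: Y_def divide_le_eq mult.commute)
        qed
        then have l: "real l \<le> Y" "Y \<le> real l + 1" "real l \<ge> l0" "l \<ge> 1" unfolding l_def using l0 by linarith+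
        have Ytwo: "Y \<le> 2 * real l" using l by linarith
        have Yn: "Y \<le> real n / 2"
        proof -
          have "real n / D \<le> real n / (\<epsilon>1 * real n powr (1 / b))"
            using far D \<epsilon>1 n by (intro divide_left_mono) auto
          also have "\<dots> = real n powr (1 - 1 / b) / \<epsilon>1" using n by (simp add: powr_diff)
          finally have "(real n / D) powr \<beta> \<le> (real n powr (1 - 1 / b) / \<epsilon>1) powr \<beta>"
            using D \<beta> by (intro powr_mono2) auto
          also have "\<dots> = real n / \<epsilon>1 powr \<beta>"
          proof -
            have "(1 - 1 / b) * \<beta> = 1" using ab_pos \<omega> by (simp add: \<beta>_def left_diff_distrib)
            then show ?thesis using \<epsilon>1 n by (simp add: powr_divide powr_powr)
          qed
          finally have "Y \<le> \<epsilon>1 powr \<beta> / 2 * (real n / \<epsilon>1 powr \<beta>)"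
            unfolding Y_def using \<kappa> by (intro mult_mono) auto
          then show ?thesis using \<epsilon>1 by simp
        qed
        have ln2: "2 * l \<le> n" using Yn l by linarith
        define t where "t = \<epsilon>2 * real l powr (1 / b)"
        define s where "s = nat \<lfloor>t / 3\<rfloor>"
        have t3: "t \<ge> 3"
        proof -
          have "l0 powr (1 / b) \<le> real l powr (1 / b)" using l l0 ab_pos by (intro powr_mono2) auto
          moreover have "l0 powr (1 / b) = 3 / \<epsilon>2" unfolding l0_def using \<epsilon>2 ab_pos by (simp add: powr_powr)
          ultimately show ?thesis using \<epsilon>2 by (simp add: t_def divide_le_eq mult.commute)
        qed
        then have "s \<ge> 1" "3 * real s \<le> t" "t / 3 \<le> real s + 1" unfolding s_def by linarith+
        then have s: "s \<ge> 1" "3 * real s \<le> t" "t \<le> 6 * real s" by linarith+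
        \<comment> \<open>One full block is held back and merged with the remainder, so the last
          duration \<open>n'\<close> lies between \<open>l\<close> and
          \<open>2 * l + 1\<close>.\<close>
        define k where "k = n div (l + 1) - 1"
        define n' where "n' = n - k * (l + 1)"
        have "l + 1 \<le> n" using ln2 l by linarith
        then have div1: "n div (l + 1) \<ge> 1" using div_le_mono[of "l + 1" n "l + 1"] by simp
        have nk: "n = (k + 1) * (l + 1) + n mod (l + 1)"
          using div1 by (simp add: k_def del: mult_Suc mult_Suc_right)
        define r where "r = n mod (l + 1)"
        have r: "r < l + 1" by (simp add: r_def)
        have nr: "n = k * (l + 1) + (l + 1 + r)" using nk unfolding r_def[symmetric] by simp
        then have n'r: "n' = l + 1 + r" unfolding n'_def by simp
        have n': "l \<le> n'" "n' \<le> 2 * l + 1" "n = k * (l + 1) + n'" using r n'r nr by simp_all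
        have "(k + 2) * (l + 1) = k * (l + 1) + 2 * (l + 1)" by (rule distrib_right)
        then have nlt: "n < (k + 2) * (l + 1)" unfolding nr using r by (simp only:) simp
        have dk: "d x y \<le> (k + 2) * s"
        proof -
          have YD: "Y powr ((b - 1) / b) \<le> (\<epsilon>2 / 12) * (real n / D)"
          proof -
            have e1: "\<beta> * ((b - 1) / b) = 1" using ab_pos \<omega> by (simp add: \<beta>_def mult.commute)
            have "Y powr ((b - 1) / b) \<le> ((\<epsilon>2 / 12) powr \<beta> * (real n / D) powr \<beta>) powr ((b - 1) / b)"
              unfolding Y_def using \<kappa> b_ge_2 by (intro powr_mono2 mult_right_mono) auto
            also have "\<dots> = (\<epsilon>2 / 12) * (real n / D)"
              unfolding powr_mult powr_powr e1 using \<epsilon>2 D by simp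
            finally show ?thesis .
          qed
          have "real l powr ((b - 1) / b) \<le> Y powr ((b - 1) / b)"
            using l b_ge_2 by (intro powr_mono2) auto
          then have "real l powr ((b - 1) / b) \<le> (\<epsilon>2 / 12) * (real n / D)" using YD by linarith
          then have "real l powr (1 / b) * real l powr ((b - 1) / b) * (12 * D) \<le> real l powr (1 / b) * (\<epsilon>2 / 12 * (real n / D)) * (12 * D)"
            using D by (intro mult_right_mono mult_left_mono) auto
          also have "\<dots> = t * real n" using D by (simp add: t_def)
          also have "real l powr (1 / b) * real l powr ((b - 1) / b) = real l"
          proof -
            have "1 / b + (b - 1) / b = 1" using ab_pos by (simp add: add_divide_distrib[symmetric])
            then show ?thesis using l by (simp add: powr_add[symmetric])
          qed
          finally have "real l * (12 * D) \<le> t * real n" .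
          also have "\<dots> \<le> (6 * real s) * real ((k + 2) * (l + 1))"
            using s nlt by (intro mult_mono) (auto simp del: of_nat_mult)
          also have "\<dots> = 6 * real ((k + 2) * s) * real (l + 1)" by (simp only: of_nat_mult mult_ac)
          also have "\<dots> \<le> 6 * real ((k + 2) * s) * (2 * real l)" using l by (intro mult_left_mono) auto
          finally have "real l * (12 * D) \<le> real l * (12 * real ((k + 2) * s))" by (simp add: mult_ac)
          then have "D \<le> real ((k + 2) * s)" using l by simp
          then show ?thesis unfolding D_def by linarith
        qed
        have kX: "real k \<le> 1 / \<kappa> * X"
        proof -
          have "real k * Y \<le> real k * real (l + 1)" using l by (intro mult_left_mono) auto
          also have "\<dots> \<le> real n" using n'(3) by (metis le_add1 of_nat_le_iff of_nat_mult)
          finally have "real k * (\<kappa> * (real n / D) powr \<beta>) \<le> real n" by (simp add: Y_def)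
          then have "real k * (\<kappa> * (real n / D) powr \<beta>) * (D / real n) powr \<beta> \<le> real n * (D / real n) powr \<beta>"
            by (intro mult_right_mono) auto
          moreover have "(real n / D) powr \<beta> * (D / real n) powr \<beta> = 1"
            using D n by (simp add: powr_divide)
          ultimately have "real k * \<kappa> \<le> X" unfolding X_eq by (simp add: mult.assoc)
          then show ?thesis using \<kappa> by (simp add: le_divide_eq)
        qed
        have "real k * ln (1 / \<eta>) \<le> 1 / \<kappa> * X * ln (1 / \<eta>)" using kX lnp by (intro mult_right_mono)
        also have "\<dots> = 1 / \<kappa> * ln (1 / \<eta>) * X" by simp
        also have "\<dots> \<le> C * X" using C X by (intro mult_right_mono)
        finally have "exp (- C * X) \<le> exp (real k * ln \<eta>)" using \<eta> by (simp add: ln_div)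
        also have "\<dots> = \<eta> ^ k" using \<eta> by (simp add: exp_of_nat_mult)
        finally have "c2 * exp (- C * X) * real n powr (- \<gamma>) \<le> c2 * \<eta> ^ k * real n powr (- \<gamma>)"
          using c2 by (intro mult_right_mono mult_left_mono) auto
        also have "\<dots> = \<eta> ^ k * c2 * real n powr (- \<gamma>)" by simp
        also have "\<dots> \<le> q n x y"
          using l s n' dk by (intro chain[of l s n' x y k n]) (auto simp: t_def)
        finally show ?thesis using c(4) unfolding D_def[symmetric] X_def[symmetric] by (intro reduce)
      qed
    qed
  qed
  show ?thesis by (rule that[OF C(1) c(1)]) (rule main[unfolded \<omega>_def])
qed

section \<open>From powers of \<open>n\<close> to the volume form of the bounds\<close>

lemma V_time:
  assumes "n \<ge> 1"
  shows "c_vol * real n powr \<gamma> \<le> V x (real n powr (1 / b))" "V x (real n powr (1 / b)) \<le> CV * real n powr \<gamma>"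
proof -
  have r: "real n powr (1 / b) \<ge> 1" using assms ab_pos by (intro ge_one_powr_ge_zero) auto
  have e: "(real n powr (1 / b)) powr a = real n powr \<gamma>" by (simp add: powr_powr \<gamma>_def)
  show "c_vol * real n powr \<gamma> \<le> V x (real n powr (1 / b))"
  proof -
    have "real n powr (1 / b) > 0" using r by linarith
    from V_lower[OF this, of x] show ?thesis unfolding e .
  qed
  show "V x (real n powr (1 / b)) \<le> CV * real n powr \<gamma>" using V_upper[OF r, of x] e by simp
qed

lemma exponent_rescale:
  assumes "C > 0" "D \<ge> 0"
  shows "(D / (C * real n)) powr (1 / (b - 1)) = C powr (- 1 / (b - 1)) * (D / real n) powr (1 / (b - 1))"
proof -
  have "D / (C * real n) = (1 / C) * (D / real n)" by simp
  also have "\<dots> powr (1 / (b - 1)) = (1 / C) powr (1 / (b - 1)) * (D / real n) powr (1 / (b - 1))"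
    by (rule powr_mult)
  also have "(1 / C) powr (1 / (b - 1)) = C powr (- 1 / (b - 1))"
    using assms by (simp add: powr_divide powr_minus_divide)
  finally show ?thesis .
qed

lemma heat_kernel_upper:
  "\<exists>C>0. \<forall>n\<ge>1. \<forall>x y. h n x y \<le> C / V x (real n powr (1 / b)) *
     exp (- ((real (d x y) powr b / (C * real n)) powr (1 / (b - 1))))"
proof -
  obtain C1 c1 where C1: "C1 > 0" and c1: "c1 > 0" and up:
    "\<And>n x y. n \<ge> 1 \<Longrightarrow>
       h n x y \<le> C1 * real n powr (- \<gamma>) * exp (- c1 * (real (d x y) powr b / real n) powr (1 / (b - 1)))"
    by (rule off_diagonal_upper) blast
  have b1: "b - 1 > 0" using b_ge_2 by simp
  \<comment> \<open>A single constant serves in the prefactor and inside the exponent, where it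
    enters as \<open>C powr (- 1 / (b - 1))\<close>, decreasing in \<open>C\<close>. Enlarging it
    weakens both, so the maximum of the two requirements works.\<close>
  define C where "C = max (C1 * CV) (c1 powr (- (b - 1)))"
  have C: "C > 0" unfolding C_def using c1 by (simp add: less_max_iff_disj)
  have Cc: "C powr (- 1 / (b - 1)) \<le> c1"
  proof -
    have "C powr (- 1 / (b - 1)) \<le> (c1 powr (- (b - 1))) powr (- 1 / (b - 1))"
      using c1 b1 by (intro powr_mono2') (auto simp: C_def)
    also have "\<dots> = c1 powr 1"
    proof -
      have "- (b - 1) * (- 1 / (b - 1)) = 1" using b1 by (simp add: field_simps)
      then show ?thesis by (simp only: powr_powr)
    qed
    also have "\<dots> = c1" using c1 by simp
    finally show ?thesis .
  qed
  have "h n x y \<le> C / V x (real n powr (1 / b)) * exp (- ((real (d x y) powr b / (C * real n)) powr (1 / (b - 1))))"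
    if n: "n \<ge> 1" for n x y
  proof -
    let ?X = "(real (d x y) powr b / real n) powr (1 / (b - 1))"
    let ?V = "V x (real n powr (1 / b))"
    have V: "?V > 0" by (rule V_pos) simp
    have "real n powr \<gamma> > 0" using n by simp
    then have "real n powr (- \<gamma>) = CV / (CV * real n powr \<gamma>)" using CV1 by (simp add: powr_minus_divide)
    also have "\<dots> \<le> CV / ?V" using V_time(2)[OF n, of x] V CV1 by (intro divide_left_mono) auto
    finally have "C1 * real n powr (- \<gamma>) \<le> C1 * (CV / ?V)" using C1 by (intro mult_left_mono) auto
    also have "\<dots> \<le> C / ?V" using V by (simp add: C_def divide_right_mono)
    finally have 1: "C1 * real n powr (- \<gamma>) \<le> C / ?V" .
    have "C powr (- 1 / (b - 1)) * ?X \<le> c1 * ?X" by (intro mult_right_mono Cc) simp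
    then have "exp (- c1 * ?X) \<le> exp (- ((real (d x y) powr b / (C * real n)) powr (1 / (b - 1))))"
      using exponent_rescale[OF C, of "real (d x y) powr b" n] by simp
    then have "C1 * real n powr (- \<gamma>) * exp (- c1 * ?X)
       \<le> C / ?V * exp (- ((real (d x y) powr b / (C * real n)) powr (1 / (b - 1))))"
      using 1 C V by (intro mult_mono) auto
    then show ?thesis using up[OF n, of x y] by linarith
  qed
  then show ?thesis using C by blast
qed

lemma heat_kernel_lower:
  "\<exists>c>0. \<forall>x y. \<forall>n. n \<ge> max 1 (d x y) \<longrightarrow>
     h n x y + h (Suc n) x y \<ge> c / V x (real n powr (1 / b)) *
       exp (- ((real (d x y) powr b / (c * real n)) powr (1 / (b - 1))))"
proof -
  obtain C1 c1 where C1: "C1 > 0" and c1: "c1 > 0" and low: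
    "\<And>n x y. n \<ge> 1 \<Longrightarrow> d x y \<le> n \<Longrightarrow>
       c1 * real n powr (- \<gamma>) * exp (- C1 * (real (d x y) powr b / real n) powr (1 / (b - 1)))
       \<le> h n x y + h (n + 1) x y"
    by (rule subgaussian_lower) blast
  have b1: "b - 1 > 0" using b_ge_2 by simp
  \<comment> \<open>Both roles of the constant now call for a small value, since a smaller
    \<open>c\<close> lowers the prefactor and enlarges the exponent.\<close>
  define c where "c = min (c1 * c_vol) (C1 powr (- (b - 1)))"
  have c: "c > 0" unfolding c_def using C1 c1 c_vol_pos by simp
  have Cc: "C1 \<le> c powr (- 1 / (b - 1))"
  proof -
    have "C1 = C1 powr 1" using C1 by simp
    also have "\<dots> = (C1 powr (- (b - 1))) powr (- 1 / (b - 1))"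
    proof -
      have "- (b - 1) * (- 1 / (b - 1)) = 1" using b1 by (simp add: field_simps)
      then show ?thesis by (simp only: powr_powr)
    qed
    also have "\<dots> \<le> c powr (- 1 / (b - 1))"
      using c b1 by (intro powr_mono2') (auto simp: c_def)
    finally show ?thesis .
  qed
  have "c / V x (real n powr (1 / b)) * exp (- ((real (d x y) powr b / (c * real n)) powr (1 / (b - 1))))
      \<le> h n x y + h (Suc n) x y"
    if n: "n \<ge> max 1 (d x y)" for n x y
  proof -
    have n1: "n \<ge> 1" "d x y \<le> n" using n by auto
    let ?X = "(real (d x y) powr b / real n) powr (1 / (b - 1))"
    let ?V = "V x (real n powr (1 / b))"
    have V: "?V > 0" by (rule V_pos) simp
    have pos: "c_vol * real n powr \<gamma> > 0" using n1 c_vol_pos by simp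
    have "c / ?V \<le> c1 * c_vol / ?V" using V by (intro divide_right_mono) (auto simp: c_def)
    also have "\<dots> \<le> c1 * c_vol / (c_vol * real n powr \<gamma>)"
      using V_time(1)[OF n1(1), of x] V pos c1 c_vol_pos by (intro divide_left_mono mult_pos_pos[OF V pos]) auto
    also have "\<dots> = c1 * real n powr (- \<gamma>)" using c_vol_pos by (simp add: powr_minus_divide)
    finally have 1: "c / ?V \<le> c1 * real n powr (- \<gamma>)" .
    have "C1 * ?X \<le> c powr (- 1 / (b - 1)) * ?X" by (intro mult_right_mono Cc) simp
    then have "exp (- ((real (d x y) powr b / (c * real n)) powr (1 / (b - 1)))) \<le> exp (- C1 * ?X)"
      using exponent_rescale[OF c, of "real (d x y) powr b" n] by simp
    then have "c / ?V * exp (- ((real (d x y) powr b / (c * real n)) powr (1 / (b - 1))))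
       \<le> c1 * real n powr (- \<gamma>) * exp (- C1 * ?X)"
      using 1 c1 by (intro mult_mono) auto
    then show ?thesis using low[OF n1] by simp
  qed
  then show ?thesis using c by blast
qed

end

theorem theorem1p1:
  fixes adj :: "'a \<Rightarrow> 'a \<Rightarrow> bool" and mu :: "'a \<Rightarrow> 'a \<Rightarrow> real" and df dw :: real
  assumes "weighted_graph adj mu"
    and "cond_p0 adj mu"
    and "cond_V adj mu df"
    and "cond_PI adj mu dw"
    and "cond_Cap_le adj mu dw"
    and "df < 1 + dw"
  shows "(\<exists>C>0. \<forall>n\<ge>1. \<forall>x y.
            hn adj mu n x y \<le> C / VG adj mu x (real n powr (1 / dw)) *
              exp (- ((real (dG adj x y) powr dw / (C * real n)) powr (1 / (dw - 1)))))
       \<and> (\<exists>c>0. \<forall>x y. \<forall>n. n \<ge> max 1 (dG adj x y) \<longrightarrow>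
            hn adj mu n x y + hn adj mu (Suc n) x y \<ge> c / VG adj mu x (real n powr (1 / dw)) *
              exp (- ((real (dG adj x y) powr dw / (c * real n)) powr (1 / (dw - 1)))))"
proof -
  obtain p0 where p0: "p0 > 0" "\<And>x y. adj x y \<Longrightarrow> p0 \<le> ptr adj mu x y"
    using assms(2) unfolding cond_p0_def by blast
  obtain CV where CV: "CV > 1" "\<And>x r. r \<ge> 1 \<Longrightarrow> r powr df / CV \<le> VG adj mu x r"
    "\<And>x r. r \<ge> 1 \<Longrightarrow> VG adj mu x r \<le> CV * r powr df"
    using assms(3) unfolding cond_V_def by blast
  obtain CP where CP: "CP > 1" and PI: "\<forall>x0. \<forall>r\<ge>0. \<forall>f :: 'a \<Rightarrow> real.
      (\<Sum>x\<in>ball_G adj x0 r. (f x - (\<Sum>x\<in>ball_G adj x0 r. f x * muv adj mu x) / muset adj mu (ball_G adj x0 r))^2 * muv adj mu x)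
          \<le> CP * r powr dw * (\<Sum>(x,y)\<in>{(x,y). x \<in> ball_G adj x0 (2*r) \<and> y \<in> ball_G adj x0 (2*r) \<and> adj x y}.
                (f x - f y)^2 * mu x y)"
    using assms(4) unfolding cond_PI_def Let_def by blast
  obtain CC where CC: "CC > 1" "\<And>x r. r > 0 \<Longrightarrow>
      capG mu (ball_G adj x r) (- ball_G adj x (2 * r)) \<le> ennreal (CC * VG adj mu x r / r powr dw)"
    using assms(5) unfolding cond_Cap_le_def by blast
  interpret hk_graph adj mu df dw p0 CV CP CC
  proof unfold_locales
    fix x0 and r :: real and f :: "'a \<Rightarrow> real"
    assume "r \<ge> 0"
    then show "(\<Sum>x\<in>ball_G adj x0 r. (f x - (\<Sum>x\<in>ball_G adj x0 r. f x * muv adj mu x) / muset adj mu (ball_G adj x0 r))\<^sup>2 * muv adj mu x)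
          \<le> CP * r powr dw * (\<Sum>(x,y)\<in>{(x,y). x \<in> ball_G adj x0 (2*r) \<and> y \<in> ball_G adj x0 (2*r) \<and> adj x y}. (f x - f y)\<^sup>2 * mu x y)"
      using PI by blast
  qed (use assms(1,6) p0 CV CP CC in auto)
  show ?thesis using heat_kernel_upper heat_kernel_lower by blast
qed

end
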